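(* Let $2\le m\le26$, and let the real toll sequence $(t_n)_{n\ge0}$ satisfy $$\text{(a) } t_n=o(\sqrt n)\qquad\text{and}\qquad\text{(b) }\sum_{n\ge1}n^{-1}\max_{n^\delta\le k\le n}\frac{t_k^2}{k}<\infty\ \text{ for some }0<\delta<1 .$$ Let $X_n$ be the corresponding additive functional on $m$-ary search trees on $n$ keys under the random permutation model, with mean $\mu_n$ and variance $\sigma_n^2$. Then $$\mu_n=\mu n+o(\sqrt n),\qquad \mu:=\frac{K_1}{H_m-1},\qquad K_1:=\sum_{j=0}^\infty\frac{t_j}{(j+1)(j+2)},$$ and $$\sigma_n^2=\sigma^2n+o(n),\qquad\sigma^2:=\frac1{H_m-1}\sum_{j=0}^\infty\frac{r_j}{(j+1)(j+2)},$$ where $r_j:=0$ for $0\le j\le m-2$ and $$r_n:=\frac1{\binom n{m-1}}\sum_{\mathbf j}\bigl[t_n+\mu_{j_1}+\cdots+\mu_{j_m}-\mu_n\bigr]^2,\qquad n\ge m-1,$$ the sum $\sum_{\mathbf j}$ being over all $m$-tuples $(j_1,\dots,j_m)$ of nonnegative integers summing to $n-(m-1)$. Moreover, $(X_n-\mu n)/\sqrt n$ converges in distribution to $N(0,\sigma^2)$, and there is convergence of moments of every order.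
   Context: Random permutation model and additive functionals. Fix an integer $m\ge 2$. From a sequence of $n$ distinct keys one builds an $m$-ary search tree $T$ with $|T|=n$ keys: if $n<m$, all keys are stored in the root (for $n=0$ the tree is empty; if $n\le m-1$ all subtrees of the root are empty); if $n\ge m$, the first $m-1$ keys are stored in the root in increasing order $\sigma_1<\dots<\sigma_{m-1}$, and for $1\le j\le m$ the remaining keys lying strictly between $\sigma_{j-1}$ and $\sigma_j$ (with $\sigma_0=-\infty$, $\sigma_m=+\infty$), taken in their original order, recursively form the $j$th subtree $L_j(T)$. Given a real sequence $(t_n)_{n\ge0}$ (toll sequence), the additive functional $f$ is defined by $f(T)=t_{|T|}$ if $0\le |T|\le m-2$ (arbitrary initial values) and $f(T)=\sum_{i=1}^m f(L_i(T))+t_{|T|}$ if $|T|\ge m-1$. $X_n:=f(T_n)$, where $T_n$ is the tree built from a uniformly random permutation of $\{1,\dots,n\}$. $H_m=\sum_{j=1}^m1/j$. $N(0,0)$ is the point mass at $0$. *)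

theory Defs
  imports "HOL-Probability.Probability" "HOL-Combinatorics.Multiset_Permutations"
    "HOL-Library.Landau_Symbols"
begin

section \<open>$m$-ary search trees\<close>

text \<open>A nonempty tree consists of the keys stored in its root and the list of the $m$ subtrees
  of the root.\<close>

datatype 'k mtree = Empty | Node "'k list" "'k mtree list"

text \<open>For increasing \<open>ks = [\<sigma>\<^sub>1, \<dots>, \<sigma>\<^sub>l]\<close> and \<open>0 \<le> j \<le> l\<close>: \<open>x\<close> lies strictly
  between \<open>\<sigma>\<^sub>j\<close> and \<open>\<sigma>\<^sub>j\<^sub>+\<^sub>1\<close>, where the two outermost bounds are infinite.\<close>

definition in_gap :: "'k::linorder list \<Rightarrow> nat \<Rightarrow> 'k \<Rightarrow> bool" where
  "in_gap ks j x \<longleftrightarrow>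
     (j = 0 \<or> ks ! (j - 1) < x) \<and> (j = length ks \<or> x < ks ! j)"

text \<open>The disjunct \<open>m < 2\<close> is only there for termination; such \<open>m\<close> are never used.\<close>

function mst :: "nat \<Rightarrow> 'k::linorder list \<Rightarrow> 'k mtree" where
  "mst m xs =
     (if xs = [] then Empty
      else if length xs < m \<or> m < 2 then Node (sort xs) (replicate m Empty)
      else let ks = sort (take (m - 1) xs)
           in Node ks (map (\<lambda>j. mst m (filter (in_gap ks j) (drop (m - 1) xs))) [0..<m]))"
  by pat_completeness auto
termination
proof (relation "Wellfounded.measure (\<lambda>(m, xs). length xs)", goal_cases)
  case (2 m xs ks j)
  have "length (filter (in_gap ks j) (drop (m - 1) xs)) \<le> length (drop (m - 1) xs)"
    by (rule length_filter_le)
  also have "\<dots> < length xs"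
    using 2 by (simp only: length_drop length_greater_0_conv[symmetric] de_Morgan_disj not_less) linarith
  finally show ?case by simp
qed simp

declare mst.simps [simp del]

fun num_keys :: "'k mtree \<Rightarrow> nat" where
  "num_keys Empty = 0"
| "num_keys (Node ks ts) = length ks + sum_list (map num_keys ts)"

text \<open>The additive functional with toll sequence \<open>t\<close>. The first branch includes the empty tree
  because \<open>m \<ge> 2\<close>.\<close>

fun additive_functional :: "nat \<Rightarrow> (nat \<Rightarrow> real) \<Rightarrow> 'k mtree \<Rightarrow> real" where
  "additive_functional m t Empty = t 0"
| "additive_functional m t (Node ks ts) =
     (if num_keys (Node ks ts) \<le> m - 2 then t (num_keys (Node ks ts))
      else sum_list (map (additive_functional m t) ts) + t (num_keys (Node ks ts)))"


section \<open>The random permutation model\<close>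

definition random_mst :: "nat \<Rightarrow> nat \<Rightarrow> nat mtree pmf" where
  "random_mst m n = map_pmf (mst m) (pmf_of_set (permutations_of_set {1..n}))"

definition X_dist :: "nat \<Rightarrow> (nat \<Rightarrow> real) \<Rightarrow> nat \<Rightarrow> real pmf" where
  "X_dist m t n = map_pmf (additive_functional m t) (random_mst m n)"

definition mean_X :: "nat \<Rightarrow> (nat \<Rightarrow> real) \<Rightarrow> nat \<Rightarrow> real" where
  "mean_X m t n = measure_pmf.expectation (X_dist m t n) (\<lambda>x. x)"

definition var_X :: "nat \<Rightarrow> (nat \<Rightarrow> real) \<Rightarrow> nat \<Rightarrow> real" where
  "var_X m t n = measure_pmf.variance (X_dist m t n) (\<lambda>x. x)"

definition normalized_X :: "nat \<Rightarrow> (nat \<Rightarrow> real) \<Rightarrow> real \<Rightarrow> nat \<Rightarrow> real measure" where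
  "normalized_X m t c n =
     distr (measure_pmf (X_dist m t n)) borel (\<lambda>x. (x - c * real n) / sqrt (real n))"


section \<open>Constants\<close>

definition K1 :: "(nat \<Rightarrow> real) \<Rightarrow> real" where
  "K1 t = (\<Sum>j. t j / (real (j + 1) * real (j + 2)))"

definition mu_const :: "nat \<Rightarrow> (nat \<Rightarrow> real) \<Rightarrow> real" where
  "mu_const m t = K1 t / (harm m - 1)"

definition r_seq :: "nat \<Rightarrow> (nat \<Rightarrow> real) \<Rightarrow> nat \<Rightarrow> real" where
  "r_seq m t n =
     (if n \<le> m - 2 then 0
      else 1 / real (n choose (m - 1)) *
        (\<Sum>js | length js = m \<and> sum_list js = n - (m - 1).
           (t n + sum_list (map (mean_X m t) js) - mean_X m t n)\<^sup>2))"

definition sigma_sq :: "nat \<Rightarrow> (nat \<Rightarrow> real) \<Rightarrow> real" where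
  "sigma_sq m t = 1 / (harm m - 1) * (\<Sum>j. r_seq m t j / (real (j + 1) * real (j + 2)))"

definition window_max :: "(nat \<Rightarrow> real) \<Rightarrow> real \<Rightarrow> nat \<Rightarrow> real" where
  "window_max t \<delta> n =
     Max ((\<lambda>k. (t k)\<^sup>2 / real k) ` {k. real n powr \<delta> \<le> real k \<and> k \<le> n})"

text \<open>Normal distribution given by its mean and its variance \<open>v \<ge> 0\<close>.\<close>

definition normal_dist :: "real \<Rightarrow> real \<Rightarrow> real measure" where
  "normal_dist a v =
     (if v = 0 then return borel a else density lborel (normal_density a (sqrt v)))"

end

theory Submission
  imports Defs "HOL-Computational_Algebra.Fundamental_Theorem_Algebra"
    "HOL-Computational_Algebra.Formal_Power_Series" "HOL-Real_Asymp.Real_Asymp"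
begin

text \<open>A sequence with \<open>a\<^sub>n = b\<^sub>n + E(a(J\<^sub>1) + \<dots> + a(J\<^sub>m))\<close>, for the uniformly random split
  \<open>(J\<^sub>1, \<dots>, J\<^sub>m)\<close> of \<open>n - (m - 1)\<close>, satisfies \<open>\<psi>(\<theta>)(a - b) = m! b\<close> in terms of generating functions,
  where \<open>\<theta> = (1 - z) d/dz\<close> and \<open>\<psi>(x) = x(x + 1)\<dots>(x + m - 2) - m!\<close>. Each factor \<open>\<theta> - \<lambda>\<close> of
  \<open>\<psi>(\<theta>)\<close> is a first-order recurrence. For \<open>Re \<lambda> < 3/2\<close> its solutions inherit \<open>x\<^sub>n = o(\<surd>n)\<close> together
  with \<open>\<Sum> x\<^sub>n\<^sup>2 / n\<^sup>2 < \<infinity>\<close>, and likewise \<open>\<Sum> |x\<^sub>n| / n\<^sup>2 < \<infinity>\<close>; the simple root \<open>2\<close> contributes the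
  linear term; and for \<open>m \<le> 26\<close> all other roots have real part below \<open>3/2\<close>. This gives the mean, and
  then the variance with \<open>b = r\<close>. Condition (b) supplies \<open>\<Sum> t\<^sub>n\<^sup>2 / n\<^sup>2 < \<infinity>\<close>.

  The central moments of order \<open>k \<ge> 3\<close> are found by induction on \<open>k\<close>: the independence of the subtrees
  and the convolution identity for normal moments show that the deviation \<open>e\<^sub>n\<close> of the \<open>k\<close>th moment
  from that of \<open>N(0, \<sigma>\<^sup>2 (n + 1))\<close> satisfies \<open>|e\<^sub>n| \<le> E(|e(J\<^sub>1)| + \<dots> + |e(J\<^sub>m)|) + o(n\<^sup>k\<^sup>/\<^sup>2)\<close>, which is a
  contraction at the scale \<open>n\<^sup>k\<^sup>/\<^sup>2\<close>. Normal moments grow slowly enough for their convergence to give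
  convergence of the characteristic functions.\<close>

section \<open>Polynomials in the operator $(1-z)\,d/dz$\<close>

unbundle no vec_syntax
unbundle fps_syntax

text \<open>A solution of (\<theta> - \<lambda>) F = 0 has coefficients of order n^(Re \<lambda> -
  1), so 3/2 is the real part at which a root begins to compete with sqrt n. A conjugate pair of
  roots crosses this line between m = 26 and m = 27, which is why the numerical margins are narrow.
  The bound o(sqrt n) alone would not make the series for \<sigma>^2 converge: r is quadratic in the
  deviations of the mean from its linear part, so square-summability has to be carried through every
  factor as well. The equation is solved for a - b because the first m - 1 values of a are free: a -
  b vanishes there, and no boundary terms enter. Linear parts are written with n + 1 because
  \<theta> - 2 annihilates that sequence and because the subtree sizes, each increased by 1, add up
  to n + 1. For the same reason the mean and the variance are out of reach of a contraction:
  averaging over splits reproduces n + 1 with factor exactly 1. Only from order 3 on is n^(k/2)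
  convex enough for a factor below 1.\<close>

definition fps_theta :: "'a::comm_ring_1 fps \<Rightarrow> 'a fps" where
  "fps_theta F = (1 - fps_X) * fps_deriv F"

lemma fps_theta_nth:
  "fps_theta F $ n = of_nat (n + 1) * F $ (n + 1) - of_nat n * F $ n"
  by (cases n) (simp_all add: fps_theta_def algebra_simps)

lemma fps_theta_0 [simp]: "fps_theta 0 = 0"
  by (simp add: fps_theta_def)

lemma fps_theta_add: "fps_theta (F + G) = fps_theta F + fps_theta G"
  by (simp add: fps_theta_def algebra_simps)

lemma fps_theta_const_mult: "fps_theta (fps_const c * F) = fps_const c * fps_theta F"
  by (simp add: fps_theta_def algebra_simps)

text \<open>Horner form of a polynomial in the operator \<theta>. Products of polynomials become
  compositions of operators, so a factorization over the complex numbers can be inverted one linear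
  factor at a time.\<close>

definition theta_poly :: "'a::comm_ring_1 poly \<Rightarrow> 'a fps \<Rightarrow> 'a fps" where
  "theta_poly p = fold_coeffs (\<lambda>a f F. fps_const a * F + fps_theta (f F)) p (\<lambda>F. 0)"

lemma theta_poly_0 [simp]: "theta_poly 0 F = 0"
  by (simp add: theta_poly_def)

lemma theta_poly_pCons [simp]:
  "theta_poly (pCons a p) F = fps_const a * F + fps_theta (theta_poly p F)"
  by (cases "p = 0 \<and> a = 0") (auto simp add: theta_poly_def)

lemma theta_poly_add: "theta_poly (p + q) F = theta_poly p F + theta_poly q F"
proof (induction p arbitrary: q)
  case (pCons a p)
  then show ?case
    by (cases q) (auto simp: fps_theta_add algebra_simps simp flip: fps_const_add)
qed simp

lemma theta_poly_smult: "theta_poly (smult c p) F = fps_const c * theta_poly p F"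
  by (induction p)
     (auto simp: fps_theta_const_mult algebra_simps simp flip: fps_const_mult)

lemma theta_poly_mult: "theta_poly (p * q) F = theta_poly p (theta_poly q F)"
  by (induction p) (auto simp: theta_poly_add theta_poly_smult)

lemma theta_poly_1 [simp]: "theta_poly 1 F = F"
  by (simp add: one_pCons)

definition rising_poly :: "nat \<Rightarrow> 'a::comm_ring_1 poly" where
  "rising_poly k = (\<Prod>i<k. [:of_nat i, 1:])"

text \<open>Applying \<theta> to (1 - z)^k D^k F gives (1 - z)^(k + 1) D^(k + 1) F - k (1 - z)^k D^k
  F, so \<theta> + k raises the order by one without a remainder.\<close>

lemma theta_poly_rising:
  "theta_poly (rising_poly k) F = (1 - fps_X) ^ k * (fps_deriv ^^ k) F"
proof (induction k)
  case (Suc k)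
  have deriv: "fps_deriv ((1 - fps_X) ^ k) = (- of_nat k * (1 - fps_X) ^ (k - 1) :: 'a fps)"
    by (simp add: fps_deriv_power algebra_simps flip: fps_of_nat)
  have absorb: "of_nat k * ((1 - fps_X) * (1 - fps_X) ^ (k - 1 :: nat)) =
      of_nat k * (1 - fps_X :: 'a fps) ^ k"
    by (cases k) auto
  have "theta_poly (rising_poly (Suc k)) F =
    theta_poly [:of_nat k, 1:] (theta_poly (rising_poly k) F)"
    by (simp add: rising_poly_def theta_poly_mult mult.commute flip: theta_poly_mult del: theta_poly_pCons)
  also have "\<dots> = of_nat k * ((1 - fps_X) ^ k * (fps_deriv ^^ k) F)
     + (1 - fps_X) * fps_deriv ((1 - fps_X) ^ k * (fps_deriv ^^ k) F)"
    by (simp add: Suc fps_theta_def fps_of_nat)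
  also have "(1 - fps_X) * fps_deriv ((1 - fps_X) ^ k * (fps_deriv ^^ k) F) =
     (1 - fps_X) ^ Suc k * (fps_deriv ^^ Suc k) F
      - (of_nat k * ((1 - fps_X) * (1 - fps_X) ^ (k - 1 :: nat))) * (fps_deriv ^^ k) F"
    by (simp add: deriv algebra_simps)
  also have "\<dots> = (1 - fps_X) ^ Suc k * (fps_deriv ^^ Suc k) F
      - of_nat k * ((1 - fps_X) ^ k * (fps_deriv ^^ k) F)"
    unfolding absorb by (simp only: mult.assoc)
  finally show ?case by (simp only: add_diff_eq add_diff_cancel_left')
qed (simp add: rising_poly_def)

lemma fps_nth_deriv_iter:
  "(fps_deriv ^^ k) F $ n = of_nat (fact k * ((n + k) choose k)) * F $ (n + k)"
proof (induction k arbitrary: n)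
  case (Suc k)
  have "(n + 1) * (fact k * ((n + 1 + k) choose k)) = fact (Suc k) * ((n + Suc k) choose Suc k)"
  proof -
    have "(n + 1) * ((n + 1 + k) choose k) = Suc k * ((n + 1 + k) choose Suc k)"
      using binomial_absorb_comp[of "n + 1 + k" k] binomial_absorption[of k "n + 1 + k"]
      by simp
    thus ?thesis by (simp add: algebra_simps)
  qed
  hence "of_nat (n + 1) * (of_nat (fact k * ((n + 1 + k) choose k)) :: 'a)
     = of_nat (fact (Suc k) * ((n + Suc k) choose Suc k))"
    by (simp only: of_nat_mult[symmetric])
  thus ?case using Suc[of "n + 1"]
    by (simp add: mult.assoc[symmetric])
qed simp

section \<open>Weak compositions and averages over splits\<close>

definition comps :: "nat \<Rightarrow> nat \<Rightarrow> nat list set" where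
  "comps m N = {js. length js = m \<and> sum_list js = N}"

lemma comps_0: "comps 0 N = (if N = 0 then {[]} else {})"
  by (auto simp: comps_def)

lemma comps_Suc: "comps (Suc m) N = (\<lambda>(j, js). j # js) ` (SIGMA j:{..N}. comps m (N - j))"
  by (auto simp: comps_def length_Suc_conv image_iff)

lemma finite_comps [simp]: "finite (comps m N)"
  by (induction m arbitrary: N) (auto simp: comps_0 comps_Suc)

lemma sum_comps_Suc:
  "(\<Sum>js\<in>comps (Suc m) N. g js) = (\<Sum>j\<le>N. \<Sum>js\<in>comps m (N - j). g (j # js))"
  unfolding comps_Suc
  by (subst sum.reindex) (auto simp: inj_on_def sum.Sigma o_def split_def)

lemma card_comps: "card (comps m N) = (N + m - 1) choose N"
  unfolding comps_def by (rule card_length_sum_list)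

lemma fps_card_comps:
  "Abs_fps (\<lambda>N. of_nat (card (comps m N))) = (Abs_fps (\<lambda>_. 1) ^ m :: 'a::comm_ring_1 fps)"
proof (induction m)
  case (Suc m)
  have "of_nat (card (comps (Suc m) N)) = (\<Sum>j=0..N. of_nat (card (comps m (N - j))) :: 'a)" for N
    using sum_comps_Suc[of "\<lambda>_. 1::nat" m N] by (simp add: atLeast0AtMost)
  thus ?case
    by (subst power_Suc, subst Suc[symmetric]) (auto simp: fps_eq_iff fps_mult_nth)
qed (auto simp: comps_0 fps_eq_iff fps_one_def)

text \<open>Each of the m positions contributes the series of \<open>a\<close>, times 1 / (1 - z)
  for each of the other m - 1 positions.\<close>

lemma fps_sum_comps:
  fixes a :: "nat \<Rightarrow> 'a::comm_ring_1"
  shows "Abs_fps (\<lambda>N. \<Sum>js\<in>comps m N. sum_list (map a js)) =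
    of_nat m * Abs_fps a * Abs_fps (\<lambda>_. 1) ^ (m - 1)"
proof (induction m)
  case 0
  show ?case by (auto simp: comps_0 fps_eq_iff)
next
  case (Suc m)
  let ?U = "Abs_fps (\<lambda>_. 1) :: 'a fps"
  let ?S = "Abs_fps (\<lambda>N. \<Sum>js\<in>comps m N. sum_list (map a js))"
  have "Abs_fps (\<lambda>N. \<Sum>js\<in>comps (Suc m) N. sum_list (map a js)) =
      Abs_fps a * Abs_fps (\<lambda>N. of_nat (card (comps m N))) + ?U * ?S"
    by (auto simp: fps_eq_iff sum_comps_Suc sum.distrib fps_mult_nth atLeast0AtMost mult.commute)
  also have "\<dots> = Abs_fps a * ?U ^ m + ?U * (of_nat m * Abs_fps a * ?U ^ (m - 1))"
    by (simp add: Suc fps_card_comps)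
  also have "\<dots> = of_nat (Suc m) * Abs_fps a * ?U ^ (Suc m - 1)"
    by (cases m) (simp_all add: algebra_simps)
  finally show ?case .
qed

text \<open>The expectation of \<open>a(J\<^sub>1) + \<dots> + a(J\<^sub>m)\<close>, and \<open>0\<close> by convention for \<open>n < m - 1\<close>, where the initial values are free.\<close>

definition split_avg :: "nat \<Rightarrow> (nat \<Rightarrow> 'a::field_char_0) \<Rightarrow> nat \<Rightarrow> 'a" where
  "split_avg m a n = (if n < m - 1 then 0
     else (\<Sum>js\<in>comps m (n - (m - 1)). sum_list (map a js)) / of_nat (n choose (m - 1)))"

lemma geo_inverse: "(1 - fps_X) * Abs_fps (\<lambda>_. 1) = (1 :: 'a::comm_ring_1 fps)"
proof (rule fps_ext)
  fix n show "((1 - fps_X) * Abs_fps (\<lambda>_. 1)) $ n = (1 :: 'a fps) $ n"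
    by (cases n) (simp_all add: left_diff_distrib)
qed

text \<open>Multiplying coefficients by \<open>n choose (m - 1)\<close> amounts, up to (m - 1)!, to
  an (m - 1)-fold derivative. It leaves m a(z) / (1 - z)^(m - 1), whose denominator is cancelled by
  the power of 1 - z in \<open>theta_poly_rising\<close>.\<close>

lemma theta_poly_split_avg:
  assumes "m \<ge> 1"
  shows "theta_poly (rising_poly (m - 1)) (Abs_fps (split_avg m a)) =
           fps_const (fact m) * Abs_fps (a :: nat \<Rightarrow> 'a::field_char_0)"
proof -
  have "(fps_deriv ^^ (m - 1)) (Abs_fps (split_avg m a)) =
      fps_const (fact (m - 1)) * Abs_fps (\<lambda>N. \<Sum>js\<in>comps m N. sum_list (map a js))"
    by (rule fps_ext) (simp add: fps_nth_deriv_iter split_avg_def)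
  also have "\<dots> = fps_const (fact m) * Abs_fps a * Abs_fps (\<lambda>_. 1) ^ (m - 1)"
  proof -
    have "fact m = (of_nat m * fact (m - 1) :: 'a)" using assms by (intro fact_reduce) auto
    thus ?thesis unfolding fps_sum_comps
      by (simp add: algebra_simps flip: fps_of_nat fps_const_mult)
  qed
  finally have *: "(fps_deriv ^^ (m - 1)) (Abs_fps (split_avg m a)) =
     fps_const (fact m) * Abs_fps a * Abs_fps (\<lambda>_. 1) ^ (m - 1)" .
  have "theta_poly (rising_poly (m - 1)) (Abs_fps (split_avg m a)) =
     fps_const (fact m) * Abs_fps a * ((1 - fps_X) * Abs_fps (\<lambda>_. 1)) ^ (m - 1)"
    unfolding theta_poly_rising * power_mult_distrib by (simp only: mult_ac)
  thus ?thesis by (simp add: geo_inverse)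
qed

section \<open>First-order recurrences\<close>

text \<open>The weight of the series in \<open>K1\<close> and \<open>sigma_sq\<close>. Dividing the
  recurrence for the root 2 by (n + 1) (n + 2) makes it telescope in F_n / (n + 1).\<close>

definition weight :: "nat \<Rightarrow> real" where "weight n = 1 / (real (n + 1) * real (n + 2))"

lemma summable_imp_vanishing_harmonic:
  fixes v :: "nat \<Rightarrow> real"
  assumes "\<And>n. v n \<ge> 0" "v \<longlonglongrightarrow> L" "summable (\<lambda>n. v n / real (n + 2))"
  shows "L = 0"
proof (rule ccontr)
  assume "L \<noteq> 0"
  moreover have "L \<ge> 0" using assms(1,2) by (meson LIMSEQ_le_const)
  ultimately have "L > 0" by simp
  hence "eventually (\<lambda>n. v n > L / 2) sequentially"
    using assms(2) by (intro order_tendstoD) auto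
  then have ev: "eventually (\<lambda>n. norm (1 / real (n + 2)) \<le> (2 / L) * (v n / real (n + 2))) sequentially"
  proof eventually_elim
    case (elim n)
    have "1 / real (n + 2) \<le> ((2 / L) * v n) / real (n + 2)"
      using elim \<open>L > 0\<close> by (intro divide_right_mono) (auto simp: field_simps)
    thus ?case by simp
  qed
  have "summable (\<lambda>n. 1 / real (n + 2))"
    by (rule summable_comparison_test_ev[OF ev]) (intro summable_mult assms)
  hence "summable (\<lambda>n. 1 / real n)"
    using summable_iff_shift[of "\<lambda>n. 1 / real n" 2] by simp
  thus False using not_summable_harmonic[where 'a = real] by (simp add: inverse_eq_divide)
qed

text \<open>Summing the recursion bounds the total loss, c times the sum of v n / (n + 2), by the
  initial value plus the total forcing. Convergence of v follows by monotonicity, and a nonzero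
  limit would contradict the divergence of the harmonic series.\<close>

lemma damped_recursion_summable:
  fixes v q :: "nat \<Rightarrow> real"
  assumes nonneg: "\<And>n. v n \<ge> 0" "\<And>n. q n \<ge> 0" and "c > 0" "C \<ge> 0"
    and rec: "eventually (\<lambda>n. v (n + 1) \<le> (1 - c / real (n + 2)) * v n + C * q n / real (n + 2)) sequentially"
    and q: "summable (\<lambda>n. q n / real (n + 2))"
  shows "summable (\<lambda>n. v n / real (n + 2))" and "v \<longlonglongrightarrow> 0"
proof -
  obtain N where N: "\<And>n. n \<ge> N \<Longrightarrow> v (n + 1) \<le> (1 - c / real (n + 2)) * v n + C * q n / real (n + 2)"
    using rec by (auto simp: eventually_sequentially)
  define e where "e n = C * (q (n + N) / real (n + N + 2))" for n
  have e: "summable e" unfolding e_def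
    using q summable_iff_shift[of "\<lambda>n. q n / real (n + 2)" N] by (intro summable_mult) simp
  have e0: "e n \<ge> 0" for n unfolding e_def using assms by auto
  have step: "v (Suc n + N) \<le> v (n + N) - c * (v (n + N) / real (n + N + 2)) + e n" for n
    using N[of "n + N"] by (simp add: e_def algebra_simps)
  have bnd: "v (n + N) + (\<Sum>i<n. c * (v (i + N) / real (i + N + 2))) \<le> v N + (\<Sum>i<n. e i)" for n
  proof (induction n)
    case (Suc n)
    show ?case using Suc step[of n] by simp
  qed simp
  have "summable (\<lambda>i. c * (v (i + N) / real (i + N + 2)))"
  proof (rule bounded_imp_summable)
    fix n
    have "(\<Sum>i<Suc n. e i) \<le> suminf e" by (intro sum_le_suminf e e0 finite_lessThan)
    moreover have "(\<Sum>i<Suc n. c * (v (i + N) / real (i + N + 2))) \<le> v N + (\<Sum>i<Suc n. e i)"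
      using bnd[of "Suc n"] nonneg(1)[of "Suc n + N"] by linarith
    ultimately show "(\<Sum>i\<le>n. c * (v (i + N) / real (i + N + 2))) \<le> v N + suminf e"
      by (simp add: lessThan_Suc_atMost)
  qed (use \<open>c > 0\<close> nonneg in auto)
  hence "summable (\<lambda>i. v (i + N) / real (i + N + 2))"
    using \<open>c > 0\<close> by (simp add: summable_cmult_iff del: times_divide_eq_right)
  thus sv: "summable (\<lambda>n. v n / real (n + 2))"
    using summable_iff_shift[of "\<lambda>n. v n / real (n + 2)" N] by simp
  \<comment> \<open>Removing the accumulated forcing leaves a decreasing sequence that is bounded
    below.\<close>
  define z where "z n = v (n + N) - (\<Sum>i<n. e i)" for n
  have "decseq z"
  proof (rule decseq_SucI)
    fix n
    have "c * (v (n + N) / real (n + N + 2)) \<ge> 0" using nonneg(1) \<open>c > 0\<close> by simp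
    with step[of n] show "z (Suc n) \<le> z n" by (simp add: z_def)
  qed
  moreover have "z n \<ge> - suminf e" for n
    using sum_le_suminf[OF e, of "{..<n}"] e0 nonneg(1)[of "n + N"] by (simp add: z_def)
  ultimately obtain L where "z \<longlonglongrightarrow> L" using decseq_convergent by blast
  moreover have "(\<lambda>n. \<Sum>i<n. e i) \<longlonglongrightarrow> suminf e" using e by (rule summable_LIMSEQ)
  ultimately have "(\<lambda>n. z n + (\<Sum>i<n. e i)) \<longlonglongrightarrow> L + suminf e" by (rule tendsto_add)
  hence "(\<lambda>n. v (n + N)) \<longlonglongrightarrow> L + suminf e" by (simp add: z_def)
  hence "v \<longlonglongrightarrow> L + suminf e" by (rule LIMSEQ_offset)
  with summable_imp_vanishing_harmonic[OF nonneg(1) this sv] show "v \<longlonglongrightarrow> 0" by simp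
qed

text \<open>Here the forcing need not be summable. Once C q n < c \<epsilon>, however, the positive
  part of v - \<epsilon> obeys the recursion without forcing, and
  \<open>damped_recursion_summable\<close> applies to it.\<close>

lemma damped_recursion_tendsto_0:
  fixes v q :: "nat \<Rightarrow> real"
  assumes nonneg: "\<And>n. v n \<ge> 0" and "c > 0"
    and rec: "eventually (\<lambda>n. v (n + 1) \<le> (1 - c / real (n + 2)) * v n + C * q n / real (n + 2)) sequentially"
    and q: "q \<longlonglongrightarrow> 0"
  shows "v \<longlonglongrightarrow> 0"
proof (rule order_tendstoI)
  fix b :: real assume "b > 0"
  define \<epsilon> where "\<epsilon> = b / 2"
  have "\<epsilon> > 0" using \<open>b > 0\<close> by (simp add: \<epsilon>_def)
  define p where "p n = max 0 (v n - \<epsilon>)" for n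
  have "(\<lambda>n. C * q n) \<longlonglongrightarrow> 0" using tendsto_mult_right_zero[OF q] .
  hence ev1: "eventually (\<lambda>n. C * q n < c * \<epsilon>) sequentially"
    using \<open>c > 0\<close> \<open>\<epsilon> > 0\<close> by (intro order_tendstoD) auto
  \<comment> \<open>From here on the damping factor is nonnegative, so it preserves
    inequalities.\<close>
  have ev2: "eventually (\<lambda>n. c \<le> real (n + 2)) sequentially"
    using filterlim_real_sequentially eventually_ge_at_top[of c]
    by (auto simp: filterlim_at_top elim!: eventually_mono dest!: spec[of _ c])
  have "eventually (\<lambda>n. p (n + 1) \<le> (1 - c / real (n + 2)) * p n + 0 * 0 / real (n + 2)) sequentially"
    using rec ev1 ev2
  proof eventually_elim
    case (elim n)
    have *: "C * q n / real (n + 2) \<le> c * \<epsilon> / real (n + 2)"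
      using elim(2) by (intro divide_right_mono) auto
    hence "v (n + 1) - \<epsilon> \<le> (1 - c / real (n + 2)) * (v n - \<epsilon>)"
    proof -
      have "c * \<epsilon> / real (n + 2) = \<epsilon> - (1 - c / real (n + 2)) * \<epsilon>"
        by (simp add: algebra_simps)
      with * elim(1) show ?thesis by (simp add: right_diff_distrib)
    qed
    also have "\<dots> \<le> (1 - c / real (n + 2)) * p n"
      using elim(3) by (intro mult_left_mono) (auto simp: p_def)
    finally have "v (n + 1) - \<epsilon> \<le> (1 - c / real (n + 2)) * p n" .
    moreover have "0 \<le> (1 - c / real (n + 2)) * p n"
      using elim(3) by (auto simp: p_def intro!: mult_nonneg_nonneg)
    ultimately show ?case unfolding p_def[of "n + 1"] by simp
  qed
  moreover have "p n \<ge> 0" for n by (simp add: p_def)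
  ultimately have "p \<longlonglongrightarrow> 0"
    using damped_recursion_summable(2)[of p "\<lambda>_. 0" c 0] \<open>c > 0\<close> by simp
  hence "eventually (\<lambda>n. p n < \<epsilon>) sequentially" using \<open>\<epsilon> > 0\<close> by (intro order_tendstoD)
  thus "eventually (\<lambda>n. v n < b) sequentially"
    by eventually_elim (auto simp: p_def \<epsilon>_def max_def split: if_splits)
qed (use nonneg in \<open>auto intro!: always_eventually dest: order_less_le_trans\<close>)

text \<open>For \<open>p = 1, 2\<close> the weighted coefficients of a solution of \<open>(\<theta> - \<lambda>) F = G\<close> satisfy a damped recursion as
  soon as \<open>Re \<lambda> < 3/2\<close>; for \<open>p = 2\<close> this bound is the sharp one.\<close>

definition fps_weighted :: "nat \<Rightarrow> complex fps \<Rightarrow> nat \<Rightarrow> real" where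
  "fps_weighted p F n = cmod (F $ n) ^ p / real (n + 1)"

lemma fps_weighted_nonneg [simp]: "fps_weighted p F n \<ge> 0"
  by (simp add: fps_weighted_def)

text \<open>The modulus of n + l exceeds n + Re l only by a term of order 1/n.\<close>

lemma eventually_norm_shift:
  assumes "Re l < \<rho>"
  shows "eventually (\<lambda>n. cmod (of_nat n + l) \<le> real n + \<rho>) sequentially"
proof -
  define \<delta> where "\<delta> = \<rho> - Re l"
  have "\<delta> > 0" using assms by (simp add: \<delta>_def)
  \<comment> \<open>With \<rho> = Re l + \<delta>, the difference of (n + \<rho>)^2 and (n + Re l)^2
    is \<delta> (2 (n + Re l) + \<delta>); this threshold makes it at least (Im l)^2.\<close>
  have "eventually (\<lambda>n. real n \<ge> \<bar>Re l\<bar> + (Im l)\<^sup>2 / \<delta> + \<bar>\<rho>\<bar>) sequentially"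
    using filterlim_real_sequentially by (auto simp: filterlim_at_top)
  thus ?thesis
  proof eventually_elim
    case (elim n)
    have pos: "(Im l)\<^sup>2 / \<delta> \<ge> 0" using \<open>\<delta> > 0\<close> by simp
    have "(Im l)\<^sup>2 = \<delta> * ((Im l)\<^sup>2 / \<delta>)" using \<open>\<delta> > 0\<close> by simp
    also have "\<dots> \<le> \<delta> * (2 * (real n + Re l) + \<delta>)"
      using elim \<open>\<delta> > 0\<close> pos by (intro mult_left_mono) (auto simp: \<delta>_def)
    finally have "(real n + Re l)\<^sup>2 + (Im l)\<^sup>2 \<le> (real n + \<rho>)\<^sup>2"
      by (simp add: \<delta>_def power2_eq_square algebra_simps)
    moreover have "real n + \<rho> \<ge> 0" using elim pos by linarith
    ultimately show ?case by (auto simp: cmod_def intro: real_le_lsqrt)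
  qed
qed

lemma theta_linear_nth:
  assumes "theta_poly [:-l, 1:] F = (G :: complex fps)"
  shows "of_nat (n + 1) * F $ (n + 1) = (of_nat n + l) * F $ n + G $ n"
proof -
  have "theta_poly [:-l, 1:] F $ n = G $ n" using assms by simp
  thus ?thesis by (simp add: fps_theta_nth algebra_simps)
qed

lemma theta_linear_bound:
  assumes "theta_poly [:-l, 1:] F = G" "Re l < \<rho>"
  shows "eventually (\<lambda>n. real (n + 1) * cmod (F $ (n + 1)) \<le> (real n + \<rho>) * cmod (F $ n) + cmod (G $ n)) sequentially"
  using eventually_norm_shift[OF assms(2)]
proof eventually_elim
  case (elim n)
  have "real (n + 1) * cmod (F $ (n + 1)) = cmod (of_nat (n + 1) * F $ (n + 1))"
    by (simp add: norm_mult del: of_nat_add of_nat_Suc)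
  also have "\<dots> \<le> cmod ((of_nat n + l) * F $ n) + cmod (G $ n)"
    unfolding theta_linear_nth[OF assms(1)] by (rule norm_triangle_ineq)
  also have "cmod ((of_nat n + l) * F $ n) \<le> (real n + \<rho>) * cmod (F $ n)"
    unfolding norm_mult using elim by (intro mult_right_mono) auto
  finally show ?case by simp
qed

lemma divide_recursion_step:
  fixes k l :: real
  assumes "k * X \<le> A * x + B * y" "k > 0" "l > 0"
  shows "X / l \<le> (A / l) * (x / k) + B * (y / k) / l"
proof -
  have "X / l = (k * X) / (k * l)" using assms by simp
  also have "\<dots> \<le> (A * x + B * y) / (k * l)" using assms by (intro divide_right_mono) auto
  also have "\<dots> = (A / l) * (x / k) + B * (y / k) / l"
    by (simp add: add_divide_distrib mult.commute)
  finally show ?thesis .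
qed

lemma theta_linear_weighted_1:
  assumes "theta_poly [:-l, 1:] F = G" "Re l < 3/2"
  shows "eventually (\<lambda>n. fps_weighted 1 F (n + 1) \<le>
    (1 - (1/2) / real (n + 2)) * fps_weighted 1 F n + 1 * fps_weighted 1 G n / real (n + 2)) sequentially"
  using theta_linear_bound[OF assms]
proof eventually_elim
  case (elim n)
  have "cmod (F $ (n + 1)) / real (n + 2) \<le> ((real n + 3/2) / real (n + 2)) * (cmod (F $ n) / real (n + 1))
     + 1 * (cmod (G $ n) / real (n + 1)) / real (n + 2)"
    using elim by (intro divide_recursion_step) auto
  also have "(real n + 3/2) / real (n + 2) = 1 - (1/2) / real (n + 2)"
    by (simp add: field_simps)
  finally show ?case by (simp add: fps_weighted_def)
qed

text \<open>With \<rho> = 3/2 - \<delta>, squaring gives the factor (n + \<rho>)^2 / ((n + 1) (n +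
  2)), about 1 - 2 \<delta> / n. Splitting the cross term 2 u w into squares costs \<delta> of this
  gain, the lower-order terms cost \<delta>/2, and \<delta>/2 remains as damping.\<close>

lemma theta_linear_weighted_2:
  assumes "theta_poly [:-l, 1:] F = G" "Re l < 3/2"
  shows "\<exists>c>0. \<exists>C\<ge>0. eventually (\<lambda>n. fps_weighted 2 F (n + 1) \<le>
    (1 - c / real (n + 2)) * fps_weighted 2 F n + C * fps_weighted 2 G n / real (n + 2)) sequentially"
proof -
  \<comment> \<open>The midpoint between Re l and 3/2, raised to 1 if necessary so that \<delta> is
    at most 1/2.\<close>
  define \<rho> where "\<rho> = max (Re l / 2 + 3/4) 1"
  define \<delta> where "\<delta> = 3/2 - \<rho>"
  have \<rho>: "Re l < \<rho>" "\<rho> < 3/2" "\<rho> \<ge> 1" using assms(2) by (auto simp: \<rho>_def max_def field_simps)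
  have \<delta>_half: "\<delta> \<le> 1/2" using \<rho> by (simp add: \<delta>_def)
  have \<delta>: "\<delta> > 0" "\<rho> = 3/2 - \<delta>" using \<rho> by (auto simp: \<delta>_def)
  \<comment> \<open>From this n on, n \<delta>/2 dominates \<rho> (\<rho> + \<delta>), the constant
    term of (n + \<rho>) (n + \<rho> + \<delta>).\<close>
  have "eventually (\<lambda>n. real n \<ge> \<rho> * (\<rho> + \<delta>) / (\<delta>/2)) sequentially"
    using filterlim_real_sequentially by (auto simp: filterlim_at_top)
  with theta_linear_bound[OF assms(1) \<rho>(1)]
  have "eventually (\<lambda>n. fps_weighted 2 F (n + 1) \<le>
    (1 - \<delta>/2 / real (n + 2)) * fps_weighted 2 F n + (2/\<delta> + 1) * fps_weighted 2 G n / real (n + 2)) sequentially"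
  proof eventually_elim
    case (elim n)
    define u w where "u = cmod (F $ n)" and "w = cmod (G $ n)"
    let ?a = "real n + \<rho>"
    have a: "?a \<ge> 0" using \<rho> by simp
    have uw: "u \<ge> 0" "w \<ge> 0" by (auto simp: u_def w_def)
    have am: "2 * (u * w) \<le> \<delta> * u\<^sup>2 + w\<^sup>2 / \<delta>"
    proof -
      have "0 \<le> (\<delta> * u - w)\<^sup>2 / \<delta>" using \<delta> by simp
      also have "\<dots> = \<delta> * u\<^sup>2 + w\<^sup>2 / \<delta> - 2 * (u * w)"
        using \<delta>(1) by (simp add: field_simps power2_eq_square)
      finally show ?thesis by simp
    qed
    have "(real (n + 1) * cmod (F $ (n + 1)))\<^sup>2 \<le> (?a * u + w)\<^sup>2"
      using elim(1) by (intro power_mono) (auto simp: u_def w_def)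
    also have "\<dots> = ?a\<^sup>2 * u\<^sup>2 + ?a * (2 * (u * w)) + w\<^sup>2"
      by (simp add: power2_eq_square algebra_simps)
    also have "\<dots> \<le> ?a\<^sup>2 * u\<^sup>2 + ?a * (\<delta> * u\<^sup>2 + w\<^sup>2 / \<delta>) + w\<^sup>2"
      using am a by (intro add_mono mult_left_mono) auto
    also have "\<dots> = ?a * (?a + \<delta>) * u\<^sup>2 + (?a / \<delta> + 1) * w\<^sup>2"
      by (simp add: power2_eq_square algebra_simps)
    also have "?a * (?a + \<delta>) * u\<^sup>2 \<le> (real (n + 1) * (real (n + 2) - \<delta>/2)) * u\<^sup>2"
    proof (rule mult_right_mono)
      have "\<rho> * (\<rho> + \<delta>) / (\<delta>/2) * (\<delta>/2) \<le> real n * (\<delta>/2)"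
        using elim(2) \<delta> by (intro mult_right_mono) auto
      hence "\<rho> * (\<rho> + \<delta>) \<le> real n * \<delta> / 2" using \<delta>(1) by simp
      moreover have "\<rho> * (\<rho> + \<delta>) = 9/4 - 3/2 * \<delta>"
        unfolding \<delta>(2) by (simp add: algebra_simps)
      moreover have "?a * (?a + \<delta>) = real n * real n + 3 * real n - real n * \<delta> + 9/4 - 3/2 * \<delta>"
        unfolding \<delta>(2) by (simp add: algebra_simps)
      moreover have "real (n + 1) * (real (n + 2) - \<delta>/2) =
          real n * real n + 3 * real n + 2 - real n * \<delta> / 2 - \<delta> / 2"
        by (simp add: field_simps)
      ultimately show "?a * (?a + \<delta>) \<le> real (n + 1) * (real (n + 2) - \<delta>/2)"
        using \<delta>_half by linarith
    qed simp
    also have "(?a / \<delta> + 1) * w\<^sup>2 \<le> ((2/\<delta> + 1) * real (n + 1)) * w\<^sup>2"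
    proof (rule mult_right_mono)
      have "?a / \<delta> \<le> (2 * real (n + 1)) / \<delta>" using \<rho> \<delta>(1) by (intro divide_right_mono) auto
      thus "?a / \<delta> + 1 \<le> (2/\<delta> + 1) * real (n + 1)" by (simp add: algebra_simps)
    qed simp
    finally have "(real (n + 1) * cmod (F $ (n + 1)))\<^sup>2 \<le>
       real (n + 1) * ((real (n + 2) - \<delta>/2) * u\<^sup>2 + (2/\<delta> + 1) * w\<^sup>2)"
      by (simp add: algebra_simps)
    hence "real (n + 1) * cmod (F $ (n + 1))^2 \<le> (real (n + 2) - \<delta>/2) * u\<^sup>2 + (2/\<delta> + 1) * w\<^sup>2"
      by (simp add: power_mult_distrib power2_eq_square mult_ac)
    hence "cmod (F $ (n + 1))^2 / real (n + 2) \<le>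
       ((real (n + 2) - \<delta>/2) / real (n + 2)) * (u\<^sup>2 / real (n + 1)) + (2/\<delta> + 1) * (w\<^sup>2 / real (n + 1)) / real (n + 2)"
      by (intro divide_recursion_step) auto
    also have "(real (n + 2) - \<delta>/2) / real (n + 2) = 1 - \<delta>/2 / real (n + 2)"
      by (simp add: diff_divide_distrib)
    finally show ?case by (simp add: fps_weighted_def u_def w_def)
  qed
  thus ?thesis using \<delta> by (intro exI[of _ "\<delta>/2"] exI[of _ "2/\<delta> + 1"] conjI) auto
qed

lemma weight_summable_eq: "(\<lambda>n. fps_weighted p F n / real (n + 2)) = (\<lambda>n. cmod (F $ n) ^ p * weight n)"
  by (auto simp: fps_weighted_def weight_def)

definition small1 :: "complex fps \<Rightarrow> bool" where
  "small1 F \<longleftrightarrow> summable (\<lambda>n. cmod (F $ n) * weight n)"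

definition small2 :: "complex fps \<Rightarrow> bool" where
  "small2 F \<longleftrightarrow> (\<lambda>n. cmod (F $ n) ^ 2 / real (n + 1)) \<longlonglongrightarrow> 0
     \<and> summable (\<lambda>n. cmod (F $ n) ^ 2 * weight n)"

lemma theta_linear_small1:
  assumes "theta_poly [:-l, 1:] F = G" "Re l < 3/2" "small1 G"
  shows "small1 F" "(\<lambda>n. cmod (F $ n) / real (n + 1)) \<longlonglongrightarrow> 0"
proof -
  have "summable (\<lambda>n. fps_weighted 1 G n / real (n + 2))"
    using assms(3) unfolding small1_def weight_summable_eq by simp
  note * = damped_recursion_summable[OF _ _ _ _ theta_linear_weighted_1[OF assms(1,2)] this]
  show "small1 F" using *(1) unfolding small1_def weight_summable_eq by simp
  show "(\<lambda>n. cmod (F $ n) / real (n + 1)) \<longlonglongrightarrow> 0" using *(2) by (simp add: fps_weighted_def)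
qed

lemma theta_linear_small2:
  assumes "theta_poly [:-l, 1:] F = G" "Re l < 3/2" "small2 G"
  shows "small2 F"
proof -
  obtain c C where cC: "c > 0" "C \<ge> 0" and rec: "eventually (\<lambda>n. fps_weighted 2 F (n + 1) \<le>
    (1 - c / real (n + 2)) * fps_weighted 2 F n + C * fps_weighted 2 G n / real (n + 2)) sequentially"
    using theta_linear_weighted_2[OF assms(1,2)] by blast
  have "summable (\<lambda>n. fps_weighted 2 G n / real (n + 2))" "fps_weighted 2 G \<longlonglongrightarrow> 0"
    using assms(3) unfolding small2_def weight_summable_eq by (simp_all add: fps_weighted_def[abs_def])
  with damped_recursion_summable(1)[OF _ _ cC rec] damped_recursion_tendsto_0[OF _ cC(1) rec]
  show ?thesis unfolding small2_def weight_summable_eq by (simp add: fps_weighted_def[abs_def])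
qed

section \<open>The functional that yields the linear coefficient\<close>

lemma weight_pos: "weight n > 0" by (simp add: weight_def)

lemma small1_norm_summable: "small1 F \<Longrightarrow> summable (\<lambda>n. cmod (F $ n * of_real (weight n)))"
  using weight_pos by (simp add: small1_def norm_mult abs_of_pos)

lemma small1_summable: "small1 F \<Longrightarrow> summable (\<lambda>n. F $ n * of_real (weight n))"
  by (rule summable_norm_cancel[OF small1_norm_summable])

text \<open>The functional that determines the coefficient of the linear term: summation by parts gives
  \<open>fps_mean ((\<theta> - \<lambda>) F) = (2 - \<lambda>) fps_mean F - F\<^sub>0\<close>.\<close>

definition fps_mean :: "complex fps \<Rightarrow> complex" where
  "fps_mean F = (\<Sum>n. F $ n * of_real (weight n))"

text \<open>The pointwise half of \<open>small2\<close> bounds the coefficients by sqrt (n + 1)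
  eventually, and the weight then leaves a summable power with exponent -3/2.\<close>

lemma small2_imp_small1:
  assumes "small2 F" shows "small1 F"
proof -
  have "(\<lambda>n. cmod (F $ n) ^ 2 / real (n + 1)) \<longlonglongrightarrow> 0" using assms by (simp add: small2_def)
  hence "eventually (\<lambda>n. cmod (F $ n) ^ 2 / real (n + 1) < 1) sequentially"
    by (intro order_tendstoD) auto
  hence ev: "eventually (\<lambda>n. norm (cmod (F $ n) * weight n) \<le> real (n + 1) powr (-3/2)) sequentially"
  proof eventually_elim
    case (elim n)
    have "cmod (F $ n) \<le> real (n + 1) powr (1/2)"
      using elim by (auto simp: powr_half_sqrt field_simps intro!: real_le_rsqrt)
    moreover have "weight n \<le> real (n + 1) powr (-2)"
    proof -
      have "weight n \<le> 1 / (real (n + 1) * real (n + 1))"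
        unfolding weight_def by (intro divide_left_mono mult_left_mono) auto
      thus ?thesis by (simp add: powr_minus powr_numeral power2_eq_square divide_inverse)
    qed
    ultimately have "cmod (F $ n) * weight n \<le> real (n + 1) powr (1/2) * real (n + 1) powr (-2)"
      using weight_pos[of n] by (intro mult_mono) auto
    also have "\<dots> = real (n + 1) powr (-3/2)" by (simp flip: powr_add)
    finally show ?case using weight_pos[of n] by (simp add: abs_mult)
  qed
  have "summable (\<lambda>n. real n powr (-3/2))" by (subst summable_real_powr_iff) simp
  hence "summable (\<lambda>n. real (n + 1) powr (-3/2))"
    using summable_iff_shift[of "\<lambda>n. real n powr (-3/2)" 1] by simp
  from summable_comparison_test_ev[OF ev this] show ?thesis by (simp add: small1_def)
qed

lemma of_nat_plus_nonzero: "of_nat n + 1 \<noteq> (0::complex)" "of_nat n + 2 \<noteq> (0::complex)"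
proof -
  have "of_nat (n + 1) \<noteq> (0::complex)" "of_nat (n + 2) \<noteq> (0::complex)"
    by (simp_all only: of_nat_eq_0_iff)
  thus "of_nat n + 1 \<noteq> (0::complex)" "of_nat n + 2 \<noteq> (0::complex)" by (simp_all add: add.commute)
qed

text \<open>Write n + l as (n + 2) - (2 - l) and divide the recurrence by (n + 1) (n + 2): G_n times
  its weight becomes an increment of F_n / (n + 1) plus (2 - l) times the weighted F_n.\<close>

lemma theta_linear_partial_sum:
  assumes "theta_poly [:-l, 1:] F = (G :: complex fps)"
  shows "(\<Sum>k<n. G $ k * of_real (weight k)) =
    F $ n / of_nat (n + 1) - F $ 0 + (2 - l) * (\<Sum>k<n. F $ k * of_real (weight k))"
proof (induction n)
  case (Suc n)
  define f g f' where "f = F $ n" and "g = G $ n" and "f' = F $ (n + 1)"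
  define x :: complex where "x = of_nat n"
  have eq: "(x + 1) * f' = (x + l) * f + g"
    using theta_linear_nth[OF assms, of n] by (simp add: f_def g_def f'_def x_def add.commute)
  have nz': "x + 1 \<noteq> 0" "x + 2 \<noteq> 0" using of_nat_plus_nonzero by (simp_all add: x_def)
  have "g / ((x + 1) * (x + 2)) = f' / (x + 2) - f / (x + 1) + (2 - l) * (f / ((x + 1) * (x + 2)))"
  proof -
    have "f' / (x + 2) = ((x + 1) * f') / ((x + 1) * (x + 2))" using nz' by simp
    also have "\<dots> = ((x + l) * f + g) / ((x + 1) * (x + 2))" unfolding eq ..
    finally have "f' / (x + 2) = ((x + l) * f + g) / ((x + 1) * (x + 2))" .
    moreover have "f / (x + 1) = ((x + 2) * f) / ((x + 1) * (x + 2))" using nz' by simp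
    ultimately show ?thesis by (simp add: algebra_simps flip: add_divide_distrib diff_divide_distrib)
  qed
  moreover have "of_real (weight n) = 1 / ((x + 1) * (x + 2))"
    by (simp add: weight_def x_def add.commute)
  moreover have "of_nat (n + 1) = x + 1" "of_nat (Suc n + 1) = x + 2"
    by (simp_all add: x_def)
  ultimately have key: "G $ n * of_real (weight n) = F $ Suc n / of_nat (Suc n + 1) - F $ n / of_nat (n + 1)
      + (2 - l) * (F $ n * of_real (weight n))"
    by (simp add: f_def g_def f'_def del: of_nat_add of_nat_Suc)
  show ?case unfolding sum.lessThan_Suc Suc key by (simp only: distrib_left) simp
qed simp

lemma theta_linear_mean:
  assumes "theta_poly [:-l, 1:] F = G" "small1 F" "small1 G"
    and lim: "(\<lambda>n. cmod (F $ n) / real (n + 1)) \<longlonglongrightarrow> 0"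
  shows "fps_mean G = (2 - l) * fps_mean F - F $ 0"
proof -
  note partial = theta_linear_partial_sum[OF assms(1)]
  have "(\<lambda>n. F $ n / of_nat (n + 1)) \<longlonglongrightarrow> 0"
    using lim by (intro tendsto_norm_zero_cancel[of "\<lambda>n. F $ n / of_nat (n + 1)"])
      (simp add: norm_divide del: of_nat_add of_nat_Suc)
  moreover have "(\<lambda>n. \<Sum>k<n. F $ k * of_real (weight k)) \<longlonglongrightarrow> fps_mean F"
    using small1_summable[OF assms(2)] unfolding fps_mean_def by (rule summable_LIMSEQ)
  ultimately have "(\<lambda>n. F $ n / of_nat (n + 1) - F $ 0 + (2 - l) * (\<Sum>k<n. F $ k * of_real (weight k)))
     \<longlonglongrightarrow> 0 - F $ 0 + (2 - l) * fps_mean F"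
    by (intro tendsto_intros)
  moreover have "(\<lambda>n. \<Sum>k<n. G $ k * of_real (weight k)) \<longlonglongrightarrow> fps_mean G"
    using small1_summable[OF assms(3)] unfolding fps_mean_def by (rule summable_LIMSEQ)
  ultimately have "fps_mean G = 0 - F $ 0 + (2 - l) * fps_mean F"
    unfolding partial using LIMSEQ_unique by blast
  thus ?thesis by simp
qed

text \<open>A coefficient of \<theta> F involves the next coefficient of F, so each application of
  \<theta> uses up one initial zero.\<close>

lemma theta_poly_initial_zeros:
  assumes "\<And>i. i < k \<Longrightarrow> F $ i = 0" "i + degree p < k"
  shows "theta_poly p F $ i = 0"
  using assms(2)
proof (induction p arbitrary: i)
  case (pCons a p)
  show ?case
  proof (cases "p = 0")
    case False
    hence "i + 1 + degree p < k" using pCons.prems by simp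
    thus ?thesis using pCons.IH[of i] pCons.IH[of "i + 1"] assms(1)[of i]
      by (simp add: fps_theta_nth)
  qed (use assms pCons.prems in simp)
qed simp

lemma degree_prod_list_linear: "degree (\<Prod>l\<leftarrow>ls. [:- l, 1:] :: complex poly) = length ls"
proof (induction ls)
  case (Cons l ls)
  have "(\<Prod>l\<leftarrow>ls. [:- l, 1:] :: complex poly) \<noteq> 0" by (auto simp: prod_list_zero_iff)
  thus ?case using Cons by (simp add: degree_mult_eq del: mult_pCons_left)
qed simp

text \<open>The head of the list is the outermost operator, hence the first to be inverted. The
  initial zeros of F make every intermediate series start with 0, so the boundary term of
  \<open>theta_linear_mean\<close> vanishes and the means simply multiply.\<close>

lemma theta_prod_small:
  assumes "theta_poly (\<Prod>l\<leftarrow>ls. [:- l, 1:]) F = G" "small1 G" "\<forall>l\<in>set ls. Re l < 3/2"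
    "\<And>i. i < length ls \<Longrightarrow> F $ i = 0"
  shows "small1 F" "small2 G \<Longrightarrow> small2 F" "fps_mean G = (\<Prod>l\<leftarrow>ls. 2 - l) * fps_mean F"
proof -
  have "small1 F \<and> (small2 G \<longrightarrow> small2 F) \<and> fps_mean G = (\<Prod>l\<leftarrow>ls. 2 - l) * fps_mean F"
    using assms
  proof (induction ls arbitrary: G)
    case (Cons l ls)
    define H where "H = theta_poly (\<Prod>l\<leftarrow>ls. [:- l, 1:]) F"
    have H: "theta_poly [:-l, 1:] H = G"
      using Cons.prems(1) by (simp add: H_def theta_poly_mult del: mult_pCons_left theta_poly_pCons)
    have "H $ 0 = 0" unfolding H_def
      by (rule theta_poly_initial_zeros[of "length (l # ls)"])
         (use Cons.prems(4) in \<open>auto simp: degree_prod_list_linear\<close>)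
    have l: "Re l < 3/2" using Cons.prems by simp
    note H1 = theta_linear_small1[OF H l Cons.prems(2)]
    have IH: "small1 F \<and> (small2 H \<longrightarrow> small2 F) \<and> fps_mean H = (\<Prod>l\<leftarrow>ls. 2 - l) * fps_mean F"
      using Cons.prems by (intro Cons.IH[OF H_def[symmetric] H1(1)]) auto
    moreover have "fps_mean G = (2 - l) * fps_mean H"
      using theta_linear_mean[OF H H1(1) Cons.prems(2) H1(2)] \<open>H $ 0 = 0\<close> by simp
    ultimately show ?case using theta_linear_small2[OF H l] by (auto simp: mult.assoc)
  qed simp
  thus "small1 F" "small2 G \<Longrightarrow> small2 F" "fps_mean G = (\<Prod>l\<leftarrow>ls. 2 - l) * fps_mean F" by auto
qed

section \<open>The simple root 2\<close>

lemma theta_two_solution: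
  assumes "theta_poly [:-2, 1:] F = (G :: complex fps)" "F $ 0 = 0"
  shows "F $ n / of_nat (n + 1) = (\<Sum>k<n. G $ k * of_real (weight k))"
  using theta_linear_partial_sum[OF assms(1), of n] assms(2) by simp

lemma theta_two_limit:
  assumes "theta_poly [:-2, 1:] F = G" "F $ 0 = 0" "small1 G"
  shows "(\<lambda>n. F $ n / of_nat (n + 1)) \<longlonglongrightarrow> fps_mean G"
  unfolding theta_two_solution[OF assms(1,2)] fps_mean_def
  by (rule summable_LIMSEQ[OF small1_summable[OF assms(3)]])

text \<open>For the root 2 the forward recursion has no damping. The assumed limit pins the solution
  down at infinity instead, so the recurrence is read backwards, bounding F_n by F_(n+1).\<close>

lemma theta_two_remainder_small2:
  assumes eq: "theta_poly [:-2, 1:] F = G" and lim: "(\<lambda>n. cmod (F $ n) / real (n + 1)) \<longlonglongrightarrow> 0"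
    and G: "small2 G"
  shows "small2 F"
proof -
  define u w where "u n = cmod (F $ n)" and "w n = cmod (G $ n)" for n
  have rec: "real (n + 2) * u n \<le> real (n + 1) * u (n + 1) + w n" for n
  proof -
    have "of_nat (n + 2) * F $ n = of_nat (n + 1) * F $ (n + 1) - G $ n"
      using theta_linear_nth[OF eq, of n] by simp
    hence "cmod (of_nat (n + 2) * F $ n) \<le> cmod (of_nat (n + 1) * F $ (n + 1)) + cmod (G $ n)"
      by (simp only: norm_triangle_ineq4)
    thus ?thesis by (simp add: u_def w_def norm_mult del: of_nat_add of_nat_Suc)
  qed
  have u_nonneg: "u n \<ge> 0" and w_nonneg: "w n \<ge> 0" for n by (auto simp: u_def w_def)
  have lim_w: "(\<lambda>n. (w n)\<^sup>2 / real (n + 1)) \<longlonglongrightarrow> 0"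
    and sum_w: "summable (\<lambda>n. (w n)\<^sup>2 * weight n)"
    using G by (simp_all add: small2_def w_def)
  have bound: "eventually (\<lambda>n. u n \<le> 2 * \<epsilon> * sqrt (real (n + 1))) sequentially" if "\<epsilon> > 0" for \<epsilon>
  proof -
    have "eventually (\<lambda>n. (w n)\<^sup>2 / real (n + 1) < \<epsilon>\<^sup>2) sequentially"
      using lim_w that by (intro order_tendstoD) auto
    then obtain N where N: "\<And>n. n \<ge> N \<Longrightarrow> (w n)\<^sup>2 / real (n + 1) < \<epsilon>\<^sup>2"
      by (auto simp: eventually_sequentially)
    have wN: "w n \<le> \<epsilon> * sqrt (real (n + 1))" if "n \<ge> N" for n
    proof -
      have "(w n)\<^sup>2 \<le> (\<epsilon> * sqrt (real (n + 1)))\<^sup>2"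
        using N[OF that] by (simp add: field_simps power_mult_distrib)
      thus ?thesis by (rule power2_le_imp_le) (use \<open>\<epsilon> > 0\<close> in simp)
    qed
    \<comment> \<open>One backward step adds at most \<epsilon> / ((n + 2) sqrt (n + 1)), which the
      decrement of 2 \<epsilon> / sqrt (n + 1) covers. Hence z increases from N on, and its limit 0
      forces it to be nonpositive there.\<close>
    define z where "z n = u n / real (n + 1) - 2 * \<epsilon> / sqrt (real (n + 1))" for n
    have "z n \<le> z (Suc n)" if "n \<ge> N" for n
    proof -
      define s r where "s = sqrt (real (n + 1))" and "r = sqrt (real (n + 2))"
      have s: "s > 0" "r > 0" "s \<le> r" "s * s = real (n + 1)" "r * r = real (n + 2)"
        by (auto simp: s_def r_def)
      have "u n / real (n + 1) = (real (n + 2) * u n) / (real (n + 1) * real (n + 2))" by simp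
      also have "\<dots> \<le> (real (n + 1) * u (n + 1) + \<epsilon> * s) / (real (n + 1) * real (n + 2))"
        using rec[of n] wN[OF that] by (intro divide_right_mono) (auto simp: s_def)
      also have "\<dots> = u (n + 1) / real (n + 2) + \<epsilon> * s / (s * s * (r * r))"
        by (simp add: add_divide_distrib s)
      also have "\<epsilon> * s / (s * s * (r * r)) \<le> 2 * \<epsilon> / s - 2 * \<epsilon> / r"
      proof -
        have "(r - s) * (r + s) = 1" using s(4,5) by (simp add: algebra_simps)
        hence "1 \<le> (r - s) * (2 * r)"
          using s mult_left_mono[of "r + s" "2 * r" "r - s"] by simp
        hence "\<epsilon> * 1 \<le> \<epsilon> * ((r - s) * (2 * r))" using \<open>\<epsilon> > 0\<close> by (intro mult_left_mono) auto
        hence "\<epsilon> / (s * (r * r)) \<le> \<epsilon> * ((r - s) * (2 * r)) / (s * (r * r))"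
          using s by (intro divide_right_mono) auto
        also have "\<dots> = 2 * \<epsilon> / s - 2 * \<epsilon> / r" using s(1,2) by (simp add: field_simps)
        finally show ?thesis using s(1) by simp
      qed
      finally show ?thesis by (simp add: z_def s_def r_def add.commute)
    qed
    hence mono: "z (n + N) \<le> z (Suc n + N)" for n by simp
    have "z \<longlonglongrightarrow> 0 - 0"
      unfolding z_def
    proof (intro tendsto_diff)
      show "(\<lambda>n. u n / real (n + 1)) \<longlonglongrightarrow> 0" using lim by (simp add: u_def)
      show "(\<lambda>n. 2 * \<epsilon> / sqrt (real (n + 1))) \<longlonglongrightarrow> 0" by real_asymp
    qed
    hence "(\<lambda>n. z (n + N)) \<longlonglongrightarrow> 0" by (simp add: LIMSEQ_ignore_initial_segment)
    hence "z (n + N) \<le> 0" for n by (rule incseq_le[OF incseq_SucI[of "\<lambda>n. z (n + N)", OF mono]])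
    hence "z n \<le> 0" if "n \<ge> N" for n using that by (metis le_add_diff_inverse2)
    hence "u n \<le> 2 * \<epsilon> * sqrt (real (n + 1))" if "n \<ge> N" for n
    proof -
      have "u n / real (n + 1) \<le> 2 * \<epsilon> / sqrt (real (n + 1))"
        using that \<open>\<And>n. n \<ge> N \<Longrightarrow> z n \<le> 0\<close> by (force simp: z_def)
      hence "u n \<le> 2 * \<epsilon> / sqrt (real (n + 1)) * real (n + 1)" by (simp add: pos_divide_le_eq)
      also have "\<dots> = 2 * \<epsilon> * (real (n + 1) / sqrt (real (n + 1)))" by simp
      also have "real (n + 1) / sqrt (real (n + 1)) = sqrt (real (n + 1))"
        by (rule real_div_sqrt) simp
      finally show ?thesis .
    qed
    thus ?thesis by (auto simp: eventually_sequentially)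
  qed
  define v where "v n = (u n)\<^sup>2 / real (n + 1)" for n
  have v_nonneg: "v n \<ge> 0" for n by (simp add: v_def)
  have v0: "v \<longlonglongrightarrow> 0"
  proof (rule order_tendstoI)
    fix b :: real assume "b > 0"
    have "eventually (\<lambda>n. u n \<le> 2 * (sqrt b / 4) * sqrt (real (n + 1))) sequentially"
      using \<open>b > 0\<close> by (intro bound) auto
    thus "eventually (\<lambda>n. v n < b) sequentially"
    proof eventually_elim
      case (elim n)
      have "(u n)\<^sup>2 \<le> (2 * (sqrt b / 4) * sqrt (real (n + 1)))\<^sup>2"
        using elim u_nonneg by (intro power_mono)
      also have "\<dots> = b / 4 * real (n + 1)"
        using \<open>b > 0\<close> by (simp add: power_mult_distrib power_divide)
      finally have "v n \<le> b / 4" by (simp add: v_def pos_divide_le_eq)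
      thus ?case using \<open>b > 0\<close> by simp
    qed
  qed (use v_nonneg in \<open>auto intro!: always_eventually dest: order_less_le_trans\<close>)
  \<comment> \<open>The backward counterpart of a damped recursion. Because v tends to 0, the
    increments of v are summable, and so is the left-hand side.\<close>
  have step: "v (Suc n) / real (n + 2) / 2 \<le> v (Suc n) - v n + 2 * ((w n)\<^sup>2 * weight n)" for n
  proof -
    define D where "D = u (n + 1)"
    define k where "k = real (n + 1)"
    have k: "k > 0" "k \<ge> 1" "real (n + 2) = k + 1" by (auto simp: k_def)
    have am: "2 * (D * w n) \<le> D\<^sup>2 / 2 + 2 * (w n)\<^sup>2"
    proof -
      have "0 \<le> (D - 2 * w n)\<^sup>2 / 2" by simp
      also have "\<dots> = D\<^sup>2 / 2 + 2 * (w n)\<^sup>2 - 2 * (D * w n)" by (simp add: power2_eq_square field_simps)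
      finally show ?thesis by simp
    qed
    have "((k + 1) * u n)\<^sup>2 \<le> (k * D + w n)\<^sup>2"
      using rec[of n] u_nonneg[of n] k by (intro power_mono) (auto simp: D_def k_def)
    also have "\<dots> = k\<^sup>2 * D\<^sup>2 + k * (2 * (D * w n)) + (w n)\<^sup>2"
      by (simp add: power2_eq_square algebra_simps)
    also have "\<dots> \<le> k\<^sup>2 * D\<^sup>2 + k * (D\<^sup>2 / 2 + 2 * (w n)\<^sup>2) + (w n)\<^sup>2"
      using am k by (intro add_mono mult_left_mono) auto
    also have "\<dots> = (k * (k + 1/2)) * D\<^sup>2 + (2 * k + 1) * (w n)\<^sup>2"
      by (simp add: power2_eq_square algebra_simps)
    also have "\<dots> \<le> (k * (k + 1/2)) * D\<^sup>2 + (2 * (k + 1)) * (w n)\<^sup>2"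
      by (intro add_left_mono mult_right_mono) auto
    finally have "((k + 1) * u n)\<^sup>2 / (k * (k + 1) * (k + 1)) \<le>
       ((k * (k + 1/2)) * D\<^sup>2 + (2 * (k + 1)) * (w n)\<^sup>2) / (k * (k + 1) * (k + 1))"
      using k by (intro divide_right_mono) auto
    also have "((k + 1) * u n)\<^sup>2 / (k * (k + 1) * (k + 1)) = v n"
      using k by (simp add: v_def power_mult_distrib power2_eq_square flip: k_def)
    also have "((k * (k + 1/2)) * D\<^sup>2 + (2 * (k + 1)) * (w n)\<^sup>2) / (k * (k + 1) * (k + 1)) =
        (k + 1/2) / (k + 1) * (D\<^sup>2 / (k + 1)) + 2 * ((w n)\<^sup>2 / (k * (k + 1)))"
    proof -
      have "(k * A) * x / (k * c * c) = A / c * (x / c)" "(2 * c) * x / (k * c * c) = 2 * (x / (k * c))"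
        if "c \<noteq> 0" for A c x :: real using k(1) that by simp_all
      from this[of "k + 1"] show ?thesis
        using k(1) unfolding add_divide_distrib[of _ _ "k * (k + 1) * (k + 1)"] by simp
    qed
    also have "(k + 1/2) / (k + 1) = 1 - 1 / (k + 1) / 2" using k by (simp add: field_simps)
    also have "D\<^sup>2 / (k + 1) = v (Suc n)" by (simp add: v_def D_def k_def)
    also have "(w n)\<^sup>2 / (k * (k + 1)) = (w n)\<^sup>2 * weight n"
      by (simp add: weight_def k_def)
    finally show ?thesis unfolding k(3) by (simp add: algebra_simps)
  qed
  have "summable (\<lambda>n. v (Suc n) / real (n + 2) / 2)"
  proof (rule summable_comparison_test')
    show "summable (\<lambda>n. v (Suc n) - v n + 2 * ((w n)\<^sup>2 * weight n))"
      using telescope_summable[OF v0] sum_w by (intro summable_add summable_mult)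
    show "norm (v (Suc n) / real (n + 2) / 2) \<le> v (Suc n) - v n + 2 * ((w n)\<^sup>2 * weight n)" if "n \<ge> 0" for n
      using step[of n] v_nonneg[of "Suc n"] by simp
  qed
  hence "summable (\<lambda>n. v (Suc n) / real (n + 2))"
    by (simp only: summable_divide_iff) simp
  hence "summable (\<lambda>n. v (Suc n) / real (Suc n + 2))"
    by (rule summable_comparison_test'[where N = 0])
       (use v_nonneg in \<open>auto intro!: divide_left_mono\<close>)
  hence "summable (\<lambda>n. v n / real (n + 2))"
    using summable_Suc_iff[of "\<lambda>n. v n / real (n + 2)"] by simp
  moreover have "v n / real (n + 2) = (cmod (F $ n))\<^sup>2 * weight n" for n
    by (simp add: v_def u_def weight_def)
  ultimately show ?thesis using v0 by (simp add: small2_def v_def[abs_def] u_def)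
qed

section \<open>The roots of the characteristic polynomial\<close>

text \<open>On \<open>Re z \<ge> 3/2\<close> both the modulus and, in the upper half plane, the argument of
  \<open>z(z + 1)\<dots>(z + m - 2)\<close> are controlled by the single point \<open>z\<^sub>0 = 3/2 + (97/44) i\<close> below: if
  \<open>Im z \<ge> Im z\<^sub>0\<close>, the modulus exceeds \<open>m!\<close>, and if \<open>0 < Im z < Im z\<^sub>0\<close>, the argument lies strictly
  between \<open>0\<close> and \<open>2 \<pi>\<close>. For \<open>m = 26\<close> the height of \<open>z\<^sub>0\<close> must lie between about \<open>2.2035\<close> and
  \<open>2.2057\<close>. The Gaussian integer \<open>gauss_prod k\<close> is \<open>44\<^sup>k z\<^sub>0 (z\<^sub>0 + 1)\<dots>(z\<^sub>0 + k - 1)\<close>.\<close>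

fun gauss_prod :: "nat \<Rightarrow> int \<times> int" where
  "gauss_prod 0 = (1, 0)"
| "gauss_prod (Suc j) = (case gauss_prod j of (a, b) \<Rightarrow>
     (a * (66 + 44 * int j) - b * 97, a * 97 + b * (66 + 44 * int j)))"

text \<open>Two mutually recursive predicates, so that the simplifier normalises each product before it is
  used in the test and in the next step.\<close>

fun sign_chain :: "nat \<Rightarrow> nat \<Rightarrow> int \<times> int \<Rightarrow> bool" and sign_test :: "nat \<Rightarrow> nat \<Rightarrow> int \<times> int \<Rightarrow> bool" where
  "sign_chain 0 j p = True"
| "sign_chain (Suc n) j (a, b) = sign_test n (Suc j)
     (a * (66 + 44 * int j) - b * 97, a * 97 + b * (66 + 44 * int j))"
| "sign_test n j p = ((if j \<le> 5 then 0 < snd p else snd p < 0) \<and> sign_chain n j p)"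

lemma sign_chain_gauss_prod:
  "sign_chain n j (gauss_prod j) \<Longrightarrow> j < k \<Longrightarrow> k \<le> j + n \<Longrightarrow>
    (if k \<le> 5 then 0 < snd (gauss_prod k) else snd (gauss_prod k) < 0)"
proof (induction n arbitrary: j)
  case (Suc n)
  obtain a b where ab: "gauss_prod j = (a, b)" by force
  from Suc.prems(1) have "(if Suc j \<le> 5 then 0 < snd (gauss_prod (Suc j)) else snd (gauss_prod (Suc j)) < 0)"
    and "sign_chain n (Suc j) (gauss_prod (Suc j))"
    by (simp_all add: ab split: if_splits)
  with Suc.IH[of "Suc j"] Suc.prems(2,3) show ?case by (cases "k = Suc j") auto
qed simp

text \<open>The signs encode the argument of the product: it passes \<pi> between the fifth and the
  sixth factor and stays below 2 \<pi> up to the twenty-fifth. \<open>arg_sum_crit\<close> recovers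
  this from them.\<close>

lemma gauss_prod_sign:
  assumes "0 < k" "k \<le> 25"
  shows "if k \<le> 5 then 0 < snd (gauss_prod k) else snd (gauss_prod k) < 0"
proof -
  \<comment> \<open>Numerals are unfolded into successors so that the equations of
    \<open>sign_chain\<close> fire; the simplifier then computes all 25 products.\<close>
  have "sign_chain 25 0 (1, 0)"
    by (simp add: numeral_eq_Suc[of "num.Bit1 _"] numeral_eq_Suc[of "num.Bit0 _"])
  with assms show ?thesis by (intro sign_chain_gauss_prod[of 25 0]) auto
qed

text \<open>\<open>factor_num j / factor_den j\<close> is \<open>|z\<^sub>0 + j|\<^sup>2 / (j + 2)\<^sup>2\<close>. The list in \<open>size_cert\<close> holds lower bounds,
  scaled by \<open>100000\<close>, for the partial products of these quotients.\<close>

definition factor_num :: "nat \<Rightarrow> int" where "factor_num j = (66 + 44 * int j) * (66 + 44 * int j) + 9409"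

definition factor_den :: "nat \<Rightarrow> int" where "factor_den j = (88 + 44 * int j) * (88 + 44 * int j)"

fun size_cert :: "nat \<Rightarrow> int \<Rightarrow> int list \<Rightarrow> bool" where
  "size_cert j u [] = True"
| "size_cert j u (v # vs) =
     (100000 < v \<and> v * factor_den j \<le> u * factor_num j \<and> size_cert (Suc j) v vs)"

lemma factor_den_pos: "factor_den j > 0" by (simp add: factor_den_def)

lemma factor_num_pos: "factor_num j > 0"
  unfolding factor_num_def by (intro add_nonneg_pos) auto

text \<open>Along the list, v / 100000 stays below the quotient of the partial products.
  Cross-multiplication keeps this invariant in the integers, and v > 100000 makes the conclusion
  strict.\<close>

lemma size_cert_prod:
  "size_cert j u vs \<Longrightarrow> u * (\<Prod>i<j. factor_den i) \<le> 100000 * (\<Prod>i<j. factor_num i) \<Longrightarrow>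
    j < k \<Longrightarrow> k \<le> j + length vs \<Longrightarrow> (\<Prod>i<k. factor_den i) < (\<Prod>i<k. factor_num i)"
proof (induction vs arbitrary: j u)
  case (Cons v vs)
  have v: "100000 < v" "v * factor_den j \<le> u * factor_num j" "size_cert (Suc j) v vs"
    using Cons.prems(1) by simp_all
  have D: "(\<Prod>i<l. factor_den i) > 0" for l by (intro prod_pos) (auto simp: factor_den_pos)
  have "(v * factor_den j) * (\<Prod>i<j. factor_den i) \<le> (u * factor_num j) * (\<Prod>i<j. factor_den i)"
    using D[of j] v(2) by (intro mult_right_mono) auto
  also have "\<dots> = (u * (\<Prod>i<j. factor_den i)) * factor_num j" by simp
  also have "\<dots> \<le> (100000 * (\<Prod>i<j. factor_num i)) * factor_num j"
    using Cons.prems(2) factor_num_pos[of j] by (intro mult_right_mono) auto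
  finally have nxt: "v * (\<Prod>i<Suc j. factor_den i) \<le> 100000 * (\<Prod>i<Suc j. factor_num i)"
    by (simp add: mult_ac)
  show ?case
  proof (cases "k = Suc j")
    case True
    have "100000 * (\<Prod>i<Suc j. factor_den i) < v * (\<Prod>i<Suc j. factor_den i)"
      using v(1) D[of "Suc j"] by (intro mult_strict_right_mono)
    with nxt have "100000 * (\<Prod>i<Suc j. factor_den i) < 100000 * (\<Prod>i<Suc j. factor_num i)" by linarith
    thus ?thesis using True by simp
  next
    case False
    with Cons.IH[OF v(3) nxt] Cons.prems(3,4) show ?thesis by simp
  qed
qed simp

lemma prod_factors_less:
  assumes "0 < k" "k \<le> 25"
  shows "(\<Prod>i<k. factor_den i) < (\<Prod>i<k. factor_num i)"
proof -
  \<comment> \<open>The last entry is the tight case m = 26: the squared modulus exceeds the square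
    of 26! by a factor of only about 1.00224.\<close>
  have "size_cert 0 100000
    [177750, 219422, 234644, 235676, 229849, 220983, 211004, 200870, 191047, 181747,
     173050, 164970, 157487, 150564, 144159, 138228, 132728, 127621, 122870, 118442,
     114308, 110442, 106820, 103420, 100224]"
    by (simp add: factor_num_def factor_den_def)
  from size_cert_prod[OF this] assms show ?thesis by simp
qed

definition crit :: complex where "crit = Complex (3/2) (97/44)"

lemma gauss_prod_complex:
  "44 ^ k * (\<Prod>j<k. crit + of_nat j) = Complex (of_int (fst (gauss_prod k))) (of_int (snd (gauss_prod k)))"
proof (induction k)
  case (Suc k)
  obtain a b where ab: "gauss_prod k = (a, b)" by force
  have "44 ^ Suc k * (\<Prod>j<Suc k. crit + of_nat j) =
     (44 ^ k * (\<Prod>j<k. crit + of_nat j)) * (44 * (crit + of_nat k))"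
    by (simp add: mult_ac)
  also have "44 * (crit + of_nat k) = Complex (66 + 44 * real k) 97"
    by (simp add: crit_def complex_eq_iff)
  finally show ?case unfolding Suc by (simp add: ab complex_eq_iff algebra_simps)
qed (simp add: complex_eq_iff)

lemma crit_norm_large:
  assumes "0 < k" "k \<le> 25"
  shows "cmod (\<Prod>j<k. crit + of_nat j) > fact (Suc k)"
proof -
  have "44 ^ k * fact (Suc k) = (\<Prod>i<k. 88 + 44 * real i)"
  proof (induction k)
    case (Suc k)
    have "44 ^ Suc k * fact (Suc (Suc k)) = (44 ^ k * fact (Suc k)) * (88 + 44 * real k)"
      by (simp add: algebra_simps)
    with Suc show ?case by simp
  qed simp
  hence "(44 ^ k * fact (Suc k))\<^sup>2 = (\<Prod>i<k. (88 + 44 * real i) * (88 + 44 * real i))"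
    by (simp only: power2_eq_square prod.distrib)
  also have "\<dots> = of_int (\<Prod>i<k. factor_den i)" by (simp add: factor_den_def)
  also have "\<dots> < of_int (\<Prod>i<k. factor_num i)"
    using prod_factors_less[OF assms] by (simp only: of_int_less_iff)
  also have "\<dots> = (\<Prod>i<k. (cmod (44 * (crit + of_nat i)))\<^sup>2)"
  proof -
    have "44 * (crit + of_nat k) = Complex (66 + 44 * real k) 97" for k
      by (simp add: crit_def complex_eq_iff)
    thus ?thesis unfolding cmod_power2 by (simp add: power2_eq_square factor_num_def)
  qed
  also have "\<dots> = (44 ^ k * cmod (\<Prod>j<k. crit + of_nat j))\<^sup>2"
  proof -
    have "(\<Prod>i<k. cmod (44 * (crit + of_nat i))) = 44 ^ k * cmod (\<Prod>j<k. crit + of_nat j)"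
      by (simp add: norm_mult prod.distrib prod_norm del: distrib_left_numeral)
    thus ?thesis by (simp only: flip: prod_power_distrib)
  qed
  finally have "44 ^ k * fact (Suc k) < 44 ^ k * cmod (\<Prod>j<k. crit + of_nat j)"
    by (rule power_less_imp_less_base) simp
  thus ?thesis by simp
qed

text \<open>A continuous branch of the argument of the product on Re z > 0. Since it is not reduced
  modulo 2 \<pi>, full turns remain visible, and each summand is monotone in Re z and in Im
  z.\<close>

definition arg_sum :: "nat \<Rightarrow> complex \<Rightarrow> real" where
  "arg_sum k z = (\<Sum>j<k. arctan (Im z / (Re z + real j)))"

lemma prod_polar:
  assumes "Re z > 0"
  shows "(\<Prod>j<k. z + of_nat j) = of_real (cmod (\<Prod>j<k. z + of_nat j)) * cis (arg_sum k z)"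
proof (induction k)
  case (Suc k)
  define w where "w = z + of_nat k"
  have w: "Re w > 0" "Re w = Re z + real k" "Im w = Im z" using assms by (auto simp: w_def add_pos_nonneg)
  have "cmod w > 0" using w(1) by (auto simp: zero_less_norm_iff)
  have nw: "cmod w = Re w * sqrt (1 + (Im w / Re w)\<^sup>2)"
  proof -
    have "cmod w = sqrt ((Re w)\<^sup>2 * (1 + (Im w / Re w)\<^sup>2))"
      using w(1) by (simp add: cmod_def power_divide distrib_left)
    also have "\<dots> = Re w * sqrt (1 + (Im w / Re w)\<^sup>2)"
      using w(1) by (simp add: real_sqrt_mult)
    finally show ?thesis .
  qed
  have s: "sqrt (1 + (Im w / Re w)\<^sup>2) > 0" by (simp add: add_pos_nonneg)
  have "w = of_real (cmod w) * cis (arctan (Im w / Re w))"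
    using w(1) s by (simp add: complex_eq_iff cos_arctan sin_arctan nw)
  moreover have arg: "arg_sum (Suc k) z = arg_sum k z + arctan (Im w / Re w)"
    by (simp add: arg_sum_def w)
  ultimately have "(\<Prod>j<k. z + of_nat j) * w =
      (of_real (cmod (\<Prod>j<k. z + of_nat j)) * cis (arg_sum k z)) * (of_real (cmod w) * cis (arctan (Im w / Re w)))"
    using Suc by metis
  also have "\<dots> = of_real (cmod ((\<Prod>j<k. z + of_nat j) * w)) * cis (arg_sum (Suc k) z)"
    unfolding arg norm_mult of_real_mult cis_mult[symmetric] by (simp only: mult_ac)
  finally show ?case by (simp add: w_def)
qed (simp add: arg_sum_def)

text \<open>One more factor adds less than \<pi>/2, so the sign of the imaginary part decides on
  which side of \<pi> or 2 \<pi> the new sum lies. A positive sine below 2 \<pi> forces it below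
  \<pi>; a negative sine below 5 \<pi>/2 forces it below 2 \<pi>.\<close>

lemma arg_sum_crit:
  "k \<le> 25 \<Longrightarrow> arg_sum k crit < (if k \<le> 5 then pi else 2 * pi)"
proof (induction k)
  case (Suc k)
  define S where "S = arg_sum (Suc k) crit"
  have a: "arctan (Im crit / (Re crit + real k)) < pi / 2" by (rule arctan_ubound)
  have S: "S < arg_sum k crit + pi / 2" using a by (simp add: S_def arg_sum_def)
  have S0: "S \<ge> 0" unfolding S_def arg_sum_def
    by (intro sum_nonneg) (auto simp: zero_le_arctan_iff crit_def)
  let ?P = "\<Prod>j<Suc k. crit + of_nat j"
  have sgn: "44 ^ Suc k * (cmod ?P * sin S) = of_int (snd (gauss_prod (Suc k)))"
  proof -
    have "Im (44 ^ Suc k * ?P) = of_int (snd (gauss_prod (Suc k)))"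
      unfolding gauss_prod_complex by simp
    moreover have "Im (44 ^ Suc k * ?P) = 44 ^ Suc k * Im ?P"
    proof -
      have "(44 ^ Suc k :: complex) = of_real (44 ^ Suc k)" by simp
      hence "Im (44 ^ Suc k * ?P) = Im (of_real (44 ^ Suc k) * ?P)" by (simp only:)
      also have "\<dots> = 44 ^ Suc k * Im ?P" by (simp only: Im_complex_of_real Re_complex_of_real times_complex.sel)
      finally show ?thesis .
    qed
    moreover have "Im ?P = cmod ?P * sin S"
      using arg_cong[OF prod_polar[of crit "Suc k"], of Im] by (simp add: S_def crit_def)
    ultimately show ?thesis by simp
  qed
  have "cmod ?P \<ge> 0" by simp
  have sgn_pos: "sin S > 0" if "snd (gauss_prod (Suc k)) > 0"
  proof -
    have "0 < 44 ^ Suc k * (cmod ?P * sin S)" using that by (simp only: sgn of_int_0_less_iff)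
    thus ?thesis using \<open>cmod ?P \<ge> 0\<close> by (simp add: zero_less_mult_iff)
  qed
  have sgn_neg: "sin S < 0" if "snd (gauss_prod (Suc k)) < 0"
  proof -
    have "44 ^ Suc k * (cmod ?P * sin S) < 0" using that by (simp only: sgn of_int_less_0_iff)
    thus ?thesis using \<open>cmod ?P \<ge> 0\<close> by (simp add: mult_less_0_iff)
  qed
  show ?case
  proof (cases "Suc k \<le> 5")
    case True
    hence "sin S > 0" using gauss_prod_sign[of "Suc k"] Suc.prems sgn_pos by simp
    moreover have "arg_sum k crit < pi" using Suc.IH Suc.prems True by simp
    hence "S < 2 * pi" using S pi_gt_zero by linarith
    ultimately have "S < pi" using sin_le_zero[of S] by (cases "S < pi") auto
    thus ?thesis using True by (simp add: S_def)
  next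
    case False
    hence neg: "sin S < 0" using gauss_prod_sign[of "Suc k"] Suc.prems sgn_neg by simp
    have "arg_sum k crit < (if k \<le> 5 then pi else 2 * pi)" using Suc.IH Suc.prems by simp
    also have "\<dots> \<le> 2 * pi" using pi_gt_zero by simp
    finally have "S < 2 * pi + pi / 2" using S by linarith
    moreover have "sin (S - 2 * pi) \<ge> 0" if "S \<ge> 2 * pi"
      using that \<open>S < 2 * pi + pi / 2\<close> pi_gt_zero by (intro sin_ge_zero) auto
    ultimately have "S < 2 * pi" using neg by (cases "S < 2 * pi") (auto simp: sin_diff)
    thus ?thesis using False by (simp add: S_def)
  qed
qed (simp add: arg_sum_def)

text \<open>At a root the product is the positive number m!, so its modulus is m! and its argument
  is a multiple of 2 \<pi>. In the upper half plane one of the two fails, according to the height of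
  the root; conjugation covers the lower half plane, and on the real axis the product is strictly
  increasing.\<close>

theorem rising_roots:
  assumes m: "2 \<le> m" "m \<le> 26" and root: "(\<Prod>j<m - 1. z + of_nat j) = (fact m :: complex)"
  shows "z = 2 \<or> Re z < 3/2"
proof (rule ccontr)
  assume neg: "\<not> (z = 2 \<or> Re z < 3/2)"
  define k where "k = m - 1"
  have k: "0 < k" "k \<le> 25" "m = Suc k" using m by (auto simp: k_def)
  have main: False if "Im w > 0" and "Re w \<ge> 3/2" and wroot: "(\<Prod>j<k. w + of_nat j) = (fact m :: complex)" for w
  proof (cases "Im w \<ge> 97/44")
    case True
    have "cmod (\<Prod>j<k. crit + of_nat j) \<le> cmod (\<Prod>j<k. w + of_nat j)"
      unfolding prod_norm[symmetric]
    proof (rule prod_mono, intro conjI)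
      fix j
      show "cmod (crit + of_nat j) \<le> cmod (w + of_nat j)"
        unfolding cmod_def using True \<open>Re w \<ge> 3/2\<close>
        by (intro real_sqrt_le_mono add_mono power_mono) (auto simp: crit_def)
    qed simp
    also have "\<dots> = fact m" unfolding wroot by simp
    finally show False using crit_norm_large[OF k(1,2)] k(3) by simp
  next
    case False
    have "arg_sum k w > 0" unfolding arg_sum_def
      using k that by (intro sum_pos) (auto intro!: divide_pos_pos add_pos_nonneg simp: zero_less_arctan_iff)
    moreover have "arg_sum k w < 2 * pi"
    proof -
      \<comment> \<open>All summands are nonnegative, so the longest product bounds the others;
        moving to \<open>crit\<close> only lowers the real part and raises the imaginary part, which
        increases every angle.\<close>
      have "arg_sum k w \<le> arg_sum 25 w" unfolding arg_sum_def
        using k that by (intro sum_mono2) (auto simp: zero_le_arctan_iff)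
      also have "\<dots> \<le> arg_sum 25 crit" unfolding arg_sum_def
        using False that by (intro sum_mono arctan_monotone' frac_le) (auto simp: crit_def)
      also have "\<dots> < 2 * pi" using arg_sum_crit[of 25] by simp
      finally show ?thesis .
    qed
    moreover have "cos (arg_sum k w) = 1"
    proof -
      have "cmod (\<Prod>j<k. w + of_nat j) = fact m" unfolding wroot by simp
      with prod_polar[of w k] that have "(fact m :: complex) = of_real (fact m) * cis (arg_sum k w)"
        by (simp add: wroot)
      hence "cis (arg_sum k w) = 1" by simp
      thus ?thesis by (metis Re_complex_of_real cis.sel(1) of_real_1)
    qed
    then obtain i :: int where "arg_sum k w = of_int i * 2 * pi" by (auto simp: cos_one_2pi_int)
    ultimately have "0 < real_of_int i" "real_of_int i < 1" using pi_gt_zero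
      by (auto simp: zero_less_mult_iff)
    thus False by simp
  qed
  consider "Im z > 0" | "Im z < 0" | "Im z = 0" by linarith
  thus False
  proof cases
    case 1
    thus ?thesis using main[of z] neg root by (simp add: k_def)
  next
    case 2
    have "(\<Prod>j<k. cnj z + of_nat j) = cnj (\<Prod>j<k. z + of_nat j)" by simp
    also have "\<dots> = fact m" using root by (simp add: k_def)
    finally show ?thesis using main[of "cnj z"] neg 2 by simp
  next
    case 3
    define x where "x = Re z"
    have z: "z = of_real x" using 3 by (simp add: x_def complex_eq_iff)
    have "(\<Prod>j<k. z + of_nat j) = of_real (\<Prod>j<k. x + real j)" by (simp add: z)
    with root have px: "(\<Prod>j<k. x + real j) = fact m"
      by (metis k_def of_real_eq_iff of_real_fact)
    have p2: "(\<Prod>i<k. 2 + real i) = fact (Suc k)" by (induction k) (simp_all add: algebra_simps)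
    have "x \<ge> 3/2" using neg by (simp add: x_def)
    moreover have "x \<noteq> 2" using neg z by auto
    ultimately have x: "x \<ge> 3/2" "x \<noteq> 2" by auto
    show ?thesis
    proof (cases "x < 2")
      case True
      have "(\<Prod>j<k. x + real j) < (\<Prod>j<k. 2 + real j)"
        using x True k by (intro prod_mono_strict) auto
      thus False using px p2 k by simp
    next
      case False
      have "(\<Prod>j<k. 2 + real j) < (\<Prod>j<k. x + real j)"
        using x False k by (intro prod_mono_strict) auto
      thus False using px p2 k by simp
    qed
  qed
qed

section \<open>Asymptotic transfer\<close>

lemma poly_rising_poly: "poly (rising_poly k) x = (\<Prod>i<k. x + of_nat i)"
  by (simp add: rising_poly_def poly_prod add.commute)

lemma monic_rising_poly:
  "degree (rising_poly k :: complex poly) = k" "lead_coeff (rising_poly k :: complex poly) = 1"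
proof -
  show "degree (rising_poly k :: complex poly) = k"
    unfolding rising_poly_def by (subst degree_prod_eq_sum_degree) auto
  show "lead_coeff (rising_poly k :: complex poly) = 1"
    unfolding rising_poly_def by (simp add: lead_coeff_prod)
qed

lemma rising_poly_at_2: "poly (rising_poly k) 2 = (fact (Suc k) :: complex)"
  by (induction k) (simp_all add: poly_rising_poly algebra_simps)

text \<open>The logarithmic derivative at 2 is 1/2 + ... + 1/(k + 1). This is the origin of the
  denominator \<open>harm m - 1\<close> in the constants.\<close>

lemma pderiv_rising_poly_at_2:
  "poly (pderiv (rising_poly k)) 2 = (fact (Suc k) * (of_real (harm (Suc k)) - 1) :: complex)"
proof (induction k)
  case (Suc k)
  have "rising_poly (Suc k) = rising_poly k * [:of_nat k, 1 :: complex:]"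
    by (simp add: rising_poly_def)
  hence "poly (pderiv (rising_poly (Suc k))) 2 =
      (2 + of_nat k) * poly (pderiv (rising_poly k)) 2 + (fact (Suc k) :: complex)"
    by (simp add: pderiv_mult pderiv_pCons rising_poly_at_2 distrib_right del: fact_Suc mult_pCons_right)
  also have "\<dots> = (2 + of_nat k) * (fact (Suc k) * (of_real (harm (Suc k)) - 1)) + fact (Suc k)"
    unfolding Suc ..
  also have "\<dots> = fact (Suc (Suc k)) * (of_real (harm (Suc k)) - 1) + fact (Suc k)"
    by (simp add: algebra_simps)
  also have "fact (Suc k) = fact (Suc (Suc k)) / (of_nat (Suc (Suc k)) :: complex)"
    by (simp del: of_nat_Suc)
  finally show ?case
    by (simp add: harm_Suc[of "Suc k"] field_simps del: fact_Suc of_nat_Suc)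
qed (simp add: rising_poly_def pderiv_1 harm_def)

lemma harm_gt_1: "m \<ge> 2 \<Longrightarrow> harm m > (1 :: real)"
proof -
  assume "m \<ge> 2"
  have "harm m \<ge> (harm 2 :: real)" using \<open>m \<ge> 2\<close> by (rule harm_mono)
  thus ?thesis by (simp add: harm_def numeral_2_eq_2)
qed

lemma of_real_harm_minus_1_nonzero:
  assumes "m \<ge> 2"
  shows "complex_of_real (harm m) - 1 \<noteq> 0"
proof -
  have "harm m - 1 \<noteq> (0::real)" using harm_gt_1[OF assms] by simp
  hence "complex_of_real (harm m - 1) \<noteq> 0" by (subst of_real_eq_0_iff)
  thus ?thesis unfolding of_real_diff of_real_1 .
qed

text \<open>The cofactor of x - 2 takes at 2 the value of the derivative of the whole polynomial,
  which is nonzero. So 2 is simple and \<open>rising_roots\<close> bounds all roots in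
  \<open>ls\<close>, listed with multiplicity. The product in the last conclusion is the same
  cofactor at 2.\<close>

lemma characteristic_factorization:
  assumes "2 \<le> m" "m \<le> 26"
  obtains ls :: "complex list" where
    "rising_poly (m - 1) + [:- fact m:] = (\<Prod>l\<leftarrow>ls. [:- l, 1:]) * [:- 2, 1:]"
    "\<forall>l\<in>set ls. Re l < 3/2" "length ls = m - 2"
    "(\<Prod>l\<leftarrow>ls. 2 - l) = fact m * (of_real (harm m) - 1)"
proof -
  define \<psi> :: "complex poly" where "\<psi> = rising_poly (m - 1) + [:- fact m:]"
  have m: "Suc (m - 1) = m" "m - 1 > 0" using assms by auto
  have deg: "degree \<psi> = m - 1" unfolding \<psi>_def
    using m monic_rising_poly(1)[of "m - 1"] by (subst degree_add_eq_left) auto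
  have lc: "lead_coeff \<psi> = 1"
  proof -
    have "coeff [:- fact m :: complex:] (m - 1) = 0" using m(2) by (cases "m - 1") auto
    thus ?thesis unfolding deg using monic_rising_poly[of "m - 1"] by (simp add: \<psi>_def)
  qed
  have "poly \<psi> 2 = 0" using rising_poly_at_2[of "m - 1"] m by (simp add: \<psi>_def)
  then obtain q where q: "\<psi> = [:-2, 1:] * q" by (auto simp: poly_eq_0_iff_dvd elim: dvdE)
  have "\<psi> \<noteq> 0" using lc by auto
  hence q0: "q \<noteq> 0" using q by auto
  have lcq: "lead_coeff q = 1" using lc unfolding q lead_coeff_mult by simp
  have degq: "degree q = m - 2"
    using deg q0 unfolding q by (subst (asm) degree_mult_eq) auto
  obtain A where A: "size A = degree q" "q = smult (lead_coeff q) (\<Prod>x\<in>#A. [:-x, 1:])"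
    using alg_closed_imp_factorization[OF q0] by blast
  obtain ls where ls: "mset ls = A" using ex_mset by blast
  have qls: "q = (\<Prod>l\<leftarrow>ls. [:- l, 1:])"
    using A(2) lcq unfolding ls[symmetric] by (simp add: prod_mset_prod_list flip: mset_map)
  have q2: "poly q 2 = fact m * (of_real (harm m) - 1)"
  proof -
    have "poly (pderiv \<psi>) 2 = poly q 2" unfolding q by (simp add: pderiv_mult pderiv_pCons del: mult_pCons_left)
    moreover have "pderiv \<psi> = pderiv (rising_poly (m - 1))" by (simp add: \<psi>_def pderiv_add pderiv_pCons)
    ultimately show ?thesis using pderiv_rising_poly_at_2[of "m - 1"] m by simp
  qed
  have "poly q 2 \<noteq> 0"
    using of_real_harm_minus_1_nonzero[OF assms(1)]
    unfolding q2 by (simp only: mult_eq_0_iff fact_nonzero simp_thms)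
  have "Re l < 3/2" if "l \<in> set ls" for l
  proof -
    have "poly q l = 0" using that unfolding qls by (induction ls) auto
    hence "l \<noteq> 2" "poly \<psi> l = 0" using \<open>poly q 2 \<noteq> 0\<close> unfolding q by auto
    thus ?thesis using rising_roots[OF assms, of l] by (simp add: \<psi>_def poly_rising_poly)
  qed
  moreover have "(\<Prod>l\<leftarrow>ls. 2 - l) = poly q 2"
    unfolding qls by (induction ls) (auto simp: algebra_simps)
  moreover have "length ls = m - 2" using A(1) degq ls by auto
  ultimately show ?thesis using that[of ls] q2 q unfolding qls \<psi>_def by (auto simp: mult.commute)
qed

lemma theta_poly_diff_const:
  "theta_poly (p + [:- c:]) F = theta_poly p F - fps_const c * F"
  by (subst theta_poly_add) (simp flip: fps_const_neg)

lemma small1_const_mult: "small1 F \<Longrightarrow> small1 (fps_const c * F)"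
  using summable_mult[of "\<lambda>n. cmod (F $ n) * weight n" "cmod c"]
  by (simp add: small1_def norm_mult mult.assoc)

lemma small2_const_mult:
  assumes "small2 F" shows "small2 (fps_const c * F)"
proof -
  have "(\<lambda>n. (cmod c)\<^sup>2 * (cmod (F $ n) ^ 2 / real (n + 1))) \<longlonglongrightarrow> (cmod c)\<^sup>2 * 0"
    using assms by (intro tendsto_mult_left) (simp add: small2_def)
  moreover have "summable (\<lambda>n. (cmod c)\<^sup>2 * (cmod (F $ n) ^ 2 * weight n))"
    using assms by (intro summable_mult) (simp add: small2_def)
  ultimately show ?thesis by (simp add: small2_def norm_mult power_mult_distrib mult.assoc)
qed

lemma fps_mean_const_mult: "small1 F \<Longrightarrow> fps_mean (fps_const c * F) = c * fps_mean F"
  using suminf_mult[OF small1_summable[of F], of c] by (simp add: fps_mean_def mult.assoc)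

lemma small2_add:
  assumes "small2 F" "small2 G" shows "small2 (F + G)"
proof -
  have le: "cmod (F $ n + G $ n) ^ 2 \<le> 2 * cmod (F $ n) ^ 2 + 2 * cmod (G $ n) ^ 2" for n
  proof -
    have "cmod (F $ n + G $ n) ^ 2 \<le> (cmod (F $ n) + cmod (G $ n)) ^ 2"
      by (intro power_mono norm_triangle_ineq) auto
    also have "\<dots> \<le> 2 * cmod (F $ n) ^ 2 + 2 * cmod (G $ n) ^ 2"
      using zero_le_power2[of "cmod (F $ n) - cmod (G $ n)"] by (simp add: power2_eq_square algebra_simps)
    finally show ?thesis .
  qed
  have "(\<lambda>n. cmod ((F + G) $ n) ^ 2 / real (n + 1)) \<longlonglongrightarrow> 0"
  proof (rule tendsto_sandwich[OF _ _ tendsto_const])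
    have "(\<lambda>n. 2 * (cmod (F $ n) ^ 2 / real (n + 1)) + 2 * (cmod (G $ n) ^ 2 / real (n + 1))) \<longlonglongrightarrow> 2 * 0 + 2 * 0"
      using assms by (intro tendsto_intros) (simp_all add: small2_def)
    thus "(\<lambda>n. 2 * (cmod (F $ n) ^ 2 / real (n + 1)) + 2 * (cmod (G $ n) ^ 2 / real (n + 1))) \<longlonglongrightarrow> 0" by simp
    show "eventually (\<lambda>n. cmod ((F + G) $ n) ^ 2 / real (n + 1) \<le>
      2 * (cmod (F $ n) ^ 2 / real (n + 1)) + 2 * (cmod (G $ n) ^ 2 / real (n + 1))) sequentially"
    proof (rule always_eventually, rule allI)
      fix n
      have "cmod ((F + G) $ n) ^ 2 / real (n + 1) \<le> (2 * cmod (F $ n) ^ 2 + 2 * cmod (G $ n) ^ 2) / real (n + 1)"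
        using le[of n] by (intro divide_right_mono) auto
      thus "cmod ((F + G) $ n) ^ 2 / real (n + 1) \<le>
        2 * (cmod (F $ n) ^ 2 / real (n + 1)) + 2 * (cmod (G $ n) ^ 2 / real (n + 1))"
        by (simp add: add_divide_distrib)
    qed
  qed simp
  moreover have "summable (\<lambda>n. cmod ((F + G) $ n) ^ 2 * weight n)"
  proof (rule summable_comparison_test'[where N = 0])
    show "summable (\<lambda>n. 2 * (cmod (F $ n) ^ 2 * weight n) + 2 * (cmod (G $ n) ^ 2 * weight n))"
      using assms by (intro summable_add summable_mult) (simp_all add: small2_def)
    fix n
    have "cmod ((F + G) $ n) ^ 2 * weight n \<le> (2 * cmod (F $ n) ^ 2 + 2 * cmod (G $ n) ^ 2) * weight n"
      using le[of n] weight_pos[of n] by (intro mult_right_mono) auto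
    thus "norm (cmod ((F + G) $ n) ^ 2 * weight n) \<le> 2 * (cmod (F $ n) ^ 2 * weight n) + 2 * (cmod (G $ n) ^ 2 * weight n)"
      using weight_pos[of n] by (simp add: algebra_simps abs_mult)
  qed
  ultimately show ?thesis by (simp add: small2_def)
qed

lemma split_avg_of_real: "split_avg m (\<lambda>n. of_real (a n)) n = (of_real (split_avg m a n) :: complex)"
proof -
  have "sum_list (map (\<lambda>n. of_real (a n)) js) = (of_real (sum_list (map a js)) :: complex)" for js
    by (induction js) auto
  thus ?thesis by (simp add: split_avg_def)
qed

text \<open>The factors other than \<theta> - 2 are inverted first and yield Y = (\<theta> - 2) C
  with control of its size and mean. The mean of B divided by the cofactor at 2 gives K, the factor
  m! cancelling; K is the slope of C.\<close>

theorem asymptotic_transfer: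
  fixes a b :: "nat \<Rightarrow> real"
  assumes m: "2 \<le> m" "m \<le> 26"
    and rec: "\<And>n. a n = b n + split_avg m a n"
    and b: "summable (\<lambda>n. \<bar>b n\<bar> * weight n)"
  defines "K \<equiv> (\<Sum>n. b n * weight n) / (harm m - 1)"
  shows "(\<lambda>n. (a n - b n) / real (n + 1)) \<longlonglongrightarrow> K"
    and "(\<lambda>n. (b n)\<^sup>2 / real (n + 1)) \<longlonglongrightarrow> 0 \<Longrightarrow> summable (\<lambda>n. (b n)\<^sup>2 * weight n) \<Longrightarrow>
           (\<lambda>n. (a n - K * real (n + 1))\<^sup>2 / real (n + 1)) \<longlonglongrightarrow> 0 \<and>
           summable (\<lambda>n. (a n - K * real (n + 1))\<^sup>2 * weight n)"
proof -
  define A B C where "A = Abs_fps (\<lambda>n. complex_of_real (a n))"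
    and "B = Abs_fps (\<lambda>n. complex_of_real (b n))" and "C = Abs_fps (split_avg m (\<lambda>n. complex_of_real (a n)))"
  have C_eq: "C $ n = of_real (a n - b n)" for n
    using rec[of n] by (simp add: C_def split_avg_of_real)
  have AC: "A = B + C" by (rule fps_ext) (simp add: A_def B_def C_eq)
  obtain ls where ls: "rising_poly (m - 1) + [:- fact m:] = (\<Prod>l\<leftarrow>ls. [:- l, 1:]) * [:- 2, 1 :: complex:]"
    "\<forall>l\<in>set ls. Re l < 3/2" "length ls = m - 2" "(\<Prod>l\<leftarrow>ls. 2 - l) = fact m * (of_real (harm m) - 1)"
    using characteristic_factorization[OF m] by metis
  define Y where "Y = theta_poly [:-2, 1:] C"
  have eqY: "theta_poly (\<Prod>l\<leftarrow>ls. [:- l, 1:]) Y = fps_const (fact m) * B"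
  proof -
    have "theta_poly (\<Prod>l\<leftarrow>ls. [:- l, 1:]) Y = theta_poly (rising_poly (m - 1) + [:- fact m:]) C"
      unfolding ls(1) theta_poly_mult Y_def ..
    also have "\<dots> = fps_const (fact m) * A - fps_const (fact m) * C"
      unfolding theta_poly_diff_const using theta_poly_split_avg[of m "\<lambda>n. complex_of_real (a n)"] m
      by (simp add: C_def A_def)
    finally show ?thesis by (simp add: AC algebra_simps)
  qed
  \<comment> \<open>The convention in \<open>split_avg\<close> for small n is used here: it supplies
    m - 1 zeros, of which \<theta> - 2 consumes one.\<close>
  have C0: "C $ i = 0" if "i < m - 1" for i using that by (simp add: C_def split_avg_def)
  have Y0: "Y $ i = 0" if "i < length ls" for i unfolding Y_def
    using that ls(3) by (intro theta_poly_initial_zeros[of "m - 1"] C0) auto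
  have B1: "small1 B" using b by (simp add: small1_def B_def)
  have Y: "small1 Y" "small2 (fps_const (fact m) * B) \<Longrightarrow> small2 Y"
    "fps_mean (fps_const (fact m) * B) = (\<Prod>l\<leftarrow>ls. 2 - l) * fps_mean Y"
    using theta_prod_small[OF eqY small1_const_mult[OF B1] ls(2)] Y0 by blast+
  have nz: "complex_of_real (harm m) - 1 \<noteq> 0" by (rule of_real_harm_minus_1_nonzero[OF m(1)])
  have "fact m * fps_mean B = fact m * ((of_real (harm m) - 1) * fps_mean Y)"
    using Y(3) fps_mean_const_mult[OF B1] ls(4) by simp
  hence "fps_mean B = (of_real (harm m) - 1) * fps_mean Y"
    by (subst (asm) mult_left_cancel) simp_all
  hence "fps_mean Y = fps_mean B / (of_real (harm m) - 1)" using nz by (simp add: field_simps)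
  also have "fps_mean B = of_real (\<Sum>n. b n * weight n)"
  proof -
    have "summable (\<lambda>n. norm (b n * weight n))" using b weight_pos by (simp add: abs_mult abs_of_pos)
    hence "summable (\<lambda>n. b n * weight n)" by (rule summable_norm_cancel)
    from suminf_of_real[OF this, where 'a = complex] show ?thesis by (simp add: fps_mean_def B_def)
  qed
  finally have meanY: "fps_mean Y = of_real K" by (simp add: K_def)
  have C00: "C $ 0 = 0" using C0[of 0] m by simp
  have limC: "(\<lambda>n. C $ n / of_nat (n + 1)) \<longlonglongrightarrow> of_real K"
    using theta_two_limit[OF Y_def[symmetric] C00 Y(1)] unfolding meanY .
  have Cn: "C $ n / of_nat (n + 1) = of_real ((a n - b n) / real (n + 1))" for n
    unfolding C_eq by simp
  show lim: "(\<lambda>n. (a n - b n) / real (n + 1)) \<longlonglongrightarrow> K"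
    using limC unfolding Cn by (rule tendsto_of_real_iff[THEN iffD1])
  assume b2: "(\<lambda>n. (b n)\<^sup>2 / real (n + 1)) \<longlonglongrightarrow> 0" "summable (\<lambda>n. (b n)\<^sup>2 * weight n)"
  have B2: "small2 B" using b2 by (simp add: small2_def B_def)
  have Y2: "small2 Y" by (rule Y(2)[OF small2_const_mult[OF B2]])
  \<comment> \<open>The sequence n + 1 spans the kernel of \<theta> - 2, so subtracting its multiple
    keeps the equation for Y and removes the linear growth.\<close>
  define L where "L = Abs_fps (\<lambda>n. of_nat (n + 1) :: complex)"
  define D where "D = C - fps_const (of_real K) * L"
  have L: "theta_poly [:-2, 1:] L = 0"
    by (rule fps_ext) (simp add: fps_theta_nth L_def algebra_simps)
  have D_eq: "theta_poly [:-2, 1:] D = Y"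
  proof -
    have "theta_poly [:-2, 1:] D = theta_poly [:-2, 1:] C + fps_const (- of_real K) * theta_poly [:-2, 1:] L"
      by (simp add: D_def fps_theta_add fps_theta_const_mult algebra_simps fps_theta_def flip: fps_const_neg)
    thus ?thesis unfolding L Y_def by simp
  qed
  have Dn: "D $ n = of_real (a n - b n - K * real (n + 1))" for n
    by (simp add: D_def C_eq L_def)
  have "(\<lambda>n. cmod (D $ n) / real (n + 1)) \<longlonglongrightarrow> 0"
  proof -
    have "(\<lambda>n. (a n - b n) / real (n + 1) - K) \<longlonglongrightarrow> K - K" by (intro tendsto_intros lim)
    hence "(\<lambda>n. norm ((a n - b n) / real (n + 1) - K)) \<longlonglongrightarrow> 0" by (intro tendsto_norm_zero) simp
    moreover have "norm ((a n - b n) / real (n + 1) - K) = cmod (D $ n) / real (n + 1)" for n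
    proof -
      have "(a n - b n) / real (n + 1) - K = (a n - b n - K * real (n + 1)) / real (n + 1)"
        by (simp add: diff_divide_distrib)
      thus ?thesis unfolding Dn norm_of_real by (simp only: real_norm_def abs_divide)
    qed
    ultimately show ?thesis by simp
  qed
  hence "small2 D" by (rule theta_two_remainder_small2[OF D_eq _ Y2])
  hence "small2 (B + D)" by (rule small2_add[OF B2])
  moreover have "(B + D) $ n = of_real (a n - K * real (n + 1))" for n by (simp add: B_def Dn)
  ultimately show "(\<lambda>n. (a n - K * real (n + 1))\<^sup>2 / real (n + 1)) \<longlonglongrightarrow> 0 \<and>
           summable (\<lambda>n. (a n - K * real (n + 1))\<^sup>2 * weight n)"
    unfolding small2_def by (simp del: of_real_diff of_real_mult of_real_add fps_add_nth)
qed

section \<open>The recursion for the distribution\<close>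

definition tree_value :: "nat \<Rightarrow> (nat \<Rightarrow> real) \<Rightarrow> 'k::linorder list \<Rightarrow> real" where
  "tree_value m t xs = additive_functional m t (mst m xs)"

text \<open>A label that depends on the set of root keys only, not on their order of arrival or on
  the sorted list. This lets one condition on that set alone.\<close>

definition rank_in :: "'k::linorder set \<Rightarrow> 'k \<Rightarrow> nat" where
  "rank_in K x = card {k \<in> K. k < x}"

lemma rank_in_le: "finite K \<Longrightarrow> rank_in K x \<le> card K"
  unfolding rank_in_def by (intro card_mono) auto

text \<open>The indices of root keys below x form an initial segment, and lying in gap j says that
  this segment has length j.\<close>

lemma in_gap_iff_rank:
  assumes "sorted_wrt (<) ks" "x \<notin> set ks" "j \<le> length ks"
  shows "in_gap ks j x \<longleftrightarrow> rank_in (set ks) x = j"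
proof -
  have ks: "sorted ks" "distinct ks" using assms(1) by (simp_all add: strict_sorted_iff)
  have mono: "ks ! i < ks ! l \<longleftrightarrow> i < l" if "i < length ks" "l < length ks" for i l
    using sorted_wrt_nth_less[OF assms(1), of i l] sorted_wrt_nth_less[OF assms(1), of l i] that
    by (cases i l rule: linorder_cases) auto
  define I where "I = {i. i < length ks \<and> ks ! i < x}"
  have "{k \<in> set ks. k < x} = (!) ks ` I" by (auto simp: I_def in_set_conv_nth)
  moreover have "inj_on ((!) ks) I" using ks(2) by (auto simp: inj_on_def I_def nth_eq_iff_index_eq)
  ultimately have rank: "rank_in (set ks) x = card I" by (simp add: rank_in_def card_image)
  have down: "l \<in> I" if "i \<in> I" "l \<le> i" for i l
    using that sorted_nth_mono[OF ks(1), of l i] by (auto simp: I_def)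
  have nx: "ks ! i \<noteq> x" if "i < length ks" for i using assms(2) that by auto
  show ?thesis
  proof
    assume gap: "in_gap ks j x"
    have "I = {..<j}"
    proof (intro equalityI subsetI)
      fix i assume i: "i \<in> I"
      show "i \<in> {..<j}"
      proof (rule ccontr)
        assume "i \<notin> {..<j}"
        hence "ks ! j < x" "j < length ks" using down[OF i, of j] by (auto simp: I_def)
        thus False using gap by (auto simp: in_gap_def)
      qed
    next
      fix i assume i: "i \<in> {..<j}"
      hence "ks ! (j - 1) < x" using gap by (auto simp: in_gap_def)
      hence "j - 1 \<in> I" using i assms(3) by (auto simp: I_def)
      thus "i \<in> I" using down i by auto
    qed
    thus "rank_in (set ks) x = j" using rank by simp
  next
    assume r: "rank_in (set ks) x = j"
    have fin: "finite I" by (simp add: I_def)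
    have "I = {..<j}"
    proof -
      have "I \<subseteq> {..<card I}"
      proof
        fix i assume i: "i \<in> I"
        hence "{..i} \<subseteq> I" using down by auto
        from card_mono[OF fin this] show "i \<in> {..<card I}" by simp
      qed
      hence "I = {..<card I}" by (intro card_subset_eq) auto
      thus ?thesis using r rank by simp
    qed
    hence "j > 0 \<Longrightarrow> j - 1 \<in> I" and jI: "j \<notin> I" by auto
    hence "j = 0 \<or> ks ! (j - 1) < x" by (auto simp: I_def)
    moreover have "j = length ks \<or> x < ks ! j"
      using jI assms(3) nx[of j] by (cases "j < length ks") (auto simp: I_def)
    ultimately show "in_gap ks j x" by (simp add: in_gap_def)
  qed
qed

lemma sum_length_filter_label:
  "(\<And>x. x \<in> set xs \<Longrightarrow> c x < (m::nat)) \<Longrightarrow> (\<Sum>j<m. length (filter (\<lambda>x. c x = j) xs)) = length xs"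
proof (induction xs)
  case (Cons x xs)
  have cx: "c x < m" using Cons.prems by simp
  have "(\<Sum>j<m. length (filter (\<lambda>y. c y = j) (x # xs))) =
    (\<Sum>j<m. (if c x = j then 1 else 0) + length (filter (\<lambda>y. c y = j) xs))"
    by (intro sum.cong) auto
  also have "\<dots> = (\<Sum>j<m. if c x = j then 1 else 0) + length xs"
    using Cons by (simp add: sum.distrib)
  also have "(\<Sum>j<m. if c x = j then 1 else 0) = (1::nat)"
    using cx by (subst sum.delta') auto
  also have "1 + length xs = Suc (length xs)" by simp
  finally show ?case by simp
qed simp

text \<open>A tree with exactly m - 1 keys is built by the other branch of \<open>mst\<close>, with
  empty subtrees. Treating it here together with the larger ones gives one recursion for all sizes
  from m - 1 on.\<close>

lemma root_split:
  assumes "m \<ge> 2" "distinct xs" "m - 1 \<le> length xs"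
  defines "K \<equiv> set (take (m - 1) xs)" and "zs \<equiv> drop (m - 1) xs"
  shows "mst m xs = Node (sort (take (m - 1) xs)) (map (\<lambda>j. mst m (filter (\<lambda>x. rank_in K x = j) zs)) [0..<m])"
    and "\<And>x. x \<in> set zs \<Longrightarrow> rank_in K x < m"
proof -
  have ne: "xs \<noteq> []" using assms by auto
  have cK: "card K = m - 1" unfolding K_def using assms by (subst distinct_card) auto
  show rank: "rank_in K x < m" if "x \<in> set zs" for x
    using rank_in_le[of K x] cK assms(1) by (simp add: K_def)
  have disj: "set zs \<inter> K = {}" unfolding zs_def K_def using assms(2) by (metis inf_commute set_take_disj_set_drop_if_distinct order_refl)
  have gap: "in_gap (sort (take (m - 1) xs)) j x \<longleftrightarrow> rank_in K x = j" if "x \<in> set zs" "j < m" for x j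
    using that disj assms by (subst in_gap_iff_rank) (auto simp: strict_sorted_iff K_def)
  show "mst m xs = Node (sort (take (m - 1) xs)) (map (\<lambda>j. mst m (filter (\<lambda>x. rank_in K x = j) zs)) [0..<m])"
  proof (cases "length xs < m")
    case True
    hence "length xs = m - 1" using assms by simp
    hence "zs = []" "take (m - 1) xs = xs" by (simp_all add: zs_def)
    thus ?thesis using True ne by (simp add: mst.simps[of m xs] mst.simps[of m "[]"] map_replicate_const)
  next
    case False
    have "map (\<lambda>j. mst m (filter (in_gap (sort (take (m - 1) xs)) j) zs)) [0..<m] =
          map (\<lambda>j. mst m (filter (\<lambda>x. rank_in K x = j) zs)) [0..<m]"
      using gap by (intro map_cong refl arg_cong[of _ _ "mst m"] filter_cong) auto
    thus ?thesis using False ne assms(1) by (subst mst.simps) (simp add: zs_def Let_def)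
  qed
qed

lemma num_keys_mst:
  assumes "m \<ge> 2" "distinct xs"
  shows "num_keys (mst m xs) = length xs"
  using assms(2)
proof (induction xs rule: length_induct)
  case (1 xs)
  show ?case
  proof (cases "m - 1 \<le> length xs")
    case True
    define K zs where "K = set (take (m - 1) xs)" and "zs = drop (m - 1) xs"
    note split = root_split[OF assms(1) 1(2) True, folded K_def zs_def]
    have "num_keys (mst m (filter (\<lambda>x. rank_in K x = j) zs)) = length (filter (\<lambda>x. rank_in K x = j) zs)" for j
    proof -
      have "length (filter (\<lambda>x. rank_in K x = j) zs) \<le> length zs" by (rule length_filter_le)
      also have "\<dots> < length xs" using True assms(1) by (simp add: zs_def)
      finally show ?thesis using 1 by (auto simp: zs_def)
    qed
    hence "num_keys (mst m xs) = (m - 1) + (\<Sum>j<m. length (filter (\<lambda>x. rank_in K x = j) zs))"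
      unfolding split(1) using True by (simp add: o_def interv_sum_list_conv_sum_set_nat atLeast0LessThan)
    also have "(\<Sum>j<m. length (filter (\<lambda>x. rank_in K x = j) zs)) = length zs"
      by (rule sum_length_filter_label[OF split(2)])
    finally show ?thesis using True by (simp add: zs_def)
  next
    case False
    have "sum_list (replicate n 0) = (0::nat)" for n by (induction n) auto
    thus ?thesis using False by (subst mst.simps) (auto simp: o_def)
  qed
qed

lemma tree_value_small:
  assumes "m \<ge> 2" "distinct xs" "length xs \<le> m - 2"
  shows "tree_value m t xs = t (length xs)"
proof -
  have "num_keys (mst m xs) = length xs" using num_keys_mst assms by blast
  thus ?thesis using assms(3) by (cases "mst m xs") (auto simp: tree_value_def)
qed

lemma tree_value_split:
  assumes "m \<ge> 2" "distinct (ys @ zs)" "length ys = m - 1"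
  shows "tree_value m t (ys @ zs) =
    (\<Sum>j\<leftarrow>[0..<m]. tree_value m t (filter (\<lambda>x. rank_in (set ys) x = j) zs)) + t (length (ys @ zs))"
proof -
  have "m - 1 \<le> length (ys @ zs)" using assms by simp
  note split = root_split(1)[OF assms(1,2) this]
  have nk: "num_keys (mst m (ys @ zs)) = length (ys @ zs)" by (rule num_keys_mst[OF assms(1,2)])
  moreover have "\<not> length (ys @ zs) \<le> m - 2" using assms by simp
  ultimately show ?thesis unfolding tree_value_def split using assms(3)
    by (simp add: o_def del: num_keys.simps)
qed

text \<open>Ranks, and hence all splits, are invariant under order-preserving relabelling, so the
  keys of a subtree may be renumbered.\<close>

lemma tree_value_map_strict_mono:
  assumes "m \<ge> 2" "distinct xs" "strict_mono_on S f" "set xs \<subseteq> S"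
  shows "tree_value m t (map f xs) = tree_value m t xs"
  using assms(2,4)
proof (induction xs rule: length_induct)
  case (1 xs)
  have inj: "inj_on f S" using assms(3) by (rule strict_mono_on_imp_inj_on)
  have d: "distinct (map f xs)" using 1 inj by (auto simp: distinct_map intro: inj_on_subset)
  show ?case
  proof (cases "m - 1 \<le> length xs")
    case True
    define ys zs where "ys = take (m - 1) xs" and "zs = drop (m - 1) xs"
    have xs: "xs = ys @ zs" by (simp add: ys_def zs_def)
    have len: "length ys = m - 1" using True by (simp add: ys_def)
    have rank: "rank_in (f ` set ys) (f x) = rank_in (set ys) x" if "x \<in> set zs" for x
    proof -
      have S: "set ys \<subseteq> S" "x \<in> S" using 1(3) that xs by auto
      have "{k \<in> f ` set ys. k < f x} = f ` {k \<in> set ys. k < x}"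
        using S strict_mono_on_less[OF assms(3)] by auto
      moreover have "inj_on f {k \<in> set ys. k < x}" using inj by (rule inj_on_subset) (use S in auto)
      ultimately show ?thesis by (simp add: rank_in_def card_image)
    qed
    have eq: "tree_value m t (filter (\<lambda>x. rank_in (f ` set ys) x = j) (map f zs)) =
       tree_value m t (filter (\<lambda>x. rank_in (set ys) x = j) zs)" for j
    proof -
      have "filter (\<lambda>x. rank_in (f ` set ys) x = j) (map f zs) = map f (filter (\<lambda>x. rank_in (set ys) x = j) zs)"
        unfolding filter_map o_def using rank by (intro arg_cong[of _ _ "map f"] filter_cong) auto
      moreover have "length (filter (\<lambda>x. rank_in (set ys) x = j) zs) < length xs"
        using True assms(1) le_less_trans[OF length_filter_le, of zs "length xs"] by (simp add: zs_def)
      moreover have "distinct (filter (\<lambda>x. rank_in (set ys) x = j) zs)" "set (filter (\<lambda>x. rank_in (set ys) x = j) zs) \<subseteq> S"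
        using 1(2,3) xs by auto
      ultimately show ?thesis using 1(1) by metis
    qed
    have "tree_value m t (map f xs) = tree_value m t (map f ys @ map f zs)" by (simp add: xs)
    also have "\<dots> = tree_value m t (ys @ zs)"
      using d 1(2) len unfolding xs
      by (subst (1 2) tree_value_split) (auto simp: assms(1) eq)
    finally show ?thesis by (simp add: xs)
  next
    case False
    thus ?thesis using tree_value_small[OF assms(1) d] tree_value_small[OF assms(1) 1(2)] by simp
  qed
qed

lemma X_dist_eq: "X_dist m t n = map_pmf (tree_value m t) (pmf_of_set (permutations_of_set {1..n}))"
  by (simp add: X_dist_def random_mst_def pmf.map_comp o_def tree_value_def[abs_def])

lemma random_tree_value:
  fixes S :: "nat set"
  assumes "m \<ge> 2" "finite S"
  shows "map_pmf (tree_value m t) (pmf_of_set (permutations_of_set S)) = X_dist m t (card S)"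
proof -
  have std: "map_pmf (tree_value m t) (pmf_of_set (permutations_of_set T)) =
     map_pmf (tree_value m t) (pmf_of_set (permutations_of_set {..<card T}))" if T: "finite T" for T :: "nat set"
  proof -
    obtain h where h: "bij_betw h {..<card T} T" "strict_mono_on {..<card T} h"
      using ex_bij_betw_strict_mono_card[OF T] by blast
    have inj: "inj_on h {..<card T}" and im: "h ` {..<card T} = T" using h(1) by (auto simp: bij_betw_def)
    have "permutations_of_set T = map h ` permutations_of_set {..<card T}"
      using permutations_of_set_image_inj[OF inj] unfolding im .
    moreover have "inj_on (map h) (permutations_of_set {..<card T})"
      by (rule inj_on_subset[OF inj_on_mapI[of h "permutations_of_set {..<card T}"]])
         (use inj in \<open>auto simp: permutations_of_set_def inj_on_def\<close>)
    ultimately have "pmf_of_set (permutations_of_set T) = map_pmf (map h) (pmf_of_set (permutations_of_set {..<card T}))"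
      by (subst map_pmf_of_set_inj) auto
    hence "map_pmf (tree_value m t) (pmf_of_set (permutations_of_set T)) =
       map_pmf (\<lambda>xs. tree_value m t (map h xs)) (pmf_of_set (permutations_of_set {..<card T}))"
      by (simp add: pmf.map_comp o_def)
    also have "\<dots> = map_pmf (tree_value m t) (pmf_of_set (permutations_of_set {..<card T}))"
    proof (intro map_pmf_cong refl tree_value_map_strict_mono[OF assms(1) _ h(2)])
      fix xs assume "xs \<in> set_pmf (pmf_of_set (permutations_of_set {..<card T}))"
      hence "xs \<in> permutations_of_set {..<card T}" by (subst (asm) set_pmf_of_set) auto
      thus "distinct xs" "set xs \<subseteq> {..<card T}" by (auto simp: permutations_of_set_def)
    qed
    finally show ?thesis .
  qed
  show ?thesis using std[OF assms(2)] std[of "{1..card S}"] by (simp add: X_dist_eq)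
qed

primrec sum_dist :: "(nat \<Rightarrow> real pmf) \<Rightarrow> nat list \<Rightarrow> real pmf" where
  "sum_dist X [] = return_pmf 0"
| "sum_dist X (j # js) = map_pmf (\<lambda>(x, y). x + y) (pair_pmf (X j) (sum_dist X js))"

text \<open>Separating a uniformly random permutation by a predicate gives two independent uniformly
  random permutations. Peeling off one label at a time turns this into independence of all
  subtrees.\<close>

lemma random_forest_value:
  fixes S :: "nat set"
  assumes "m \<ge> 2" "finite S" "distinct L"
  shows "map_pmf (\<lambda>zs. \<Sum>j\<leftarrow>L. tree_value m t (filter (\<lambda>x. c x = j) zs)) (pmf_of_set (permutations_of_set S)) =
     sum_dist (X_dist m t) (map (\<lambda>j. card {x \<in> S. c x = j}) L)"
  using assms(2,3)
proof (induction L arbitrary: S)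
  case (Cons j L)
  define P where "P x \<longleftrightarrow> c x = j" for x
  have "map_pmf (\<lambda>zs. \<Sum>j\<leftarrow>j # L. tree_value m t (filter (\<lambda>x. c x = j) zs)) (pmf_of_set (permutations_of_set S)) =
    map_pmf (\<lambda>(us, vs). tree_value m t us + (\<Sum>j\<leftarrow>L. tree_value m t (filter (\<lambda>x. c x = j) vs)))
      (map_pmf (partition P) (pmf_of_set (permutations_of_set S)))"
  proof -
    have "filter (\<lambda>x. c x = i) zs = filter (\<lambda>x. c x = i) (filter (\<lambda>x. \<not> P x) zs)" if "i \<in> set L" for i zs
      using that Cons.prems(2) unfolding filter_filter by (intro filter_cong) (auto simp: P_def)
    hence "(\<Sum>i\<leftarrow>L. tree_value m t (filter (\<lambda>x. c x = i) zs)) =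
        (\<Sum>i\<leftarrow>L. tree_value m t (filter (\<lambda>x. c x = i) (filter (\<lambda>x. \<not> P x) zs)))" for zs
      by (intro arg_cong[of _ _ sum_list] map_cong) auto
    thus ?thesis by (simp add: pmf.map_comp o_def P_def[abs_def])
  qed
  also have "\<dots> = map_pmf (\<lambda>(us, vs). tree_value m t us + (\<Sum>j\<leftarrow>L. tree_value m t (filter (\<lambda>x. c x = j) vs)))
     (pair_pmf (pmf_of_set (permutations_of_set {x\<in>S. P x})) (pmf_of_set (permutations_of_set {x\<in>S. \<not> P x})))"
    using Cons.prems(1) by (subst partition_random_permutations) auto
  also have "\<dots> = map_pmf (\<lambda>(x, y). x + y) (pair_pmf
      (map_pmf (tree_value m t) (pmf_of_set (permutations_of_set {x\<in>S. P x})))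
      (map_pmf (\<lambda>vs. \<Sum>j\<leftarrow>L. tree_value m t (filter (\<lambda>x. c x = j) vs)) (pmf_of_set (permutations_of_set {x\<in>S. \<not> P x}))))"
    by (simp add: map_pair[symmetric] pmf.map_comp o_def split_def)
  also have "\<dots> = map_pmf (\<lambda>(x, y). x + y) (pair_pmf (X_dist m t (card {x\<in>S. P x}))
      (sum_dist (X_dist m t) (map (\<lambda>j. card {x \<in> {x \<in> S. \<not> P x}. c x = j}) L)))"
    using Cons by (simp add: random_tree_value[OF assms(1)])
  also have "map (\<lambda>j. card {x \<in> {x \<in> S. \<not> P x}. c x = j}) L = map (\<lambda>j. card {x \<in> S. c x = j}) L"
    using Cons.prems(2) by (intro map_cong refl arg_cong[of _ _ card]) (auto simp: P_def)
  finally show ?case by (simp add: P_def)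
qed simp

lemma pair_pmf_of_set:
  assumes "finite A" "finite B" "A \<noteq> {}" "B \<noteq> {}"
  shows "pair_pmf (pmf_of_set A) (pmf_of_set B) = pmf_of_set (A \<times> B)"
proof (rule pmf_eqI)
  fix x show "pmf (pair_pmf (pmf_of_set A) (pmf_of_set B)) x = pmf (pmf_of_set (A \<times> B)) x"
    using assms by (cases x) (simp add: pmf_pair pmf_of_set card_cartesian_product indicator_def)
qed

text \<open>Grouping the permutations by the set K of their first k entries gives disjoint blocks of
  equal size k! (|S| - k)!, so K is uniform and, given K, the two parts are independent and
  uniform.\<close>

lemma random_permutation_split:
  assumes "finite S" "k \<le> card S"
  shows "pmf_of_set (permutations_of_set S) =
    bind_pmf (pmf_of_set {K. K \<subseteq> S \<and> card K = k}) (\<lambda>K.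
      map_pmf (\<lambda>(ys, zs). ys @ zs)
        (pair_pmf (pmf_of_set (permutations_of_set K)) (pmf_of_set (permutations_of_set (S - K)))))"
proof -
  let ?A = "{K. K \<subseteq> S \<and> card K = k}"
  define f where "f K = (\<lambda>(ys, zs). ys @ zs) ` (permutations_of_set K \<times> permutations_of_set (S - K))" for K
  have inj: "inj_on (\<lambda>(ys, zs). ys @ zs) (permutations_of_set K \<times> permutations_of_set (S - K))" for K
    by (auto simp: inj_on_def append_eq_append_conv dest!: length_finite_permutations_of_set)
  have finK: "finite K" if "K \<in> ?A" for K using that assms(1) finite_subset by auto
  have UN: "permutations_of_set S = (\<Union>K\<in>?A. f K)"
  proof (intro equalityI subsetI)
    fix xs assume xs: "xs \<in> permutations_of_set S"
    hence S: "set xs = S" "distinct xs" "length xs = card S"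
      by (auto simp: permutations_of_set_def distinct_card)
    define K where "K = set (take k xs)"
    have "K \<in> ?A" using S assms(2) by (auto simp: K_def distinct_card dest: in_set_takeD)
    moreover have "K \<union> set (drop k xs) = S"
      unfolding K_def S(1)[symmetric] by (simp flip: set_append)
    hence "S - K = set (drop k xs)"
      using set_take_disj_set_drop_if_distinct[OF S(2), of k k] by (auto simp: K_def)
    hence "(take k xs, drop k xs) \<in> permutations_of_set K \<times> permutations_of_set (S - K)"
      using S(2) by (auto simp: K_def)
    hence "xs \<in> f K" unfolding f_def by (intro image_eqI[of _ _ "(take k xs, drop k xs)"]) auto
    ultimately show "xs \<in> (\<Union>K\<in>?A. f K)" by blast
  next
    fix xs assume "xs \<in> (\<Union>K\<in>?A. f K)"
    thus "xs \<in> permutations_of_set S" by (fastforce simp: f_def permutations_of_set_def)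
  qed
  have "pmf_of_set (\<Union>K\<in>?A. f K) = bind_pmf (pmf_of_set ?A) (\<lambda>K. pmf_of_set (f K))"
  proof (rule pmf_of_set_UN[where n = "fact k * fact (card S - k)"])
    show "finite (\<Union>K\<in>?A. f K)" unfolding UN[symmetric] by simp
    show "?A \<noteq> {}" using obtain_subset_with_card_n[OF assms(2)] by auto
    show "f K \<noteq> {}" if "K \<in> ?A" for K using finK[OF that] assms(1) by (auto simp: f_def permutations_of_set_empty_iff)
    show "card (f K) = fact k * fact (card S - k)" if "K \<in> ?A" for K
      using that finK[OF that] assms(1) unfolding f_def card_image[OF inj]
      by (simp add: card_cartesian_product card_Diff_subset)
    show "disjoint_family_on f ?A"
    proof (unfold disjoint_family_on_def, intro ballI impI, rule ccontr)
      fix K K' assume K: "K \<in> ?A" "K' \<in> ?A" "K \<noteq> K'" and "f K \<inter> f K' \<noteq> {}"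
      then obtain ys zs ys' zs' where eq: "ys @ zs = ys' @ zs'"
        "ys \<in> permutations_of_set K" "ys' \<in> permutations_of_set K'" by (auto simp: f_def)
      hence "length ys = length ys'"
        using K length_finite_permutations_of_set[OF eq(2)] length_finite_permutations_of_set[OF eq(3)] by simp
      hence "ys = ys'" using eq(1) by simp
      thus False using eq(2,3) K(3) by (auto simp: permutations_of_set_def)
    qed
  qed
  also have "\<dots> = bind_pmf (pmf_of_set ?A) (\<lambda>K.
      map_pmf (\<lambda>(ys, zs). ys @ zs)
        (pair_pmf (pmf_of_set (permutations_of_set K)) (pmf_of_set (permutations_of_set (S - K)))))"
  proof (rule bind_pmf_cong[OF refl])
    fix K assume "K \<in> set_pmf (pmf_of_set ?A)"
    hence K: "K \<in> ?A" using obtain_subset_with_card_n[OF assms(2)] assms(1) by (subst (asm) set_pmf_of_set) auto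
    have ne: "permutations_of_set K \<noteq> {}" "permutations_of_set (S - K) \<noteq> {}"
      using finK[OF K] assms(1) by (auto simp: permutations_of_set_empty_iff)
    show "pmf_of_set (f K) = map_pmf (\<lambda>(ys, zs). ys @ zs)
        (pair_pmf (pmf_of_set (permutations_of_set K)) (pmf_of_set (permutations_of_set (S - K))))"
      unfolding f_def using ne by (subst map_pmf_of_set_inj[OF inj, symmetric]) (auto simp: pair_pmf_of_set)
  qed
  finally show ?thesis unfolding UN .
qed

definition gaps :: "nat \<Rightarrow> nat set \<Rightarrow> nat set \<Rightarrow> nat list" where
  "gaps m S K = map (\<lambda>j. card {x \<in> S - K. rank_in K x = j}) [0..<m]"

lemma rank_in_strict: "finite K \<Longrightarrow> x \<in> K \<Longrightarrow> x < y \<Longrightarrow> rank_in K x < rank_in K y"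
  unfolding rank_in_def by (intro psubset_card_mono) auto

text \<open>At the smallest key \<open>x\<close> at which \<open>K\<close> and \<open>K'\<close> differ, \<open>x \<in> K\<close> closes a gap that \<open>K'\<close> leaves open,
  so that this gap is larger for \<open>K'\<close>.\<close>

lemma gaps_first_difference:
  assumes fin: "finite S" and K: "K \<subseteq> S" "card K < m" "K' \<subseteq> S"
    and x: "x \<in> K" "x \<notin> K'" and min: "\<And>y. y < x \<Longrightarrow> y \<in> K \<longleftrightarrow> y \<in> K'"
  shows "gaps m S K \<noteq> gaps m S K'"
proof
  assume eq: "gaps m S K = gaps m S K'"
  have finK: "finite K" "finite K'" using fin K finite_subset by auto
  have rank_eq: "rank_in K y = rank_in K' y" if "y \<le> x" for y
    unfolding rank_in_def by (intro arg_cong[of _ _ card]) (use that min in auto)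
  define r where "r = rank_in K x"
  have "r < m" using rank_in_le[OF finK(1), of x] K(2) by (simp add: r_def)
  hence cards: "card {y \<in> S - K. rank_in K y = r} = card {y \<in> S - K'. rank_in K' y = r}"
    using arg_cong[OF eq, of "\<lambda>l. l ! r"] by (simp add: gaps_def)
  have less: "y < x" if "y \<in> S - K" "rank_in K y = r" for y
    using rank_in_strict[OF finK(1) x(1), of y] that x(1) by (cases y x rule: linorder_cases) (auto simp: r_def)
  have "insert x {y \<in> S - K. rank_in K y = r} \<subseteq> {y \<in> S - K'. rank_in K' y = r}"
  proof
    fix y assume y: "y \<in> insert x {y \<in> S - K. rank_in K y = r}"
    show "y \<in> {y \<in> S - K'. rank_in K' y = r}"
    proof (cases "y = x")
      case True
      thus ?thesis using x K(1) rank_eq[of x] by (auto simp: r_def)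
    next
      case False
      hence "y \<in> S - K" "rank_in K y = r" using y by auto
      thus ?thesis using less[of y] min[of y] rank_eq[of y] by simp
    qed
  qed
  moreover have "finite {y \<in> S - K'. rank_in K' y = r}" using fin by auto
  ultimately have "card (insert x {y \<in> S - K. rank_in K y = r}) \<le> card {y \<in> S - K'. rank_in K' y = r}"
    by (intro card_mono)
  thus False using cards x(1) fin by (simp add: card_insert_if)
qed

text \<open>Injectivity comes from the first difference and surjectivity from counting, both sets
  having \<open>card S choose (m - 1)\<close> elements. A uniform set of root keys thus yields a
  uniform composition as the vector of subtree sizes.\<close>

lemma gaps_bij:
  assumes "m \<ge> 1" "finite S" "m - 1 \<le> card S"
  shows "bij_betw (gaps m S) {K. K \<subseteq> S \<and> card K = m - 1} (comps m (card S - (m - 1)))"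
proof -
  let ?A = "{K. K \<subseteq> S \<and> card K = m - 1}"
  have inj: "inj_on (gaps m S) ?A"
  proof (rule inj_onI, rule ccontr)
    fix K K' assume K: "K \<in> ?A" "K' \<in> ?A" "gaps m S K = gaps m S K'" "K \<noteq> K'"
    define x where "x = (LEAST x. (x \<in> K) \<noteq> (x \<in> K'))"
    have "\<exists>x. (x \<in> K) \<noteq> (x \<in> K')" using K(4) by auto
    hence x: "(x \<in> K) \<noteq> (x \<in> K')" unfolding x_def by (rule LeastI_ex)
    have min: "y \<in> K \<longleftrightarrow> y \<in> K'" if "y < x" for y
      using not_less_Least[of y "\<lambda>x. (x \<in> K) \<noteq> (x \<in> K')"] that by (auto simp: x_def)
    show False
    proof (cases "x \<in> K")
      case True
      thus False using gaps_first_difference[OF assms(2), of K m K' x] x K min assms(1) by auto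
    next
      case False
      thus False using gaps_first_difference[OF assms(2), of K' m K x] x K min assms(1) by auto
    qed
  qed
  have sub: "gaps m S ` ?A \<subseteq> comps m (card S - (m - 1))"
  proof clarify
    fix K assume K: "K \<subseteq> S" "card K = m - 1"
    have finK: "finite K" using K assms(2) finite_subset by auto
    have "sum_list (gaps m S K) = (\<Sum>j<m. card {x \<in> S - K. rank_in K x = j})"
      by (simp add: gaps_def interv_sum_list_conv_sum_set_nat atLeast0LessThan)
    also have "\<dots> = card (\<Union>j<m. {x \<in> S - K. rank_in K x = j})"
      using assms(2) by (subst card_UN_disjoint) auto
    also have "(\<Union>j<m. {x \<in> S - K. rank_in K x = j}) = S - K"
      using rank_in_le[OF finK] K(2) assms(1) by (auto simp: less_eq_Suc_le) (metis One_nat_def Suc_pred le_imp_less_Suc less_eq_Suc_le)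
    also have "card (S - K) = card S - (m - 1)" using K finK by (simp add: card_Diff_subset)
    finally show "gaps m S K \<in> comps m (card S - (m - 1))"
      by (simp add: comps_def) (simp add: gaps_def)
  qed
  have "card (comps m (card S - (m - 1))) = card S choose (card S - (m - 1))"
    unfolding card_comps using assms by simp
  also have "\<dots> = card S choose (m - 1)" using assms(3) by (rule binomial_symmetric[symmetric])
  also have "\<dots> = card ?A" using n_subsets[OF assms(2), of "m - 1"] by simp
  finally have "card (gaps m S ` ?A) = card (comps m (card S - (m - 1)))"
    by (simp only: card_image[OF inj])
  hence "gaps m S ` ?A = comps m (card S - (m - 1))"
    by (intro card_subset_eq sub) auto
  thus ?thesis using inj by (simp add: bij_betw_def)
qed

theorem X_dist_recursion:
  assumes "m \<ge> 2" "m - 1 \<le> n"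
  shows "X_dist m t n = bind_pmf (pmf_of_set (comps m (n - (m - 1))))
    (\<lambda>js. map_pmf (\<lambda>x. x + t n) (sum_dist (X_dist m t) js))"
proof -
  let ?S = "{1..n}" and ?A = "{K. K \<subseteq> {1..n} \<and> card K = m - 1}"
  have neA: "?A \<noteq> {}" using obtain_subset_with_card_n[of "m - 1" ?S] assms by auto
  have finA: "finite ?A" by auto
  have perm: "pmf_of_set (permutations_of_set ?S) = bind_pmf (pmf_of_set ?A) (\<lambda>K.
      map_pmf (\<lambda>(ys, zs). ys @ zs)
        (pair_pmf (pmf_of_set (permutations_of_set K)) (pmf_of_set (permutations_of_set (?S - K)))))"
    using assms(2) by (intro random_permutation_split) auto
  have "X_dist m t n = bind_pmf (pmf_of_set ?A) (\<lambda>K.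
      map_pmf (tree_value m t) (map_pmf (\<lambda>(ys, zs). ys @ zs)
        (pair_pmf (pmf_of_set (permutations_of_set K)) (pmf_of_set (permutations_of_set (?S - K))))))"
    unfolding X_dist_eq perm by (rule map_bind_pmf)
  also have "\<dots> = bind_pmf (pmf_of_set ?A) (\<lambda>K.
      map_pmf (\<lambda>x. x + t n) (sum_dist (X_dist m t) (gaps m ?S K)))"
  proof (rule bind_pmf_cong[OF refl])
    fix K assume "K \<in> set_pmf (pmf_of_set ?A)"
    hence K: "K \<subseteq> ?S" "card K = m - 1" using set_pmf_of_set[OF neA finA] by auto
    have finK: "finite K" using K(1) finite_subset by auto
    let ?Y = "pmf_of_set (permutations_of_set K)" and ?Z = "pmf_of_set (permutations_of_set (?S - K))"
    have "map_pmf (tree_value m t) (map_pmf (\<lambda>(ys, zs). ys @ zs) (pair_pmf ?Y ?Z)) =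
      map_pmf (\<lambda>(ys, zs). (\<Sum>j\<leftarrow>[0..<m]. tree_value m t (filter (\<lambda>x. rank_in K x = j) zs)) + t n) (pair_pmf ?Y ?Z)"
      unfolding pmf.map_comp o_def
    proof (rule map_pmf_cong[OF refl], clarify)
      fix ys zs assume "(ys, zs) \<in> set_pmf (pair_pmf ?Y ?Z)"
      hence "ys \<in> set_pmf ?Y" "zs \<in> set_pmf ?Z" by auto
      hence *: "ys \<in> permutations_of_set K" "zs \<in> permutations_of_set (?S - K)"
        using finK by (subst (asm) (1 2) set_pmf_of_set; auto simp: permutations_of_set_empty_iff)+
      hence len: "length ys = m - 1" "length zs = n - (m - 1)"
        using K finK by (auto simp: length_finite_permutations_of_set card_Diff_subset)
      have "tree_value m t (ys @ zs) = (\<Sum>j\<leftarrow>[0..<m]. tree_value m t (filter (\<lambda>x. rank_in (set ys) x = j) zs)) + t (length (ys @ zs))"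
        using * by (intro tree_value_split assms len) (auto simp: permutations_of_set_def)
      thus "tree_value m t (ys @ zs) = (\<Sum>j\<leftarrow>[0..<m]. tree_value m t (filter (\<lambda>x. rank_in K x = j) zs)) + t n"
        using * len assms(2) by (simp add: permutations_of_set_def)
    qed
    \<comment> \<open>Given K, the value depends on \<open>zs\<close> alone, so \<open>ys\<close> is
      projected out.\<close>
    also have "\<dots> = map_pmf (\<lambda>zs. (\<Sum>j\<leftarrow>[0..<m]. tree_value m t (filter (\<lambda>x. rank_in K x = j) zs)) + t n)
        (map_pmf snd (pair_pmf ?Y ?Z))"
      by (simp add: pmf.map_comp o_def split_def)
    also have "\<dots> = map_pmf (\<lambda>x. x + t n) (map_pmf (\<lambda>zs. \<Sum>j\<leftarrow>[0..<m]. tree_value m t (filter (\<lambda>x. rank_in K x = j) zs)) ?Z)"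
      by (simp add: map_snd_pair_pmf pmf.map_comp o_def)
    also have "\<dots> = map_pmf (\<lambda>x. x + t n) (sum_dist (X_dist m t) (gaps m ?S K))"
      by (subst random_forest_value[OF assms(1)]) (auto simp: gaps_def)
    finally show "map_pmf (tree_value m t) (map_pmf (\<lambda>(ys, zs). ys @ zs) (pair_pmf ?Y ?Z)) =
      map_pmf (\<lambda>x. x + t n) (sum_dist (X_dist m t) (gaps m ?S K))" .
  qed
  also have "\<dots> = bind_pmf (map_pmf (gaps m ?S) (pmf_of_set ?A)) (\<lambda>js.
      map_pmf (\<lambda>x. x + t n) (sum_dist (X_dist m t) js))"
    by (simp add: bind_map_pmf)
  also have "map_pmf (gaps m ?S) (pmf_of_set ?A) = pmf_of_set (comps m (n - (m - 1)))"
    using gaps_bij[of m ?S] assms neA finA by (intro map_pmf_of_set_bij_betw) auto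
  finally show ?thesis .
qed

lemma X_dist_small:
  assumes "m \<ge> 2" "n \<le> m - 2"
  shows "X_dist m t n = return_pmf (t n)"
proof -
  have "X_dist m t n = map_pmf (\<lambda>_. t n) (pmf_of_set (permutations_of_set {1..n}))"
    unfolding X_dist_eq
  proof (rule map_pmf_cong[OF refl])
    fix xs assume "xs \<in> set_pmf (pmf_of_set (permutations_of_set {1..n}))"
    hence "xs \<in> permutations_of_set {1..n}" by (subst (asm) set_pmf_of_set) (auto simp: permutations_of_set_empty_iff)
    hence "distinct xs" "length xs = n" by (auto simp: permutations_of_set_def dest: distinct_card)
    thus "tree_value m t xs = t n" using tree_value_small[of m xs t] assms by simp
  qed
  thus ?thesis by simp
qed

section \<open>Recursions for the central moments\<close>

abbreviation expect :: "'a pmf \<Rightarrow> ('a \<Rightarrow> real) \<Rightarrow> real" where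
  "expect p f \<equiv> measure_pmf.expectation p f"

lemma expect_add: "finite (set_pmf p) \<Longrightarrow> expect p (\<lambda>x. f x + g x) = expect p f + expect p g"
  by (intro Bochner_Integration.integral_add integrable_measure_pmf_finite)

lemma expect_sum: "finite (set_pmf p) \<Longrightarrow> expect p (\<lambda>x. \<Sum>i\<in>I. f i x) = (\<Sum>i\<in>I. expect p (f i))"
  by (intro Bochner_Integration.integral_sum integrable_measure_pmf_finite)

lemma expect_pair_prod:
  assumes "finite (set_pmf p)" "finite (set_pmf q)"
  shows "expect (pair_pmf p q) (\<lambda>(x, y). f x * g y) = expect p f * expect q g"
proof -
  have "expect (pair_pmf p q) (\<lambda>(x, y). f x * g y) =
     (\<Sum>z\<in>set_pmf p \<times> set_pmf q. (case z of (x, y) \<Rightarrow> f x * g y) * pmf (pair_pmf p q) z)"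
    using assms by (subst integral_measure_pmf_real) auto
  also have "\<dots> = (\<Sum>x\<in>set_pmf p. \<Sum>y\<in>set_pmf q. (f x * pmf p x) * (g y * pmf q y))"
    unfolding sum.cartesian_product by (intro sum.cong) (auto simp: pmf_pair)
  also have "\<dots> = (\<Sum>x\<in>set_pmf p. f x * pmf p x) * (\<Sum>y\<in>set_pmf q. g y * pmf q y)"
    by (simp add: sum_product)
  also have "(\<Sum>x\<in>set_pmf p. f x * pmf p x) = expect p f"
    using assms by (subst integral_measure_pmf_real[of "set_pmf p"]) auto
  also have "(\<Sum>y\<in>set_pmf q. g y * pmf q y) = expect q g"
    using assms by (subst integral_measure_pmf_real[of "set_pmf q"]) auto
  finally show ?thesis .
qed

lemma finite_set_X_dist [simp]: "finite (set_pmf (X_dist m t n))"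
  unfolding X_dist_eq set_map_pmf
  by (intro finite_imageI, subst set_pmf_of_set) (auto simp: permutations_of_set_empty_iff)

lemma finite_set_sum_dist: "(\<And>j. finite (set_pmf (X j))) \<Longrightarrow> finite (set_pmf (sum_dist X js))"
  by (induction js) auto

definition central_moment :: "nat \<Rightarrow> (nat \<Rightarrow> real) \<Rightarrow> nat \<Rightarrow> nat \<Rightarrow> real" where
  "central_moment m t k n = expect (X_dist m t n) (\<lambda>x. (x - mean_X m t n) ^ k)"

definition sum_central_moment :: "nat \<Rightarrow> (nat \<Rightarrow> real) \<Rightarrow> nat \<Rightarrow> nat list \<Rightarrow> real" where
  "sum_central_moment m t k js =
     expect (sum_dist (X_dist m t) js) (\<lambda>x. (x - sum_list (map (mean_X m t) js)) ^ k)"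

lemma central_moment_0 [simp]: "central_moment m t 0 n = 1"
  by (simp add: central_moment_def)

lemma central_moment_1: "central_moment m t (Suc 0) n = 0"
proof -
  have "central_moment m t (Suc 0) n = expect (X_dist m t n) (\<lambda>x. x + (- mean_X m t n))"
    by (simp add: central_moment_def)
  also have "\<dots> = 0" by (subst expect_add) (auto simp: mean_X_def)
  finally show ?thesis .
qed

lemma central_moment_2: "central_moment m t 2 n = var_X m t n"
  by (simp add: central_moment_def var_X_def mean_X_def)

lemma sum_central_moment_Nil: "sum_central_moment m t k [] = (if k = 0 then 1 else 0)"
  by (simp add: sum_central_moment_def power_0_left)

lemma sum_central_moment_Cons:
  "sum_central_moment m t k (j # js) =
     (\<Sum>i\<le>k. real (k choose i) * (central_moment m t i j * sum_central_moment m t (k - i) js))"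
proof -
  let ?X = "X_dist m t j" and ?S = "sum_dist (X_dist m t) js"
  let ?a = "mean_X m t j" and ?b = "sum_list (map (mean_X m t) js)"
  have fin: "finite (set_pmf ?X)" "finite (set_pmf ?S)" by (simp_all add: finite_set_sum_dist)
  hence fin2: "finite (set_pmf (pair_pmf ?X ?S))" by simp
  have "sum_central_moment m t k (j # js) =
     expect (pair_pmf ?X ?S) (\<lambda>z. \<Sum>i\<le>k. real (k choose i) * (case z of (x, y) \<Rightarrow> (x - ?a) ^ i * (y - ?b) ^ (k - i)))"
  proof -
    have "(x + y - (?a + ?b)) ^ k = (\<Sum>i\<le>k. real (k choose i) * ((x - ?a) ^ i * (y - ?b) ^ (k - i)))" for x y :: real
      using binomial_ring[of "x - ?a" "y - ?b" k] by (simp add: algebra_simps)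
    thus ?thesis by (simp add: sum_central_moment_def split_def)
  qed
  also have "\<dots> = (\<Sum>i\<le>k. real (k choose i) * expect (pair_pmf ?X ?S) (\<lambda>(x, y). (x - ?a) ^ i * (y - ?b) ^ (k - i)))"
    by (subst expect_sum[OF fin2]) simp
  also have "\<dots> = (\<Sum>i\<le>k. real (k choose i) * (central_moment m t i j * sum_central_moment m t (k - i) js))"
    by (simp add: expect_pair_prod[OF fin] central_moment_def sum_central_moment_def)
  finally show ?thesis .
qed

lemma sum_central_moment_0 [simp]: "sum_central_moment m t 0 js = 1"
  by (simp add: sum_central_moment_def)

lemma sum_central_moment_1: "sum_central_moment m t (Suc 0) js = 0"
  by (induction js) (simp_all add: sum_central_moment_Nil sum_central_moment_Cons central_moment_1)

lemma sum_central_moment_2: "sum_central_moment m t 2 js = sum_list (map (var_X m t) js)"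
proof (induction js)
  case (Cons j js)
  have "{..2::nat} = {0, Suc 0, 2}" by auto
  thus ?case using Cons
    by (simp add: sum_central_moment_Cons central_moment_1 central_moment_2 sum_central_moment_1)
qed (simp add: sum_central_moment_Nil)

text \<open>The conditional mean given the split, minus the mean; its mean square over splits is
  \<open>r_seq\<close>.\<close>

definition split_error :: "nat \<Rightarrow> (nat \<Rightarrow> real) \<Rightarrow> nat \<Rightarrow> nat list \<Rightarrow> real" where
  "split_error m t n js = t n + sum_list (map (mean_X m t) js) - mean_X m t n"

lemma comps_nonempty: "m \<ge> 1 \<Longrightarrow> comps m N \<noteq> {}"
  using card_comps[of m N] by (intro notI) simp

lemma card_comps_choose:
  assumes "m \<ge> 1" "m - 1 \<le> n"
  shows "card (comps m (n - (m - 1))) = n choose (m - 1)"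
proof -
  have "card (comps m (n - (m - 1))) = n choose (n - (m - 1))" unfolding card_comps using assms by simp
  thus ?thesis using assms(2) binomial_symmetric by metis
qed

lemma expect_X_dist:
  assumes "m \<ge> 2" "m - 1 \<le> n"
  shows "expect (X_dist m t n) g = (\<Sum>js\<in>comps m (n - (m - 1)).
     expect (sum_dist (X_dist m t) js) (\<lambda>x. g (x + t n))) / real (n choose (m - 1))"
proof -
  have "expect (X_dist m t n) g = (\<Sum>js\<in>comps m (n - (m - 1)).
      expect (map_pmf (\<lambda>x. x + t n) (sum_dist (X_dist m t) js)) g /\<^sub>R real (card (comps m (n - (m - 1)))))"
    unfolding X_dist_recursion[OF assms, of t]
    by (subst pmf_expectation_bind_pmf_of_set) (use assms in \<open>auto simp: finite_set_sum_dist comps_nonempty\<close>)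
  thus ?thesis using card_comps_choose[of m n] assms
    by (simp add: sum_distrib_left divide_inverse mult.commute)
qed

text \<open>Given the split, the deviation from the mean is the centred sum over the subtrees plus
  the constant \<open>split_error\<close>; expand its power by the binomial theorem.\<close>

lemma central_moment_recursion:
  assumes "m \<ge> 2" "m - 1 \<le> n"
  shows "central_moment m t k n = (\<Sum>js\<in>comps m (n - (m - 1)).
     \<Sum>i\<le>k. real (k choose i) * (sum_central_moment m t i js * split_error m t n js ^ (k - i))) / real (n choose (m - 1))"
proof -
  have "expect (sum_dist (X_dist m t) js) (\<lambda>x. (x + t n - mean_X m t n) ^ k) =
     (\<Sum>i\<le>k. real (k choose i) * (sum_central_moment m t i js * split_error m t n js ^ (k - i)))" for js
  proof -
    let ?S = "sum_dist (X_dist m t) js" and ?b = "sum_list (map (mean_X m t) js)" and ?e = "split_error m t n js"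
    have fin: "finite (set_pmf ?S)" by (simp add: finite_set_sum_dist)
    have "(x + t n - mean_X m t n) ^ k = (\<Sum>i\<le>k. real (k choose i) * ?e ^ (k - i) * (x - ?b) ^ i)" for x
      using binomial_ring[of "x - ?b" ?e k] by (simp add: split_error_def algebra_simps)
    hence "expect ?S (\<lambda>x. (x + t n - mean_X m t n) ^ k) =
       expect ?S (\<lambda>x. \<Sum>i\<le>k. real (k choose i) * ?e ^ (k - i) * (x - ?b) ^ i)" by simp
    also have "\<dots> = (\<Sum>i\<le>k. real (k choose i) * ?e ^ (k - i) * sum_central_moment m t i js)"
      unfolding expect_sum[OF fin] sum_central_moment_def by simp
    finally show ?thesis by (simp add: mult_ac)
  qed
  thus ?thesis unfolding central_moment_def[of m t k n] by (subst expect_X_dist[OF assms]) simp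
qed

lemma mean_X_small: "m \<ge> 2 \<Longrightarrow> n < m - 1 \<Longrightarrow> mean_X m t n = t n"
  by (simp add: mean_X_def X_dist_small)

lemma central_moment_small: "m \<ge> 2 \<Longrightarrow> n < m - 1 \<Longrightarrow> central_moment m t k n = (if k = 0 then 1 else 0)"
  by (simp add: central_moment_def mean_X_small X_dist_small power_0_left)

lemma mean_X_recursion:
  assumes "m \<ge> 2"
  shows "mean_X m t n = t n + split_avg m (mean_X m t) n"
proof (cases "n < m - 1")
  case False
  \<comment> \<open>The first central moment vanishes, so its recursion says that
    \<open>split_error\<close> has average 0; this is the recursion for the means.\<close>
  have "0 = central_moment m t (Suc 0) n" by (simp add: central_moment_1)
  also have "\<dots> = (\<Sum>js\<in>comps m (n - (m - 1)). split_error m t n js) / real (n choose (m - 1))"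
    using False assms by (subst central_moment_recursion) (simp_all add: sum_central_moment_1)
  finally have "(\<Sum>js\<in>comps m (n - (m - 1)). split_error m t n js) = 0"
    using False by simp
  moreover have "(\<Sum>js\<in>comps m (n - (m - 1)). split_error m t n js) =
      real (n choose (m - 1)) * (t n - mean_X m t n) + (\<Sum>js\<in>comps m (n - (m - 1)). sum_list (map (mean_X m t) js))"
    using card_comps_choose[of m n] assms False
    by (simp add: split_error_def sum.distrib sum_subtractf algebra_simps)
  ultimately show ?thesis using False by (simp add: split_avg_def field_simps)
qed (use assms in \<open>simp add: mean_X_small split_avg_def\<close>)

lemma r_seq_eq:
  assumes "m \<ge> 2" "m - 1 \<le> n"
  shows "r_seq m t n = (\<Sum>js\<in>comps m (n - (m - 1)). (split_error m t n js)\<^sup>2) / real (n choose (m - 1))"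
proof -
  have "\<not> n \<le> m - 2" using assms by simp
  thus ?thesis by (simp add: r_seq_def split_error_def comps_def)
qed

lemma var_X_recursion:
  assumes "m \<ge> 2"
  shows "var_X m t n = r_seq m t n + split_avg m (var_X m t) n"
proof (cases "n < m - 1")
  case True
  thus ?thesis using assms central_moment_small[of m n t 2]
    by (simp add: central_moment_2 split_avg_def r_seq_def)
next
  case False
  have "{..2::nat} = {0, Suc 0, 2}" by auto
  hence "var_X m t n = (\<Sum>js\<in>comps m (n - (m - 1)). sum_list (map (var_X m t) js) + (split_error m t n js)\<^sup>2)
     / real (n choose (m - 1))"
    unfolding central_moment_2[symmetric, of m t n] using False assms
    by (subst central_moment_recursion) (simp_all add: sum_central_moment_1 sum_central_moment_2 add.commute)
  thus ?thesis using False assms by (simp add: r_seq_eq split_avg_def sum.distrib add_divide_distrib)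
qed

section \<open>Worst-case splits\<close>

abbreviation scale :: "nat \<Rightarrow> real" where "scale n \<equiv> sqrt (real (Suc n))"

text \<open>Uniformity over all splits of \<open>n\<close> is expressed by quantifying over sequences of splits; the
  shift \<open>Suc\<close> makes the sizes of a split of \<open>n\<close> add up to \<open>n + 1\<close> exactly.\<close>

definition forest_seq :: "nat \<Rightarrow> (nat \<Rightarrow> nat list) \<Rightarrow> bool" where
  "forest_seq L J \<longleftrightarrow> eventually (\<lambda>n. length (J n) = L \<and> sum_list (map Suc (J n)) \<le> Suc n) sequentially"

text \<open>Removing a tree leaves only an upper bound on the total size, which is why
  \<open>forest_seq\<close> demands an inequality.\<close>

lemma forest_seq_Suc:
  assumes "forest_seq (Suc L) J"
  shows "forest_seq L (\<lambda>n. tl (J n))" "eventually (\<lambda>n. J n = hd (J n) # tl (J n)) sequentially"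
    "eventually (\<lambda>n. hd (J n) \<le> n) sequentially"
proof -
  have ev: "eventually (\<lambda>n. length (J n) = Suc L \<and> sum_list (map Suc (J n)) \<le> Suc n) sequentially"
    using assms by (simp add: forest_seq_def)
  show "forest_seq L (\<lambda>n. tl (J n))" unfolding forest_seq_def using ev
    by eventually_elim (auto simp: length_Suc_conv)
  show "eventually (\<lambda>n. J n = hd (J n) # tl (J n)) sequentially" using ev
    by eventually_elim (auto simp: length_Suc_conv)
  show "eventually (\<lambda>n. hd (J n) \<le> n) sequentially" using ev
    by eventually_elim (auto simp: length_Suc_conv)
qed

text \<open>The subtree sizes may stay bounded. Small subtrees contribute a bounded amount over a
  growing scale; for large ones the scale of the whole tree exceeds their own.\<close>

lemma tendsto_0_subtree:
  fixes e :: "nat \<Rightarrow> real"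
  assumes i: "i \<ge> 1" and e: "(\<lambda>n. e n / scale n ^ i) \<longlonglongrightarrow> 0"
    and j: "eventually (\<lambda>n. j n \<le> n) sequentially"
  shows "(\<lambda>n. e (j n) / scale n ^ i) \<longlonglongrightarrow> 0"
proof (rule tendstoI)
  fix \<epsilon> :: real assume "\<epsilon> > 0"
  obtain N where N: "\<And>n. n \<ge> N \<Longrightarrow> \<bar>e n / scale n ^ i\<bar> < \<epsilon>"
    using tendstoD[OF e \<open>\<epsilon> > 0\<close>] by (auto simp: eventually_sequentially dist_real_def)
  define C where "C = (\<Sum>l<N. \<bar>e l\<bar>)"
  have C: "\<bar>e l\<bar> \<le> C" if "l < N" for l
    unfolding C_def using that by (intro member_le_sum) auto
  have C0: "C \<ge> 0" unfolding C_def by (intro sum_nonneg) auto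
  have "(\<lambda>n. C / scale n) \<longlonglongrightarrow> 0" by real_asymp
  hence "eventually (\<lambda>n. C / scale n < \<epsilon>) sequentially" using \<open>\<epsilon> > 0\<close> by (intro order_tendstoD) auto
  with j show "eventually (\<lambda>n. dist (e (j n) / scale n ^ i) 0 < \<epsilon>) sequentially"
  proof eventually_elim
    case (elim n)
    have pos: "scale l ^ i > 0" for l by simp
    show ?case
    proof (cases "j n < N")
      case True
      have "\<bar>e (j n)\<bar> / scale n ^ i \<le> C / scale n"
        using C[OF True] C0 i self_le_power[of "scale n" i] by (intro frac_le) auto
      thus ?thesis using elim(2) by (simp add: dist_real_def del: of_nat_Suc)
    next
      case False
      have "\<bar>e (j n)\<bar> / scale n ^ i \<le> \<bar>e (j n)\<bar> / scale (j n) ^ i"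
        using elim(1) pos by (intro divide_left_mono power_mono mult_pos_pos) auto
      also have "\<dots> < \<epsilon>" using N[of "j n"] False by (simp del: of_nat_Suc)
      finally show ?thesis by (simp add: dist_real_def del: of_nat_Suc)
    qed
  qed
qed

lemma tendsto_0_forest:
  fixes e :: "nat \<Rightarrow> real"
  assumes i: "i \<ge> 1" and e: "(\<lambda>n. e n / scale n ^ i) \<longlonglongrightarrow> 0" and J: "forest_seq L J"
  shows "(\<lambda>n. sum_list (map e (J n)) / scale n ^ i) \<longlonglongrightarrow> 0"
  using J
proof (induction L arbitrary: J)
  case 0
  hence "eventually (\<lambda>n. J n = []) sequentially" by (auto simp: forest_seq_def elim: eventually_mono)
  hence "eventually (\<lambda>n. sum_list (map e (J n)) / scale n ^ i = 0) sequentially"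
    by eventually_elim simp
  thus ?case by (rule tendsto_eventually)
next
  case (Suc L)
  note J = forest_seq_Suc[OF Suc.prems]
  have "(\<lambda>n. e (hd (J n)) / scale n ^ i + sum_list (map e (tl (J n))) / scale n ^ i) \<longlonglongrightarrow> 0 + 0"
    by (intro tendsto_add tendsto_0_subtree[OF i e J(3)] Suc.IH[OF J(1)])
  moreover have "eventually (\<lambda>n. e (hd (J n)) / scale n ^ i + sum_list (map e (tl (J n))) / scale n ^ i
      = sum_list (map e (J n)) / scale n ^ i) sequentially"
    using J(2) by eventually_elim (metis add_divide_distrib list.simps(9) sum_list.Cons)
  ultimately show ?case by (auto elim: Lim_transform_eventually)
qed

lemma sum_list_Suc_comps: "js \<in> comps m N \<Longrightarrow> sum_list (map Suc js) = N + m"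
  by (induction js arbitrary: m N) (auto simp: comps_def)

lemma forest_seq_comps:
  assumes "m \<ge> 1" "\<And>n. m - 1 \<le> n \<Longrightarrow> J n \<in> comps m (n - (m - 1))"
  shows "forest_seq m J"
  unfolding forest_seq_def eventually_sequentially
proof (intro exI allI impI)
  fix n assume "m - 1 \<le> n"
  with assms(2)[OF this] sum_list_Suc_comps[OF assms(2)[OF this]] assms(1)
  show "length (J n) = m \<and> sum_list (map Suc (J n)) \<le> Suc n" by (auto simp: comps_def)
qed

text \<open>There are finitely many splits of each n, so a maximizing one exists. A limit along the
  sequence of maximizers is then a uniform bound over all splits.\<close>

lemma worst_split:
  fixes G :: "nat \<Rightarrow> nat list \<Rightarrow> real"
  assumes "m \<ge> 1"
  obtains J where "\<And>n. J n \<in> comps m (n - (m - 1))"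
    "\<And>n js. js \<in> comps m (n - (m - 1)) \<Longrightarrow> \<bar>G n js\<bar> \<le> \<bar>G n (J n)\<bar>"
proof -
  have "\<exists>js\<in>comps m (n - (m - 1)). \<forall>js'\<in>comps m (n - (m - 1)). \<bar>G n js'\<bar> \<le> \<bar>G n js\<bar>" for n
  proof -
    let ?A = "(\<lambda>js. \<bar>G n js\<bar>) ` comps m (n - (m - 1))"
    have "finite ?A" "?A \<noteq> {}" using comps_nonempty[OF assms] by auto
    from Max_in[OF this] Max_ge[OF this(1)] show ?thesis by fastforce
  qed
  thus ?thesis using that by metis
qed

lemma split_avg_const_bound:
  fixes G :: "nat list \<Rightarrow> real"
  assumes "m \<ge> 1" "m - 1 \<le> n" "\<And>js. js \<in> comps m (n - (m - 1)) \<Longrightarrow> \<bar>G js\<bar> \<le> c"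
  shows "\<bar>(\<Sum>js\<in>comps m (n - (m - 1)). G js) / real (n choose (m - 1))\<bar> \<le> c"
proof -
  have pos: "real (n choose (m - 1)) > 0" using assms(2) by simp
  have "\<bar>\<Sum>js\<in>comps m (n - (m - 1)). G js\<bar> \<le> (\<Sum>js\<in>comps m (n - (m - 1)). \<bar>G js\<bar>)" by (rule sum_abs)
  also have "\<dots> \<le> real (card (comps m (n - (m - 1)))) * c"
    using assms(3) by (intro sum_bounded_above)
  also have "\<dots> = c * real (n choose (m - 1))" using card_comps_choose[OF assms(1,2)] by simp
  finally show ?thesis using pos by (simp add: abs_divide pos_divide_le_eq)
qed

lemma split_avg_Suc:
  assumes "m \<ge> 1" "m - 1 \<le> n"
  shows "split_avg m (\<lambda>j. real (Suc j)) n = real (Suc n)"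
proof -
  have "sum_list (map (\<lambda>j. real (Suc j)) js) = real (Suc n)" if "js \<in> comps m (n - (m - 1))" for js
  proof -
    have "sum_list (map (\<lambda>j. real (Suc j)) js) = real (sum_list (map Suc js))" by (induction js) auto
    thus ?thesis using sum_list_Suc_comps[OF that] assms by simp
  qed
  hence "(\<Sum>js\<in>comps m (n - (m - 1)). sum_list (map (\<lambda>j. real (Suc j)) js)) =
      real (n choose (m - 1)) * real (Suc n)"
    using card_comps_choose[OF assms] by simp
  thus ?thesis using assms(2) by (simp add: split_avg_def)
qed

text \<open>Twice a binomial coefficient, (j + 1) (j + 2) has generating function 2 / (1 - z)^3, so
  its average is an exact quotient of binomial coefficients. It replaces (j + 1)^2 for this
  reason.\<close>

lemma split_avg_pochhammer:
  assumes "m \<ge> 1" "m - 1 \<le> n"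
  shows "split_avg m (\<lambda>j. real (Suc j) * real (j + 2)) n = 2 / real (m + 1) * (real (Suc n) * real (n + 2))"
proof -
  let ?U = "Abs_fps (\<lambda>_. 1) :: real fps"
  have c3: "real (Suc j) * real (j + 2) = 2 * real (card (comps 3 j))" for j
  proof -
    have "2 * ((j + 2) choose 2) = (j + 2) * (j + 1)" by (simp add: choose_two)
    moreover have "card (comps 3 j) = (j + 2) choose 2"
      unfolding card_comps using binomial_symmetric[of 2 "j + 2"] by simp
    ultimately have "Suc j * (j + 2) = 2 * card (comps 3 j)" by simp
    thus ?thesis by (metis of_nat_mult of_nat_numeral)
  qed
  have A: "Abs_fps (\<lambda>j. real (Suc j) * real (j + 2)) = 2 * ?U ^ 3"
  proof -
    have "Abs_fps (\<lambda>j. real (Suc j) * real (j + 2)) = fps_const 2 * Abs_fps (\<lambda>j. real (card (comps 3 j)))"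
      unfolding c3 by (rule fps_ext) simp
    thus ?thesis by (simp only: fps_card_comps numeral_fps_const)
  qed
  have "Abs_fps (\<lambda>N. \<Sum>js\<in>comps m N. sum_list (map (\<lambda>j. real (Suc j) * real (j + 2)) js)) =
     of_nat m * (2 * ?U ^ 3) * ?U ^ (m - 1)"
    unfolding fps_sum_comps A ..
  also have "\<dots> = fps_const (2 * real m) * (?U ^ (m + 2))"
  proof -
    have "?U ^ (m + 2) = ?U ^ 3 * ?U ^ (m - 1)" using assms(1) by (simp flip: power_add)
    thus ?thesis by (simp add: fps_of_nat[symmetric] numeral_fps_const mult_ac)
  qed
  also have "\<dots> = fps_const (2 * real m) * Abs_fps (\<lambda>N. real (card (comps (m + 2) N)))"
    by (simp only: fps_card_comps)
  finally have *: "(\<Sum>js\<in>comps m N. sum_list (map (\<lambda>j. real (Suc j) * real (j + 2)) js)) =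
     2 * real m * real (card (comps (m + 2) N))" for N
    by (simp add: fps_eq_iff)
  define N where "N = n - (m - 1)"
  have n: "n = N + (m - 1)" using assms(2) by (simp add: N_def)
  have "card (comps (m + 2) N) = (n + 2) choose (m + 1)"
  proof -
    have "card (comps (m + 2) N) = (n + 2) choose N" unfolding card_comps using n assms(1) by simp
    also have "\<dots> = (n + 2) choose (m + 1)" using binomial_symmetric[of N "n + 2"] n assms(1) by simp
    finally show ?thesis .
  qed
  moreover have "(m + 1) * (m * ((n + 2) choose (m + 1))) = (n + 2) * ((n + 1) * (n choose (m - 1)))"
  proof -
    obtain l where l: "m = Suc l" using assms(1) by (cases m) auto
    have b1: "(m + 1) * ((n + 2) choose (m + 1)) = (n + 2) * (Suc n choose m)"
      using Suc_times_binomial[of m "n + 1"] by (simp del: binomial_Suc_Suc)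
    have b2: "m * (Suc n choose m) = Suc n * (n choose (m - 1))"
      unfolding l using Suc_times_binomial[of l n] by (simp del: binomial_Suc_Suc)
    have "(m + 1) * (m * ((n + 2) choose (m + 1))) = m * ((m + 1) * ((n + 2) choose (m + 1)))"
      by (rule mult.left_commute)
    also have "\<dots> = (n + 2) * (m * (Suc n choose m))" unfolding b1 by (rule mult.left_commute)
    finally show ?thesis unfolding b2 by simp
  qed
  hence "real (m + 1) * (real m * real ((n + 2) choose (m + 1))) = real (n + 2) * (real (n + 1) * real (n choose (m - 1)))"
    by (metis of_nat_mult)
  moreover define X Y where "X = real ((n + 2) choose (m + 1))" and "Y = real (n choose (m - 1))"
  ultimately have X: "real (card (comps (m + 2) N)) = X" "real (m + 1) * (real m * X) = real (n + 2) * (real (n + 1) * Y)"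
    by (simp_all only: X_def Y_def)
  have "Y > 0" using assms(2) by (simp add: Y_def)
  have "split_avg m (\<lambda>j. real (Suc j) * real (j + 2)) n = 2 * real m * X / Y"
    using assms(2) unfolding split_avg_def * N_def[symmetric] X(1) Y_def by simp
  also have "\<dots> = (real (m + 1) * (2 * real m * X)) / (real (m + 1) * Y)"
    by (subst mult_divide_mult_cancel_left) auto
  also have "\<dots> = 2 * (real (m + 1) * (real m * X)) / (real (m + 1) * Y)"
    by (simp only: mult_ac)
  also have "\<dots> = 2 / real (m + 1) * (real (Suc n) * real (n + 2))"
    unfolding X(2) using \<open>Y > 0\<close> by simp
  finally show ?thesis .
qed

section \<open>Mean and variance\<close>

lemma split_avg_nonneg:
  fixes a :: "nat \<Rightarrow> real"
  shows "(\<And>j. a j \<ge> 0) \<Longrightarrow> split_avg m a n \<ge> 0"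
  by (auto simp: split_avg_def intro!: divide_nonneg_nonneg sum_nonneg sum_list_nonneg)

text \<open>Averaging inverts \<open>rising_poly (m - 1)\<close> at \<theta> up to m!. Its roots 0,
  -1, -2, ... lie to the left of 3/2, so the recurrence machinery applies.\<close>

lemma split_avg_summable:
  fixes q :: "nat \<Rightarrow> real"
  assumes "m \<ge> 2" "summable (\<lambda>n. \<bar>q n\<bar> * weight n)"
  shows "summable (\<lambda>n. \<bar>split_avg m q n\<bar> * weight n)"
proof -
  define F where "F = Abs_fps (split_avg m (\<lambda>n. complex_of_real (q n)))"
  define ls where "ls = map (\<lambda>i. - of_nat i :: complex) [0..<m - 1]"
  have "theta_poly (\<Prod>l\<leftarrow>ls. [:- l, 1:]) F = fps_const (fact m) * Abs_fps (\<lambda>n. complex_of_real (q n))"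
  proof -
    have "(\<Prod>l\<leftarrow>ls. [:- l, 1:]) = (rising_poly (m - 1) :: complex poly)"
      by (simp add: ls_def rising_poly_def o_def atLeast0LessThan flip: prod.distinct_set_conv_list)
    thus ?thesis using theta_poly_split_avg[of m "\<lambda>n. complex_of_real (q n)"] assms(1) by (simp add: F_def)
  qed
  moreover have "small1 (fps_const (fact m) * Abs_fps (\<lambda>n. complex_of_real (q n)))"
    using assms(2) by (intro small1_const_mult) (simp add: small1_def)
  moreover have "- real i < 3/2" for i using of_nat_0_le_iff[of i, where 'a = real] by linarith
  hence "\<forall>l\<in>set ls. Re l < 3/2" by (auto simp: ls_def)
  moreover have "F $ i = 0" if "i < length ls" for i using that by (simp add: F_def ls_def split_avg_def)
  ultimately have "small1 F" by (rule theta_prod_small(1))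
  thus ?thesis by (simp add: small1_def F_def split_avg_of_real)
qed

lemma toll_conditions:
  fixes t :: "nat \<Rightarrow> real"
  assumes t: "t \<in> o(\<lambda>n. sqrt (real n))"
    and window: "summable (\<lambda>n. window_max t \<delta> (Suc n) / real (Suc n))" and \<delta>: "0 < \<delta>" "\<delta> < 1"
  shows "(\<lambda>n. t n / scale n) \<longlonglongrightarrow> 0" "(\<lambda>n. (t n)\<^sup>2 / real (n + 1)) \<longlonglongrightarrow> 0"
    "summable (\<lambda>n. (t n)\<^sup>2 * weight n)" "summable (\<lambda>n. \<bar>t n\<bar> * weight n)"
proof -
  have "(\<lambda>n. sqrt (real n)) \<in> O(scale)" by real_asymp
  hence "t \<in> o(scale)" using t by (rule landau_o.small_big_trans[rotated])
  thus t0: "(\<lambda>n. t n / scale n) \<longlonglongrightarrow> 0" by (rule smalloD_tendsto)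
  have "(\<lambda>n. (t n / scale n)\<^sup>2) \<longlonglongrightarrow> 0\<^sup>2" by (intro tendsto_power t0)
  thus t2: "(\<lambda>n. (t n)\<^sup>2 / real (n + 1)) \<longlonglongrightarrow> 0" by (simp add: power_divide)
  have "summable (\<lambda>n. (t (Suc n))\<^sup>2 * weight (Suc n))"
  proof (rule summable_comparison_test'[OF window, where N = 0])
    fix n :: nat
    define k where "k = Suc n"
    let ?A = "{l. real k powr \<delta> \<le> real l \<and> l \<le> k}"
    \<comment> \<open>Since \<delta> < 1, the index k lies in its own window, so the window maximum
      dominates its quotient.\<close>
    have "real k powr \<delta> \<le> real k powr 1" using \<delta> by (intro powr_mono) (auto simp: k_def)
    hence "k \<in> ?A" by simp
    moreover have "finite ?A" by (rule finite_subset[of _ "{..k}"]) auto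
    ultimately have "(t k)\<^sup>2 / real k \<le> window_max t \<delta> k"
      unfolding window_max_def by (intro Max_ge) auto
    hence le: "(t k)\<^sup>2 / real k / real k \<le> window_max t \<delta> k / real k" by (intro divide_right_mono) auto
    have "weight k \<le> 1 / (real k * real k)"
      unfolding weight_def by (intro divide_left_mono mult_mono) (auto simp: k_def)
    hence "(t k)\<^sup>2 * weight k \<le> (t k)\<^sup>2 * (1 / (real k * real k))" by (intro mult_left_mono) auto
    also have "\<dots> = (t k)\<^sup>2 / real k / real k" by simp
    finally show "norm ((t (Suc n))\<^sup>2 * weight (Suc n)) \<le> window_max t \<delta> (Suc n) / real (Suc n)"
      using le weight_pos[of k] by (simp add: k_def)
  qed
  thus s2: "summable (\<lambda>n. (t n)\<^sup>2 * weight n)" by (simp only: summable_Suc_iff[of "\<lambda>n. (t n)\<^sup>2 * weight n"])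
  have "small2 (Abs_fps (\<lambda>n. complex_of_real (t n)))" using t2 s2 by (simp add: small2_def)
  from small2_imp_small1[OF this] show "summable (\<lambda>n. \<bar>t n\<bar> * weight n)" by (simp add: small1_def)
qed

lemma weight_times: "x * weight n = x / (real (n + 1) * real (n + 2))"
  by (simp add: weight_def)

lemma mean_X_asymptotics:
  fixes t :: "nat \<Rightarrow> real"
  assumes m: "2 \<le> m" "m \<le> 26"
    and t: "(\<lambda>n. (t n)\<^sup>2 / real (n + 1)) \<longlonglongrightarrow> 0" "summable (\<lambda>n. (t n)\<^sup>2 * weight n)" "summable (\<lambda>n. \<bar>t n\<bar> * weight n)"
  defines "d \<equiv> \<lambda>n. mean_X m t n - mu_const m t * real (n + 1)"
  shows "(\<lambda>n. d n / scale n) \<longlonglongrightarrow> 0" "summable (\<lambda>n. (d n)\<^sup>2 * weight n)"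
proof -
  have K: "(\<Sum>n. t n * weight n) / (harm m - 1) = mu_const m t"
    by (simp add: mu_const_def K1_def weight_def)
  note tr = asymptotic_transfer(2)[OF m mean_X_recursion[OF m(1), of t] t(3) t(1,2), unfolded K]
  show "summable (\<lambda>n. (d n)\<^sup>2 * weight n)" using tr by (simp add: d_def)
  have "(\<lambda>n. sqrt ((d n)\<^sup>2 / real (n + 1))) \<longlonglongrightarrow> sqrt 0" using tr by (intro tendsto_real_sqrt) (simp add: d_def)
  hence "(\<lambda>n. \<bar>d n / scale n\<bar>) \<longlonglongrightarrow> 0" by (simp add: real_sqrt_divide abs_divide)
  thus "(\<lambda>n. d n / scale n) \<longlonglongrightarrow> 0" by (rule tendsto_rabs_zero_cancel)
qed

text \<open>Any multiple of n + 1 cancels, since the subtree sizes, each increased by 1, add up to n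
  + 1. Only deviations of order o(sqrt n) remain.\<close>

lemma split_error_eq:
  fixes t :: "nat \<Rightarrow> real" and c :: real
  assumes "m \<ge> 1" "m - 1 \<le> n" "js \<in> comps m (n - (m - 1))"
  defines "d \<equiv> \<lambda>n. mean_X m t n - c * real (n + 1)"
  shows "split_error m t n js = t n + sum_list (map d js) - d n"
proof -
  have "sum_list (map d js) = sum_list (map (mean_X m t) js) - c * real (sum_list (map Suc js))"
    by (induction js) (auto simp: d_def algebra_simps)
  also have "sum_list (map Suc js) = n + 1" using sum_list_Suc_comps[OF assms(3)] assms(1,2) by simp
  finally show ?thesis by (simp add: split_error_def d_def)
qed

lemma split_error_tendsto_0:
  assumes m: "m \<ge> 1" and t: "(\<lambda>n. t n / scale n) \<longlonglongrightarrow> 0"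
    and d: "(\<lambda>n. (mean_X m t n - c * real (n + 1)) / scale n) \<longlonglongrightarrow> 0"
    and J: "\<And>n. J n \<in> comps m (n - (m - 1))"
  shows "(\<lambda>n. split_error m t n (J n) / scale n) \<longlonglongrightarrow> 0"
proof -
  define d' where "d' = (\<lambda>n. mean_X m t n - c * real (n + 1))"
  have "(\<lambda>n. sum_list (map d' (J n)) / scale n ^ 1) \<longlonglongrightarrow> 0"
    using d by (intro tendsto_0_forest[OF _ _ forest_seq_comps[OF m J]]) (auto simp: d'_def)
  hence "(\<lambda>n. t n / scale n + sum_list (map d' (J n)) / scale n - d' n / scale n) \<longlonglongrightarrow> 0 + 0 - 0"
    using t d by (intro tendsto_intros) (auto simp: d'_def)
  moreover have "eventually (\<lambda>n. t n / scale n + sum_list (map d' (J n)) / scale n - d' n / scale n =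
     split_error m t n (J n) / scale n) sequentially"
    using eventually_ge_at_top[of "m - 1"]
  proof eventually_elim
    case (elim n)
    have "split_error m t n (J n) = t n + sum_list (map d' (J n)) - d' n"
      using split_error_eq[OF m elim J, of t c] by (simp add: d'_def)
    thus ?case by (simp add: add_divide_distrib diff_divide_distrib)
  qed
  ultimately show ?thesis by (auto elim: Lim_transform_eventually)
qed

lemma sum_list_square_le:
  fixes d :: "'a \<Rightarrow> real"
  shows "(sum_list (map d js))\<^sup>2 \<le> real (length js) * sum_list (map (\<lambda>j. (d j)\<^sup>2) js)"
proof -
  have "(\<Sum>i<length js. d (js ! i) * 1)\<^sup>2 \<le> (\<Sum>i<length js. (d (js ! i))\<^sup>2) * (\<Sum>i<length js. 1\<^sup>2)"
    by (rule Cauchy_Schwarz_ineq_sum)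
  thus ?thesis by (simp add: sum_list_sum_nth atLeast0LessThan mult.commute)
qed

text \<open>The square of three terms is at most three times the sum of their squares, and
  Cauchy-Schwarz handles the m subtrees. The averaged squares remain summable by
  \<open>split_avg_summable\<close>.\<close>

lemma r_seq_summable:
  fixes t :: "nat \<Rightarrow> real"
  assumes m: "m \<ge> 2" and t: "summable (\<lambda>n. (t n)\<^sup>2 * weight n)"
    and d: "summable (\<lambda>n. (mean_X m t n - c * real (n + 1))\<^sup>2 * weight n)"
  shows "summable (\<lambda>n. \<bar>r_seq m t n\<bar> * weight n)"
proof -
  define d where "d = (\<lambda>n. mean_X m t n - c * real (n + 1))"
  have sd: "summable (\<lambda>n. (d n)\<^sup>2 * weight n)" using assms(3) by (simp add: d_def)
  have av: "summable (\<lambda>n. \<bar>split_avg m (\<lambda>j. (d j)\<^sup>2) n\<bar> * weight n)"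
    using sd by (intro split_avg_summable m) simp
  show ?thesis
  proof (rule summable_comparison_test'[where N = "m - 1"])
    show "summable (\<lambda>n. 3 * ((t n)\<^sup>2 * weight n) + 3 * real m * (\<bar>split_avg m (\<lambda>j. (d j)\<^sup>2) n\<bar> * weight n)
       + 3 * ((d n)\<^sup>2 * weight n))"
      using t sd av by (intro summable_add summable_mult)
    fix n assume n: "n \<ge> m - 1"
    have pos: "real (n choose (m - 1)) > 0" using n by simp
    have sq: "(a + b - e)\<^sup>2 \<le> 3 * a\<^sup>2 + 3 * b\<^sup>2 + 3 * e\<^sup>2" for a b e :: real
    proof -
      have "0 \<le> (a - b)\<^sup>2 + (a + e)\<^sup>2 + (b + e)\<^sup>2" by simp
      thus ?thesis by (simp add: power2_eq_square algebra_simps)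
    qed
    have "(split_error m t n js)\<^sup>2 \<le> 3 * (t n)\<^sup>2 + 3 * real m * sum_list (map (\<lambda>j. (d j)\<^sup>2) js) + 3 * (d n)\<^sup>2"
      if js: "js \<in> comps m (n - (m - 1))" for js
    proof -
      have "split_error m t n js = t n + sum_list (map d js) - d n"
        using split_error_eq[OF _ n js, of t c] m by (simp add: d_def)
      moreover have "length js = m" using js by (simp add: comps_def)
      ultimately show ?thesis using sq[of "t n" "sum_list (map d js)" "d n"] sum_list_square_le[of d js] by simp
    qed
    hence "(\<Sum>js\<in>comps m (n - (m - 1)). (split_error m t n js)\<^sup>2) \<le>
       (\<Sum>js\<in>comps m (n - (m - 1)). 3 * (t n)\<^sup>2 + 3 * real m * sum_list (map (\<lambda>j. (d j)\<^sup>2) js) + 3 * (d n)\<^sup>2)"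
      by (rule sum_mono)
    also have "\<dots> = real (n choose (m - 1)) * (3 * (t n)\<^sup>2 + 3 * (d n)\<^sup>2)
       + 3 * real m * (\<Sum>js\<in>comps m (n - (m - 1)). sum_list (map (\<lambda>j. (d j)\<^sup>2) js))"
      using card_comps_choose[of m n] m n by (simp add: sum.distrib sum_distrib_left algebra_simps)
    finally have "r_seq m t n \<le> (real (n choose (m - 1)) * (3 * (t n)\<^sup>2 + 3 * (d n)\<^sup>2)
       + 3 * real m * (\<Sum>js\<in>comps m (n - (m - 1)). sum_list (map (\<lambda>j. (d j)\<^sup>2) js))) / real (n choose (m - 1))"
      unfolding r_seq_eq[OF m n] by (intro divide_right_mono) auto
    also have "\<dots> = 3 * (t n)\<^sup>2 + 3 * (d n)\<^sup>2 + 3 * real m * split_avg m (\<lambda>j. (d j)\<^sup>2) n"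
      using pos n by (simp add: split_avg_def add_divide_distrib)
    also have "split_avg m (\<lambda>j. (d j)\<^sup>2) n = \<bar>split_avg m (\<lambda>j. (d j)\<^sup>2) n\<bar>"
      using split_avg_nonneg[of "\<lambda>j. (d j)\<^sup>2" m n] by simp
    finally have "r_seq m t n * weight n \<le> (3 * (t n)\<^sup>2 + 3 * (d n)\<^sup>2 + 3 * real m * \<bar>split_avg m (\<lambda>j. (d j)\<^sup>2) n\<bar>) * weight n"
      using weight_pos[of n] by (intro mult_right_mono) auto
    moreover have "r_seq m t n \<ge> 0" unfolding r_seq_eq[OF m n] by (intro divide_nonneg_nonneg sum_nonneg) auto
    ultimately show "norm (\<bar>r_seq m t n\<bar> * weight n) \<le> 3 * ((t n)\<^sup>2 * weight n) +
        3 * real m * (\<bar>split_avg m (\<lambda>j. (d j)\<^sup>2) n\<bar> * weight n) + 3 * ((d n)\<^sup>2 * weight n)"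
      using weight_pos[of n] by (simp add: abs_mult algebra_simps)
  qed
qed

lemma r_seq_tendsto_0:
  assumes m: "m \<ge> 2" and t: "(\<lambda>n. t n / scale n) \<longlonglongrightarrow> 0"
    and d: "(\<lambda>n. (mean_X m t n - c * real (n + 1)) / scale n) \<longlonglongrightarrow> 0"
  shows "(\<lambda>n. r_seq m t n / real (n + 1)) \<longlonglongrightarrow> 0"
proof -
  obtain J where J: "\<And>n. J n \<in> comps m (n - (m - 1))"
    "\<And>n js. js \<in> comps m (n - (m - 1)) \<Longrightarrow> \<bar>split_error m t n js\<bar> \<le> \<bar>split_error m t n (J n)\<bar>"
    using worst_split[of m "split_error m t"] m by auto
  have "(\<lambda>n. split_error m t n (J n) / scale n) \<longlonglongrightarrow> 0"
    by (rule split_error_tendsto_0[OF _ t d J(1)]) (use m in auto)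
  hence "(\<lambda>n. (split_error m t n (J n) / scale n)\<^sup>2) \<longlonglongrightarrow> 0\<^sup>2" by (rule tendsto_power)
  hence lim: "(\<lambda>n. (split_error m t n (J n))\<^sup>2 / real (n + 1)) \<longlonglongrightarrow> 0" by (simp add: power_divide)
  have ev: "eventually (\<lambda>n. norm (r_seq m t n / real (n + 1)) \<le> (split_error m t n (J n))\<^sup>2 / real (n + 1)) sequentially"
    using eventually_ge_at_top[of "m - 1"]
  proof eventually_elim
    case (elim n)
    have "\<bar>r_seq m t n\<bar> \<le> (split_error m t n (J n))\<^sup>2"
      unfolding r_seq_eq[OF m elim] using m elim J(2)[of _ n] abs_le_square_iff
      by (intro split_avg_const_bound) auto
    thus ?case by (simp add: divide_right_mono)
  qed
  show ?thesis by (rule Lim_null_comparison[OF ev lim])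
qed

text \<open>Only linear order is claimed here, so weighted absolute summability of r gives the
  slope, and r = o(n) removes the difference between the variance and its split average.\<close>

lemma var_X_asymptotics:
  assumes m: "2 \<le> m" "m \<le> 26"
    and r: "summable (\<lambda>n. \<bar>r_seq m t n\<bar> * weight n)" "(\<lambda>n. r_seq m t n / real (n + 1)) \<longlonglongrightarrow> 0"
  shows "(\<lambda>n. var_X m t n / real (n + 1)) \<longlonglongrightarrow> sigma_sq m t"
proof -
  have K: "(\<Sum>n. r_seq m t n * weight n) / (harm m - 1) = sigma_sq m t"
    by (simp add: sigma_sq_def weight_def)
  have "(\<lambda>n. (var_X m t n - r_seq m t n) / real (n + 1) + r_seq m t n / real (n + 1)) \<longlonglongrightarrow> sigma_sq m t + 0"
    by (intro tendsto_add r asymptotic_transfer(1)[OF m var_X_recursion[OF m(1), of t] r(1), unfolded K])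
  thus ?thesis by (simp flip: add_divide_distrib)
qed

section \<open>Normal moments and contraction\<close>

text \<open>The double factorial (k - 1)!! written with factorials. At v = 0 these are the moments
  of the point mass at 0, so the degenerate limit needs no separate argument.\<close>

definition normal_moment :: "real \<Rightarrow> nat \<Rightarrow> real" where
  "normal_moment v k = (if even k then v ^ (k div 2) * (fact k / (2 ^ (k div 2) * fact (k div 2))) else 0)"

lemma normal_moment_simps [simp]:
  "normal_moment v 0 = 1" "normal_moment v (Suc 0) = 0" "normal_moment v 2 = v"
  by (simp_all add: normal_moment_def)

text \<open>The moment form of the stability of the normal law: a N + b N' has the law of sqrt (a^2
  + b^2) N for independent copies. Odd terms vanish, and the even ones reduce to the binomial
  theorem in a^2 and b^2.\<close>

lemma normal_moment_binomial:
  "(\<Sum>l\<le>k. real (k choose l) * ((normal_moment v l * a ^ l) * (normal_moment v (k - l) * b ^ (k - l)))) =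
     normal_moment v k * sqrt (a\<^sup>2 + b\<^sup>2) ^ k"
proof (cases "even k")
  case False
  have "normal_moment v l * normal_moment v (k - l) = 0" if "l \<le> k" for l
    using False that by (auto simp: normal_moment_def)
  hence "(\<Sum>l\<le>k. real (k choose l) * ((normal_moment v l * a ^ l) * (normal_moment v (k - l) * b ^ (k - l)))) = 0"
    by (intro sum.neutral ballI) (auto simp: mult_eq_0_iff)
  thus ?thesis using False by (simp add: normal_moment_def)
next
  case True
  then obtain q where k: "k = 2 * q" by (elim evenE)
  define g where "g l = real (k choose l) * ((normal_moment v l * a ^ l) * (normal_moment v (k - l) * b ^ (k - l)))" for l
  have odd: "g l = 0" if "odd l" for l using that by (simp add: g_def normal_moment_def)
  have even: "g (2 * p) = normal_moment v k * (real (q choose p) * (a\<^sup>2) ^ p * (b\<^sup>2) ^ (q - p))" if "p \<le> q" for p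
  proof -
    have kp: "k - 2 * p = 2 * (q - p)" by (simp add: k)
    have c1: "real (k choose (2 * p)) = fact k / (fact (2 * p) * fact (2 * (q - p)))"
      using that by (subst binomial_fact) (simp_all add: k right_diff_distrib')
    have c2: "real (q choose p) = fact q / (fact p * fact (q - p))" using that by (rule binomial_fact)
    have pw: "x ^ p * x ^ (q - p) = x ^ q" for x :: real using that by (simp flip: power_add)
    have "g (2 * p) = (v ^ p * v ^ (q - p)) * ((a\<^sup>2) ^ p * (b\<^sup>2) ^ (q - p)) *
        (fact k / (2 ^ p * 2 ^ (q - p) * (fact p * fact (q - p))))"
      unfolding g_def normal_moment_def kp c1 power_mult[of a] power_mult[of b] by (simp add: mult_ac)
    also have "\<dots> = normal_moment v k * (real (q choose p) * (a\<^sup>2) ^ p * (b\<^sup>2) ^ (q - p))"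
      unfolding pw c2 by (simp add: normal_moment_def k)
    finally show ?thesis .
  qed
  have "(\<Sum>l\<le>k. g l) = (\<Sum>l\<in>(\<lambda>p. 2 * p) ` {..q}. g l)"
  proof (rule sum.mono_neutral_right)
    show "\<forall>l\<in>{..k} - (\<lambda>p. 2 * p) ` {..q}. g l = 0"
    proof
      fix l assume l: "l \<in> {..k} - (\<lambda>p. 2 * p) ` {..q}"
      have "odd l"
      proof
        assume "even l"
        then obtain p where "l = 2 * p" by (elim evenE)
        thus False using l by (auto simp: k)
      qed
      thus "g l = 0" by (rule odd)
    qed
  qed (auto simp: k)
  also have "\<dots> = (\<Sum>p\<le>q. g (2 * p))" by (subst sum.reindex) (auto simp: inj_on_def)
  also have "\<dots> = (\<Sum>p\<le>q. normal_moment v k * (real (q choose p) * (a\<^sup>2) ^ p * (b\<^sup>2) ^ (q - p)))"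
    by (intro sum.cong even) auto
  also have "\<dots> = normal_moment v k * (a\<^sup>2 + b\<^sup>2) ^ q"
    by (simp add: binomial_ring sum_distrib_left)
  also have "(a\<^sup>2 + b\<^sup>2) ^ q = sqrt (a\<^sup>2 + b\<^sup>2) ^ k" by (simp add: k power_mult)
  finally show ?thesis by (simp add: g_def)
qed

lemma split_avg_mono:
  fixes f g :: "nat \<Rightarrow> real"
  assumes "\<And>j. j \<le> n - (m - 1) \<Longrightarrow> f j \<le> g j"
  shows "split_avg m f n \<le> split_avg m g n"
proof -
  have "sum_list (map f js) \<le> sum_list (map g js)" if js: "js \<in> comps m (n - (m - 1))" for js
  proof (rule sum_list_mono)
    fix j assume "j \<in> set js"
    thus "f j \<le> g j" using js member_le_sum_list[of j js] by (intro assms) (simp add: comps_def)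
  qed
  thus ?thesis unfolding split_avg_def by (auto intro!: divide_right_mono sum_mono)
qed

text \<open>For x = (j + 1) / (n + 1), x^(k/2) is at most x^(3/2), hence at most (x + x^2) / 2 by
  the arithmetic-geometric mean. The averages of both terms are known exactly up to replacing x^2 by
  the bound with (j + 1) (j + 2).\<close>

lemma split_avg_scale_le:
  assumes m: "m \<ge> 2" and n: "m - 1 \<le> n" "n \<ge> 3" and k: "k \<ge> 3"
  shows "split_avg m (\<lambda>j. scale j ^ k) n \<le> 11/12 * scale n ^ k"
proof -
  define S where "S = real (Suc n)"
  have S: "S > 0" "S \<ge> 4" using n by (simp_all add: S_def)
  have le: "scale j ^ k \<le> scale n ^ k * (real (Suc j) / (2 * S) + real (Suc j) * real (j + 2) / (2 * S\<^sup>2))"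
    if "j \<le> n" for j
  proof -
    define x where "x = real (Suc j) / S"
    have x: "0 \<le> x" "x \<le> 1" using that S by (simp_all add: x_def S_def)
    have "scale j ^ k = scale n ^ k * sqrt x ^ k"
      by (simp add: x_def S_def real_sqrt_divide power_divide)
    also have "sqrt x ^ k \<le> sqrt x ^ 3" using x k by (intro power_decreasing) auto
    also have "sqrt x ^ 3 = x * sqrt x" using x by (simp add: power3_eq_cube)
    also have "\<dots> \<le> (x + x\<^sup>2) / 2"
    proof -
      have "sqrt x \<le> (1 + x) / 2" using x arith_geo_mean_sqrt[of 1 x] by simp
      hence "x * sqrt x \<le> x * ((1 + x) / 2)" using x by (intro mult_left_mono) auto
      thus ?thesis by (simp add: power2_eq_square algebra_simps)
    qed
    also have "\<dots> \<le> real (Suc j) / (2 * S) + real (Suc j) * real (j + 2) / (2 * S\<^sup>2)"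
    proof -
      have "x\<^sup>2 \<le> real (Suc j) * real (j + 2) / S\<^sup>2"
        unfolding x_def power_divide using S by (intro divide_right_mono) (simp_all add: power2_eq_square algebra_simps)
      thus ?thesis by (simp add: x_def add_divide_distrib)
    qed
    finally show ?thesis by (simp add: mult_left_mono)
  qed
  have "split_avg m (\<lambda>j. scale j ^ k) n \<le>
     split_avg m (\<lambda>j. scale n ^ k * (real (Suc j) / (2 * S) + real (Suc j) * real (j + 2) / (2 * S\<^sup>2))) n"
    by (intro split_avg_mono le) auto
  also have "\<dots> = scale n ^ k * (split_avg m (\<lambda>j. real (Suc j)) n / (2 * S) +
      split_avg m (\<lambda>j. real (Suc j) * real (j + 2)) n / (2 * S\<^sup>2))"
  proof -
    have lin: "sum_list (map (\<lambda>j. c * (f j / a + g j / b)) js) =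
      c * (sum_list (map f js) / a + sum_list (map g js) / b)" for c a b :: real and f g :: "nat \<Rightarrow> real" and js
      by (induction js) (simp_all add: algebra_simps add_divide_distrib)
    have sums: "(\<Sum>js\<in>I. c * (f js / a + g js / b)) / d = c * ((\<Sum>js\<in>I. f js) / d / a + (\<Sum>js\<in>I. g js) / d / b)"
      for c a b d :: real and f g :: "nat list \<Rightarrow> real" and I
    proof -
      have "(\<Sum>js\<in>I. c * (f js / a + g js / b)) = c * ((\<Sum>js\<in>I. f js) / a + (\<Sum>js\<in>I. g js) / b)"
        by (simp add: sum.distrib flip: sum_distrib_left sum_divide_distrib)
      thus ?thesis by (simp add: add_divide_distrib distrib_left mult.commute)
    qed
    show ?thesis using n(1) unfolding split_avg_def lin sums by simp
  qed
  also have "split_avg m (\<lambda>j. real (Suc j)) n = S"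
    using split_avg_Suc[of m n] m n by (simp add: S_def)
  also have "split_avg m (\<lambda>j. real (Suc j) * real (j + 2)) n = 2 / real (m + 1) * (S * (S + 1))"
    using split_avg_pochhammer[of m n] m n by (simp add: S_def)
  \<comment> \<open>The linear half contributes 1/2; the quadratic one is largest at m = 2 and S =
    4, where it is (5/4) / 3 = 5/12.\<close>
  also have "S / (2 * S) + 2 / real (m + 1) * (S * (S + 1)) / (2 * S\<^sup>2) \<le> 11/12"
  proof -
    have "2 / real (m + 1) * (S * (S + 1)) / (2 * S\<^sup>2) = (1 + 1 / S) / real (m + 1)"
    proof -
      have "(S * (S + 1)) / S\<^sup>2 = 1 + 1 / S" using S by (simp add: power2_eq_square add_divide_distrib)
      moreover have "2 / c * X / (2 * Y) = (X / Y) / c" for c X Y :: real by simp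
      ultimately show ?thesis by (simp only:)
    qed
    also have "\<dots> \<le> (1 + 1 / 4) / 3"
      using S m by (intro frac_le add_left_mono divide_left_mono) auto
    finally show ?thesis using S by simp
  qed
  finally show ?thesis by (simp add: mult_left_mono mult.commute)
qed

text \<open>\<open>12 \<epsilon> (n + 1)\<^sup>k\<^sup>/\<^sup>2 + C (n + 1)\<close> is a supersolution: the linear term is reproduced exactly by the
  average over splits and absorbs the initial values.\<close>

lemma contraction_tendsto_0:
  fixes e R :: "nat \<Rightarrow> real"
  assumes m: "m \<ge> 2" and k: "k \<ge> 3"
    and rec: "\<And>n. m - 1 \<le> n \<Longrightarrow> \<bar>e n\<bar> \<le> split_avg m (\<lambda>j. \<bar>e j\<bar>) n + R n"
    and R: "(\<lambda>n. R n / scale n ^ k) \<longlonglongrightarrow> 0"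
  shows "(\<lambda>n. e n / scale n ^ k) \<longlonglongrightarrow> 0"
proof (rule tendstoI)
  fix \<delta> :: real assume "\<delta> > 0"
  \<comment> \<open>Contraction turns 12 \<epsilon> into 11 \<epsilon>, leaving room for the
    remainder \<epsilon>; then 12 \<epsilon> = \<delta>/2 leaves the other half for the linear
    term.\<close>
  define \<epsilon> where "\<epsilon> = \<delta> / 24"
  have "\<epsilon> > 0" using \<open>\<delta> > 0\<close> by (simp add: \<epsilon>_def)
  have pos: "scale n ^ k > 0" for n by simp
  have "eventually (\<lambda>n. R n / scale n ^ k < \<epsilon>) sequentially"
    using R \<open>\<epsilon> > 0\<close> by (intro order_tendstoD)
  then obtain N0 where N0: "\<And>n. n \<ge> N0 \<Longrightarrow> R n / scale n ^ k < \<epsilon>" by (auto simp: eventually_sequentially)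
  define N where "N = max N0 (max (m - 1) 3)"
  define C where "C = (\<Sum>l<N. \<bar>e l\<bar>)"
  have C0: "C \<ge> 0" unfolding C_def by (intro sum_nonneg) auto
  have bound: "\<bar>e n\<bar> \<le> 12 * \<epsilon> * scale n ^ k + C * real (Suc n)" for n
  proof (induction n rule: less_induct)
    case (less n)
    show ?case
    proof (cases "n < N")
      case True
      have "\<bar>e n\<bar> \<le> C * 1" unfolding C_def using True by (auto intro!: member_le_sum)
      also have "\<dots> \<le> C * real (Suc n)" using C0 by (intro mult_left_mono) auto
      finally have "\<bar>e n\<bar> \<le> C * real (Suc n)" .
      moreover have "12 * \<epsilon> * scale n ^ k \<ge> 0" using \<open>\<epsilon> > 0\<close> pos[of n] by (intro mult_nonneg_nonneg) auto
      ultimately show ?thesis by linarith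
    next
      case False
      hence n: "n \<ge> N0" "m - 1 \<le> n" "n \<ge> 3" by (auto simp: N_def)
      have "split_avg m (\<lambda>j. \<bar>e j\<bar>) n \<le> split_avg m (\<lambda>j. 12 * \<epsilon> * scale j ^ k + C * real (Suc j)) n"
      proof (rule split_avg_mono)
        fix j assume "j \<le> n - (m - 1)"
        hence "j < n" using m n by linarith
        thus "\<bar>e j\<bar> \<le> 12 * \<epsilon> * scale j ^ k + C * real (Suc j)" by (rule less)
      qed
      also have "\<dots> = 12 * \<epsilon> * split_avg m (\<lambda>j. scale j ^ k) n + C * split_avg m (\<lambda>j. real (Suc j)) n"
      proof -
        have lin: "sum_list (map (\<lambda>j. a * f j + b * g j) js) = a * sum_list (map f js) + b * sum_list (map g js)"
          for a b :: real and f g :: "nat \<Rightarrow> real" and js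
          by (induction js) (simp_all add: algebra_simps)
        show ?thesis using n
          by (simp add: split_avg_def lin sum.distrib add_divide_distrib sum_distrib_left del: of_nat_Suc)
      qed
      also have "\<dots> \<le> 12 * \<epsilon> * (11/12 * scale n ^ k) + C * real (Suc n)"
        using split_avg_scale_le[OF m n(2,3) k] split_avg_Suc[of m n] m n \<open>\<epsilon> > 0\<close> C0
        by (intro add_mono mult_left_mono) auto
      finally have "split_avg m (\<lambda>j. \<bar>e j\<bar>) n \<le> 11 * \<epsilon> * scale n ^ k + C * real (Suc n)" by simp
      moreover have "R n \<le> \<epsilon> * scale n ^ k"
        using N0[OF n(1)] pos[of n] by (simp only: pos_divide_less_eq)
      ultimately show ?thesis using rec[OF n(2)] by (simp only: mult.assoc)
    qed
  qed
  have "(\<lambda>n. C / scale n) \<longlonglongrightarrow> 0" by real_asymp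
  hence "eventually (\<lambda>n. C / scale n < \<delta> / 2) sequentially" using \<open>\<delta> > 0\<close> by (intro order_tendstoD) auto
  thus "eventually (\<lambda>n. dist (e n / scale n ^ k) 0 < \<delta>) sequentially"
  proof eventually_elim
    case (elim n)
    have "\<bar>e n\<bar> / scale n ^ k \<le> (12 * \<epsilon> * scale n ^ k + C * real (Suc n)) / scale n ^ k"
      using bound[of n] pos[of n] by (intro divide_right_mono) auto
    also have "\<dots> = \<delta> / 2 + C * real (Suc n) / scale n ^ k"
      using pos[of n] by (simp add: add_divide_distrib \<epsilon>_def del: of_nat_Suc)
    also have "C * real (Suc n) / scale n ^ k \<le> C / scale n"
    proof -
      have "scale n ^ 3 \<le> scale n ^ k" using k by (intro power_increasing) auto
      hence "C * real (Suc n) / scale n ^ k \<le> C * real (Suc n) / scale n ^ 3"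
        using C0 by (intro divide_left_mono mult_nonneg_nonneg mult_pos_pos) auto
      also have "scale n ^ 3 = real (Suc n) * scale n"
        by (simp add: power3_eq_cube del: of_nat_Suc)
      also have "C * real (Suc n) / (real (Suc n) * scale n) = C / scale n" by (simp del: of_nat_Suc)
      finally show ?thesis .
    qed
    finally have "\<bar>e n\<bar> / scale n ^ k \<le> \<delta> / 2 + C / scale n" by simp
    hence "\<bar>e n\<bar> / scale n ^ k < \<delta>" using elim by linarith
    thus ?case by (simp add: dist_real_def del: of_nat_Suc)
  qed
qed

section \<open>Asymptotics of the central moments\<close>

lemma tendsto_0_mult_bounded:
  fixes X Y :: "nat \<Rightarrow> real"
  assumes "X \<longlonglongrightarrow> 0" "eventually (\<lambda>n. \<bar>Y n\<bar> \<le> c) sequentially"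
  shows "(\<lambda>n. X n * Y n) \<longlonglongrightarrow> 0"
proof (rule Lim_null_comparison)
  show "eventually (\<lambda>n. norm (X n * Y n) \<le> \<bar>X n\<bar> * c) sequentially"
    using assms(2) by eventually_elim (auto simp: abs_mult intro: mult_left_mono)
  show "(\<lambda>n. \<bar>X n\<bar> * c) \<longlonglongrightarrow> 0"
    by (rule tendsto_mult_left_zero[OF tendsto_rabs_zero[OF assms(1)]])
qed

definition moment_error :: "nat \<Rightarrow> (nat \<Rightarrow> real) \<Rightarrow> real \<Rightarrow> nat \<Rightarrow> nat \<Rightarrow> real" where
  "moment_error m t v k n = central_moment m t k n - normal_moment v k * scale n ^ k"

definition forest_scale :: "nat list \<Rightarrow> real" where
  "forest_scale js = sqrt (real (sum_list (map Suc js)))"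

lemma forest_scale_Cons: "forest_scale (j # js) = sqrt ((scale j)\<^sup>2 + (forest_scale js)\<^sup>2)"
  by (simp add: forest_scale_def)

lemma forest_scale_le:
  "forest_seq L J \<Longrightarrow> eventually (\<lambda>n. forest_scale (J n) \<le> scale n) sequentially"
  unfolding forest_seq_def by (elim eventually_mono) (simp add: forest_scale_def del: of_nat_Suc)

lemma moment_error_0 [simp]: "moment_error m t v 0 n = 0"
  by (simp add: moment_error_def)

lemma scaled_normal_moment_bound:
  assumes "0 \<le> x" "x \<le> (s::real)" "s > 0"
  shows "\<bar>normal_moment v k * (x / s) ^ k\<bar> \<le> \<bar>normal_moment v k\<bar>"
proof -
  have "(x / s) ^ k \<le> 1" using assms by (intro power_le_one) auto
  moreover have "(x / s) ^ k \<ge> 0" using assms by simp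
  ultimately show ?thesis unfolding abs_mult by (intro mult_left_le) auto
qed

text \<open>Independent trees nearly have the normal moments of the summed variance. The tree errors
  of order i are subtracted, not assumed small, because for i = k they are the unknowns of the outer
  induction.\<close>

lemma forest_moments:
  assumes IH: "\<And>i. i < k \<Longrightarrow> (\<lambda>n. moment_error m t v i n / scale n ^ i) \<longlonglongrightarrow> 0"
    and "forest_seq L J" "i \<le> k"
  shows "(\<lambda>n. (sum_central_moment m t i (J n) - normal_moment v i * forest_scale (J n) ^ i
     - sum_list (map (moment_error m t v i) (J n))) / scale n ^ i) \<longlonglongrightarrow> 0"
  using assms(2,3)
proof (induction L arbitrary: J i)
  case 0
  hence "eventually (\<lambda>n. J n = []) sequentially" by (auto simp: forest_seq_def elim: eventually_mono)
  hence "eventually (\<lambda>n. (sum_central_moment m t i (J n) - normal_moment v i * forest_scale (J n) ^ i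
     - sum_list (map (moment_error m t v i) (J n))) / scale n ^ i = 0) sequentially"
    by eventually_elim (simp add: sum_central_moment_Nil forest_scale_def power_0_left)
  thus ?case by (rule tendsto_eventually)
next
  case (Suc L)
  define e where "e = moment_error m t v"
  define j T where "j n = hd (J n)" and "T n = tl (J n)" for n
  note J = forest_seq_Suc[OF Suc.prems(1), folded j_def T_def]
  show ?case
  proof (cases "i = 0")
    case True
    have "sum_list (map (moment_error m t v 0) js) = 0" for js by (induction js) auto
    thus ?thesis using True by simp
  next
    case False
    \<comment> \<open>A and B are the normal main terms of the first tree and of the rest, E and F
      their errors. The products A B convolve to the normal moment of the whole; the end terms l = 0
      and l = i keep F i and E i, and every other error term contains a factor that
      vanishes.\<close>
    define A E B F where "A l n = normal_moment v l * (scale (j n) / scale n) ^ l"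
      and "E l n = e l (j n) / scale n ^ l"
      and "B l n = normal_moment v l * (forest_scale (T n) / scale n) ^ l"
      and "F l n = (sum_central_moment m t l (T n) - normal_moment v l * forest_scale (T n) ^ l) / scale n ^ l" for l n
    define D where "D l n = A l n * F (i - l) n + E l n * B (i - l) n + E l n * F (i - l) n" for l n
    have Fi: "(\<lambda>n. F i n - sum_list (map (e i) (T n)) / scale n ^ i) \<longlonglongrightarrow> 0"
      using Suc.IH[OF J(1) Suc.prems(2)] by (simp add: F_def e_def diff_divide_distrib)
    have El: "E l \<longlonglongrightarrow> 0" and Fl: "F l \<longlonglongrightarrow> 0" if l: "0 < l" "l < i" for l
    proof -
      have lk: "l < k" using l Suc.prems(2) by simp
      have el: "(\<lambda>n. e l n / scale n ^ l) \<longlonglongrightarrow> 0" using IH[OF lk] by (simp add: e_def)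
      show "E l \<longlonglongrightarrow> 0" unfolding E_def using l by (intro tendsto_0_subtree[OF _ el J(3)]) simp
      have "(\<lambda>n. (sum_central_moment m t l (T n) - normal_moment v l * forest_scale (T n) ^ l
         - sum_list (map (e l) (T n))) / scale n ^ l + sum_list (map (e l) (T n)) / scale n ^ l) \<longlonglongrightarrow> 0 + 0"
        using l lk unfolding e_def
        by (intro tendsto_add Suc.IH[OF J(1)] tendsto_0_forest[OF _ el[unfolded e_def] J(1)]) auto
      thus "F l \<longlonglongrightarrow> 0" by (simp add: F_def[abs_def] diff_divide_distrib)
    qed
    have Ab: "eventually (\<lambda>n. \<bar>A l n\<bar> \<le> \<bar>normal_moment v l\<bar>) sequentially" for l
      using J(3) unfolding A_def
      by eventually_elim (rule scaled_normal_moment_bound; simp)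
    have Bb: "eventually (\<lambda>n. \<bar>B l n\<bar> \<le> \<bar>normal_moment v l\<bar>) sequentially" for l
      using forest_scale_le[OF J(1)] unfolding B_def
      by eventually_elim (rule scaled_normal_moment_bound; simp add: forest_scale_def)
    have Dl: "(\<lambda>n. real (i choose l) * D l n) \<longlonglongrightarrow> 0" if l: "l \<in> {1..<i}" for l
    proof -
      have l': "0 < l" "l < i" "0 < i - l" "i - l < i" using l by auto
      have "(\<lambda>n. F (i - l) n * A l n + E l n * B (i - l) n + E l n * F (i - l) n) \<longlonglongrightarrow> 0 + 0 + 0 * 0"
        by (intro tendsto_add tendsto_mult[OF El Fl] tendsto_0_mult_bounded[OF Fl Ab] tendsto_0_mult_bounded[OF El Bb] l')
      hence "D l \<longlonglongrightarrow> 0" by (simp add: D_def[abs_def] mult.commute)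
      thus ?thesis by (rule tendsto_mult_right_zero)
    qed
    have "(\<lambda>n. (F i n - sum_list (map (e i) (T n)) / scale n ^ i) + (\<Sum>l\<in>{1..<i}. real (i choose l) * D l n)) \<longlonglongrightarrow> 0 + 0"
      by (intro tendsto_add Fi tendsto_null_sum Dl)
    moreover have "eventually (\<lambda>n. (F i n - sum_list (map (e i) (T n)) / scale n ^ i) + (\<Sum>l\<in>{1..<i}. real (i choose l) * D l n)
       = (sum_central_moment m t i (J n) - normal_moment v i * forest_scale (J n) ^ i
           - sum_list (map (moment_error m t v i) (J n))) / scale n ^ i) sequentially"
      using J(2)
    proof eventually_elim
      case (elim n)
      have s: "scale n > 0" by simp
      have split: "(x * y) / scale n ^ i = (x / scale n ^ l) * (y / scale n ^ (i - l))" if "l \<le> i" for x y l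
        using that by (simp flip: power_add)
      have cm: "central_moment m t l (j n) / scale n ^ l = A l n + E l n" for l
        by (simp add: A_def E_def e_def moment_error_def power_divide diff_divide_distrib)
      have sm: "sum_central_moment m t l (T n) / scale n ^ l = B l n + F l n" for l
        by (simp add: B_def F_def power_divide diff_divide_distrib)
      have 1: "sum_central_moment m t i (J n) / scale n ^ i =
         (\<Sum>l\<le>i. real (i choose l) * ((A l n + E l n) * (B (i - l) n + F (i - l) n)))"
      proof -
        have "sum_central_moment m t i (J n) / scale n ^ i =
          (\<Sum>l\<le>i. real (i choose l) * ((central_moment m t l (j n) * sum_central_moment m t (i - l) (T n)) / scale n ^ i))"
          by (subst elim) (simp add: sum_central_moment_Cons sum_divide_distrib)
        also have "\<dots> = (\<Sum>l\<le>i. real (i choose l) * ((A l n + E l n) * (B (i - l) n + F (i - l) n)))"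
          by (intro sum.cong refl) (simp only: split cm sm atMost_iff)
        finally show ?thesis .
      qed
      have 2: "normal_moment v i * forest_scale (J n) ^ i / scale n ^ i = (\<Sum>l\<le>i. real (i choose l) * (A l n * B (i - l) n))"
      proof -
        have "forest_scale (J n) / scale n = sqrt ((scale (j n) / scale n)\<^sup>2 + (forest_scale (T n) / scale n)\<^sup>2)"
        proof -
          have "sqrt ((x / scale n)\<^sup>2 + (y / scale n)\<^sup>2) = sqrt (x\<^sup>2 + y\<^sup>2) / scale n" for x y
          proof -
            have "(x / scale n)\<^sup>2 + (y / scale n)\<^sup>2 = (x\<^sup>2 + y\<^sup>2) / (scale n)\<^sup>2"
              by (simp add: power_divide add_divide_distrib)
            thus ?thesis using s by (simp only: real_sqrt_divide real_sqrt_abs abs_of_pos)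
          qed
          thus ?thesis by (subst elim) (simp only: forest_scale_Cons)
        qed
        hence "normal_moment v i * (forest_scale (J n) / scale n) ^ i = (\<Sum>l\<le>i. real (i choose l) * (A l n * B (i - l) n))"
          unfolding A_def B_def normal_moment_binomial by simp
        thus ?thesis by (simp add: power_divide)
      qed
      have "{..i} = insert 0 (insert i {1..<i})" using False by auto
      hence 3: "(\<Sum>l\<le>i. real (i choose l) * D l n) = D 0 n + D i n + (\<Sum>l\<in>{1..<i}. real (i choose l) * D l n)"
        using False by simp
      have D0: "D 0 n = F i n" by (simp add: D_def A_def E_def e_def)
      have Di: "D i n = E i n" by (simp add: D_def B_def F_def)
      have 4: "sum_list (map (e i) (J n)) / scale n ^ i = E i n + sum_list (map (e i) (T n)) / scale n ^ i"
        by (subst elim) (simp add: E_def add_divide_distrib)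
      have "sum_central_moment m t i (J n) / scale n ^ i - normal_moment v i * forest_scale (J n) ^ i / scale n ^ i
         = (\<Sum>l\<le>i. real (i choose l) * D l n)"
        unfolding 1 2 D_def by (simp add: algebra_simps flip: sum_subtractf)
      thus ?case using 4 unfolding 3 D0 Di diff_divide_distrib e_def by linarith
    qed
    ultimately show ?thesis by (auto elim: Lim_transform_eventually)
  qed
qed

lemma forest_moments_lower:
  assumes IH: "\<And>i. i < k \<Longrightarrow> (\<lambda>n. moment_error m t v i n / scale n ^ i) \<longlonglongrightarrow> 0"
    and J: "forest_seq L J" and i: "i < k"
  shows "\<exists>c. eventually (\<lambda>n. \<bar>sum_central_moment m t i (J n) / scale n ^ i\<bar> \<le> c) sequentially"
proof (cases "i = 0")
  case True
  thus ?thesis by (intro exI[of _ 1]) simp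
next
  case False
  let ?e = "moment_error m t v i"
  have "(\<lambda>n. (sum_central_moment m t i (J n) - normal_moment v i * forest_scale (J n) ^ i
         - sum_list (map ?e (J n))) / scale n ^ i + sum_list (map ?e (J n)) / scale n ^ i) \<longlonglongrightarrow> 0 + 0"
    using False i by (intro tendsto_add forest_moments[OF IH J] tendsto_0_forest[OF _ IH[OF i] J]) auto
  hence "(\<lambda>n. (sum_central_moment m t i (J n) - normal_moment v i * forest_scale (J n) ^ i) / scale n ^ i) \<longlonglongrightarrow> 0"
    by (simp add: diff_divide_distrib)
  hence "eventually (\<lambda>n. \<bar>(sum_central_moment m t i (J n) - normal_moment v i * forest_scale (J n) ^ i) / scale n ^ i\<bar> < 1) sequentially"
    using tendstoD[of _ 0 sequentially 1] by (fastforce simp: dist_real_def)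
  with forest_scale_le[OF J]
  have "eventually (\<lambda>n. \<bar>sum_central_moment m t i (J n) / scale n ^ i\<bar> \<le> 1 + \<bar>normal_moment v i\<bar>) sequentially"
  proof eventually_elim
    case (elim n)
    have "\<bar>normal_moment v i * (forest_scale (J n) / scale n) ^ i\<bar> \<le> \<bar>normal_moment v i\<bar>"
      using elim(1) by (intro scaled_normal_moment_bound) (auto simp: forest_scale_def)
    moreover have "sum_central_moment m t i (J n) / scale n ^ i =
       (sum_central_moment m t i (J n) - normal_moment v i * forest_scale (J n) ^ i) / scale n ^ i
        + normal_moment v i * (forest_scale (J n) / scale n) ^ i"
      by (simp add: diff_divide_distrib power_divide)
    ultimately show ?case using elim(2) by linarith
  qed
  thus ?thesis by blast
qed

text \<open>In the recursion every term with i < k carries a positive power of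
  \<open>split_error\<close>, which is o(sqrt n) uniformly over splits. Only the term i = k
  survives, and it leads to the contraction.\<close>

theorem central_moment_asymptotics:
  assumes m: "m \<ge> 2" and var: "(\<lambda>n. var_X m t n / real (n + 1)) \<longlonglongrightarrow> v"
    and err: "\<And>J. (\<And>n. J n \<in> comps m (n - (m - 1))) \<Longrightarrow> (\<lambda>n. split_error m t n (J n) / scale n) \<longlonglongrightarrow> 0"
  shows "(\<lambda>n. moment_error m t v k n / scale n ^ k) \<longlonglongrightarrow> 0"
proof (induction k rule: less_induct)
  case (less k)
  consider "k = 0" | "k = 1" | "k = 2" | "k \<ge> 3" by linarith
  thus ?case
  proof cases
    case 3
    have "(\<lambda>n. var_X m t n / real (n + 1) - v) \<longlonglongrightarrow> v - v" by (intro tendsto_intros var)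
    moreover have "moment_error m t v 2 n / (scale n)\<^sup>2 = var_X m t n / real (n + 1) - v" for n
      by (simp add: moment_error_def central_moment_2 diff_divide_distrib add.commute)
    ultimately show ?thesis using 3 by simp
  next
    case 4
    define e where "e = moment_error m t v k"
    define H where "H n js = (\<Sum>i\<le>k. real (k choose i) * (sum_central_moment m t i js * split_error m t n js ^ (k - i)))" for n js
    \<comment> \<open>What remains of the contribution of one split after removing the normal moment
      and the errors of its subtrees. Its value at a worst split bounds the forcing.\<close>
    define G where "G n js = H n js - normal_moment v k * scale n ^ k - sum_list (map e js)" for n js
    obtain J where J: "\<And>n. J n \<in> comps m (n - (m - 1))"
      "\<And>n js. js \<in> comps m (n - (m - 1)) \<Longrightarrow> \<bar>G n js\<bar> \<le> \<bar>G n (J n)\<bar>"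
      using worst_split[of m G] m by auto
    have fJ: "forest_seq m J" using m J(1) by (intro forest_seq_comps) auto
    have errJ: "(\<lambda>n. split_error m t n (J n) / scale n) \<longlonglongrightarrow> 0" by (rule err[OF J(1)])
    have lower: "(\<lambda>n. real (k choose i) * ((split_error m t n (J n) / scale n) ^ (k - i) * (sum_central_moment m t i (J n) / scale n ^ i))) \<longlonglongrightarrow> 0"
      if i: "i \<in> {..<k}" for i
    proof -
      obtain c where c: "eventually (\<lambda>n. \<bar>sum_central_moment m t i (J n) / scale n ^ i\<bar> \<le> c) sequentially"
        using forest_moments_lower[OF less.IH fJ, of k i] i by auto
      have "(\<lambda>n. (split_error m t n (J n) / scale n) ^ (k - i)) \<longlonglongrightarrow> 0 ^ (k - i)"
        by (intro tendsto_power errJ)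
      hence "(\<lambda>n. (split_error m t n (J n) / scale n) ^ (k - i)) \<longlonglongrightarrow> 0" using i by (simp add: power_0_left)
      from tendsto_0_mult_bounded[OF this c] show ?thesis by (rule tendsto_mult_right_zero)
    qed
    have "(\<lambda>n. (sum_central_moment m t k (J n) - normal_moment v k * forest_scale (J n) ^ k - sum_list (map e (J n))) / scale n ^ k
      + (\<Sum>i<k. real (k choose i) * ((split_error m t n (J n) / scale n) ^ (k - i) * (sum_central_moment m t i (J n) / scale n ^ i)))) \<longlonglongrightarrow> 0 + 0"
      unfolding e_def by (intro tendsto_add forest_moments[OF less.IH fJ] tendsto_null_sum lower) auto
    moreover have "eventually (\<lambda>n. (sum_central_moment m t k (J n) - normal_moment v k * forest_scale (J n) ^ k - sum_list (map e (J n))) / scale n ^ k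
      + (\<Sum>i<k. real (k choose i) * ((split_error m t n (J n) / scale n) ^ (k - i) * (sum_central_moment m t i (J n) / scale n ^ i)))
      = G n (J n) / scale n ^ k) sequentially"
      using eventually_ge_at_top[of "m - 1"]
    proof eventually_elim
      case (elim n)
      have fs: "forest_scale (J n) = scale n"
        using sum_list_Suc_comps[OF J(1)[of n]] elim m by (simp add: forest_scale_def)
      have "(split_error m t n (J n) / scale n) ^ (k - i) * (sum_central_moment m t i (J n) / scale n ^ i) =
         sum_central_moment m t i (J n) * split_error m t n (J n) ^ (k - i) / scale n ^ k" if "i < k" for i
        using that by (simp add: power_divide mult.commute flip: power_add)
      hence "(\<Sum>i<k. real (k choose i) * ((split_error m t n (J n) / scale n) ^ (k - i) * (sum_central_moment m t i (J n) / scale n ^ i)))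
         = (\<Sum>i<k. real (k choose i) * (sum_central_moment m t i (J n) * split_error m t n (J n) ^ (k - i))) / scale n ^ k"
        unfolding sum_divide_distrib by (intro sum.cong) auto
      moreover have "H n (J n) = (\<Sum>i<k. real (k choose i) * (sum_central_moment m t i (J n) * split_error m t n (J n) ^ (k - i)))
         + sum_central_moment m t k (J n)"
        by (simp add: H_def flip: lessThan_Suc_atMost)
      ultimately show ?case
        by (simp only: G_def fs diff_divide_distrib add_divide_distrib)
    qed
    ultimately have "(\<lambda>n. G n (J n) / scale n ^ k) \<longlonglongrightarrow> 0" by (auto elim: Lim_transform_eventually)
    hence R: "(\<lambda>n. \<bar>G n (J n)\<bar> / scale n ^ k) \<longlonglongrightarrow> 0"
      using tendsto_rabs_zero by (fastforce simp: abs_divide)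
    have "\<bar>e n\<bar> \<le> split_avg m (\<lambda>j. \<bar>e j\<bar>) n + \<bar>G n (J n)\<bar>" if n: "m - 1 \<le> n" for n
    proof -
      let ?I = "comps m (n - (m - 1))" and ?c = "real (n choose (m - 1))"
      have c: "?c > 0" using n by simp
      have "central_moment m t k n = (\<Sum>js\<in>?I. H n js) / ?c"
        unfolding H_def by (rule central_moment_recursion[OF m n])
      also have "(\<Sum>js\<in>?I. H n js) = (\<Sum>js\<in>?I. G n js) + (\<Sum>js\<in>?I. sum_list (map e js)) + ?c * (normal_moment v k * scale n ^ k)"
        using card_comps_choose[of m n] m n by (simp add: G_def sum_subtractf)
      finally have "e n = (\<Sum>js\<in>?I. G n js) / ?c + (\<Sum>js\<in>?I. sum_list (map e js)) / ?c"
        using c by (simp add: e_def moment_error_def add_divide_distrib)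
      moreover have "\<bar>(\<Sum>js\<in>?I. G n js) / ?c\<bar> \<le> \<bar>G n (J n)\<bar>"
        using m n J(2)[of _ n] by (intro split_avg_const_bound) auto
      moreover have "\<bar>(\<Sum>js\<in>?I. sum_list (map e js)) / ?c\<bar> \<le> split_avg m (\<lambda>j. \<bar>e j\<bar>) n"
      proof -
        have "\<bar>\<Sum>js\<in>?I. sum_list (map e js)\<bar> \<le> (\<Sum>js\<in>?I. \<bar>sum_list (map e js)\<bar>)" by (rule sum_abs)
        also have "\<dots> \<le> (\<Sum>js\<in>?I. sum_list (map (\<lambda>j. \<bar>e j\<bar>) js))"
        proof (rule sum_mono)
          fix js show "\<bar>sum_list (map e js)\<bar> \<le> sum_list (map (\<lambda>j. \<bar>e j\<bar>) js)"
            using sum_list_abs[of "map e js"] by (simp add: o_def)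
        qed
        finally show ?thesis using n c by (simp add: split_avg_def abs_divide divide_right_mono)
      qed
      ultimately show ?thesis by linarith
    qed
    from contraction_tendsto_0[OF m 4 this R] show ?thesis by (simp add: e_def)
  qed (simp_all add: moment_error_def central_moment_1)
qed

section \<open>Convergence in distribution\<close>

text \<open>The Taylor polynomial of degree 2p of a characteristic function has error controlled by
  the moment of order 2p. For the limit law this error tends to 0 in p, so p is fixed first and then
  n tends to infinity.\<close>

theorem weak_conv_normal_moments:
  fixes M :: "nat \<Rightarrow> real measure" and M' :: "real measure"
  assumes rd: "\<And>n. real_distribution (M n)" "real_distribution M'"
    and int: "\<And>n k. integrable (M n) (\<lambda>x. x ^ k)" "\<And>k. integrable M' (\<lambda>x. x ^ k)"
    and M': "\<And>k. (\<integral>x. x ^ k \<partial>M') = normal_moment v k"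
    and lim: "\<And>k. (\<lambda>n. \<integral>x. x ^ k \<partial>M n) \<longlonglongrightarrow> normal_moment v k"
  shows "weak_conv_m M M'"
proof (rule levy_continuity[OF rd])
  fix \<tau> :: real
  define S where "S p N = (\<Sum>k\<le>2 * p. ((\<i> * of_real \<tau>) ^ k / fact k) * of_real (\<integral>x. x ^ k \<partial>N))"
    for p and N :: "real measure"
  define B where "B p N = 2 * \<bar>\<tau>\<bar> ^ (2 * p) / fact (2 * p) * (\<integral>x. x ^ (2 * p) \<partial>N)" for p and N :: "real measure"
  have approx: "cmod (char N \<tau> - S p N) \<le> B p N"
    if "real_distribution N" "\<And>k. integrable N (\<lambda>x. x ^ k)" for N p
    using real_distribution.char_approx1[OF that(1), of "2 * p" \<tau>] that(2)
    by (simp add: S_def B_def power_even_abs)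
  have limS: "(\<lambda>n. S p (M n)) \<longlonglongrightarrow> S p M'" for p
    unfolding S_def M' by (intro tendsto_intros lim)
  have limB: "(\<lambda>n. B p (M n)) \<longlonglongrightarrow> B p M'" for p
    unfolding B_def M' by (intro tendsto_intros lim)
  \<comment> \<open>The factor (2p)! cancels between the Taylor bound and the normal moment, leaving
    a term of an exponential series.\<close>
  have B_eq: "B p M' = 2 * ((\<tau>\<^sup>2 * v / 2) ^ p / fact p)" for p
  proof -
    have "\<bar>\<tau>\<bar> ^ (2 * p) = (\<tau>\<^sup>2) ^ p" by (simp add: power_mult)
    moreover have "normal_moment v (2 * p) = v ^ p * (fact (2 * p) / (2 ^ p * fact p))"
      by (simp add: normal_moment_def)
    moreover have "(\<tau>\<^sup>2 * v / 2) ^ p = (\<tau>\<^sup>2) ^ p * v ^ p / 2 ^ p"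
      by (simp only: power_divide power_mult_distrib)
    moreover have "fact (2 * p) \<noteq> (0::real)" by simp
    ultimately show ?thesis unfolding B_def M' by (simp del: fact_nonzero)
  qed
  have "(\<lambda>p. (\<tau>\<^sup>2 * v / 2) ^ p / fact p) \<longlonglongrightarrow> 0"
    using summable_LIMSEQ_zero[OF summable_exp[of "\<tau>\<^sup>2 * v / 2"]]
    by (simp only: divide_inverse mult.commute)
  hence B0: "(\<lambda>p. B p M') \<longlonglongrightarrow> 0" unfolding B_eq by (rule tendsto_mult_right_zero)
  show "(\<lambda>n. char (M n) \<tau>) \<longlonglongrightarrow> char M' \<tau>"
  proof (rule tendstoI)
    fix \<epsilon> :: real assume "\<epsilon> > 0"
    have "eventually (\<lambda>p. B p M' < \<epsilon> / 4) sequentially"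
      using B0 \<open>\<epsilon> > 0\<close> by (intro order_tendstoD) auto
    then obtain p where p: "B p M' < \<epsilon> / 4" by (auto simp: eventually_sequentially)
    have e1: "eventually (\<lambda>n. B p (M n) < \<epsilon> / 4) sequentially" using limB p by (intro order_tendstoD)
    have e2: "eventually (\<lambda>n. dist (S p (M n)) (S p M') < \<epsilon> / 4) sequentially"
      using limS \<open>\<epsilon> > 0\<close> by (intro tendstoD) auto
    show "eventually (\<lambda>n. dist (char (M n) \<tau>) (char M' \<tau>) < \<epsilon>) sequentially"
      using e1 e2
    proof eventually_elim
      case (elim n)
      have "dist (char (M n) \<tau>) (char M' \<tau>) \<le>
         dist (char (M n) \<tau>) (S p (M n)) + dist (S p (M n)) (S p M') + dist (S p M') (char M' \<tau>)"
        using dist_triangle[of "char (M n) \<tau>" "char M' \<tau>" "S p (M n)"]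
          dist_triangle[of "S p (M n)" "char M' \<tau>" "S p M'"] by linarith
      also have "\<dots> < \<epsilon> / 4 + \<epsilon> / 4 + \<epsilon> / 4"
        using approx[OF rd(1) int(1), of n p] approx[OF rd(2) int(2), of p] elim p
        by (simp add: dist_norm norm_minus_commute)
      finally show ?case using \<open>\<epsilon> > 0\<close> by simp
    qed
  qed
qed

lemma normal_dist_0:
  assumes "v \<ge> 0"
  shows "real_distribution (normal_dist 0 v)" "integrable (normal_dist 0 v) (\<lambda>x. x ^ k)"
    "(\<integral>x. x ^ k \<partial>normal_dist 0 v) = normal_moment v k"
proof -
  have "real_distribution (normal_dist 0 v) \<and> integrable (normal_dist 0 v) (\<lambda>x. x ^ k)
    \<and> (\<integral>x. x ^ k \<partial>normal_dist 0 v) = normal_moment v k"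
  proof (cases "v = 0")
    case True
    have "real_distribution (return borel (0::real))"
      by (simp add: real_distribution_def real_distribution_axioms_def prob_space_return)
    moreover have "integrable (return borel (0::real)) (\<lambda>x. x ^ k)"
      by (rule integrableI_bounded) (auto simp: nn_integral_return)
    moreover have "(\<integral>x. x ^ k \<partial>return borel (0::real)) = normal_moment v k"
      using True by (subst integral_return) (auto simp: normal_moment_def power_0_left)
    ultimately show ?thesis using True by (simp add: normal_dist_def)
  next
    case False
    define s where "s = sqrt v"
    have s: "s > 0" "s\<^sup>2 = v" using False assms by (auto simp: s_def)
    let ?N = "density lborel (normal_density 0 s)"
    have "prob_space ?N" by (rule prob_space_normal_density[OF s(1)])
    hence "real_distribution ?N" by (simp add: real_distribution_def real_distribution_axioms_def)
    moreover have "integrable ?N (\<lambda>x. x ^ k)"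
      using integrable_normal_moment[OF s(1), of 0 k] by (simp add: integrable_density normal_density_nonneg)
    moreover have "(\<integral>x. x ^ k \<partial>?N) = normal_moment v k"
    proof -
      have "(\<integral>x. x ^ k \<partial>?N) = (\<integral>x. normal_density 0 s x * x ^ k \<partial>lborel)"
        by (subst integral_density) (auto simp: normal_density_nonneg)
      also have "\<dots> = normal_moment v k"
      proof (cases "even k")
        case True
        then obtain p where "k = 2 * p" by (elim evenE)
        thus ?thesis using integral_normal_moment_even[OF s(1), of 0 p]
          by (simp add: normal_moment_def s(2) power_divide)
      next
        case False
        then obtain p where "k = 2 * p + 1" by (elim oddE)
        thus ?thesis using integral_normal_moment_odd[OF s(1), of 0 p]
          by (simp add: normal_moment_def)
      qed
      finally show ?thesis .
    qed
    ultimately show ?thesis using False by (simp add: normal_dist_def s_def)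
  qed
  thus "real_distribution (normal_dist 0 v)" "integrable (normal_dist 0 v) (\<lambda>x. x ^ k)"
    "(\<integral>x. x ^ k \<partial>normal_dist 0 v) = normal_moment v k" by auto
qed

lemma normalized_X:
  shows "real_distribution (normalized_X m t c n)" "integrable (normalized_X m t c n) (\<lambda>x. x ^ k)"
    "(\<integral>x. x ^ k \<partial>normalized_X m t c n) =
       (\<Sum>i\<le>k. real (k choose i) * ((central_moment m t i n / sqrt (real n) ^ i) *
          ((mean_X m t n - c * real n) / sqrt (real n)) ^ (k - i)))"
proof -
  let ?p = "X_dist m t n" and ?\<delta> = "mean_X m t n - c * real n" and ?s = "sqrt (real n)"
  show "real_distribution (normalized_X m t c n)"
    unfolding normalized_X_def by (rule prob_space.real_distribution_distr[OF prob_space_measure_pmf]) simp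
  show "integrable (normalized_X m t c n) (\<lambda>x. x ^ k)"
    unfolding normalized_X_def by (subst integrable_distr_eq) (auto intro: integrable_measure_pmf_finite)
  have "(\<integral>x. x ^ k \<partial>normalized_X m t c n) = expect ?p (\<lambda>x. ((x - c * real n) / ?s) ^ k)"
    unfolding normalized_X_def by (subst integral_distr) auto
  also have "\<dots> = expect ?p (\<lambda>x. \<Sum>i\<le>k. (real (k choose i) * (?\<delta> / ?s) ^ (k - i) / ?s ^ i) * (x - mean_X m t n) ^ i)"
  proof -
    have "((x - c * real n) / ?s) ^ k = (\<Sum>i\<le>k. (real (k choose i) * (?\<delta> / ?s) ^ (k - i) / ?s ^ i) * (x - mean_X m t n) ^ i)" for x
    proof -
      have "(x - c * real n) / ?s = (x - mean_X m t n) / ?s + ?\<delta> / ?s" by (simp add: add_divide_distrib[symmetric])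
      hence "((x - c * real n) / ?s) ^ k = (\<Sum>i\<le>k. real (k choose i) * ((x - mean_X m t n) / ?s) ^ i * (?\<delta> / ?s) ^ (k - i))"
        by (simp only: binomial_ring)
      thus ?thesis by (simp add: power_divide mult_ac)
    qed
    thus ?thesis by simp
  qed
  also have "\<dots> = (\<Sum>i\<le>k. (real (k choose i) * (?\<delta> / ?s) ^ (k - i) / ?s ^ i) * central_moment m t i n)"
    by (subst expect_sum) (simp_all add: central_moment_def)
  finally show "(\<integral>x. x ^ k \<partial>normalized_X m t c n) =
       (\<Sum>i\<le>k. real (k choose i) * ((central_moment m t i n / ?s ^ i) * (?\<delta> / ?s) ^ (k - i)))"
    by (simp add: mult_ac)
qed

text \<open>Changing the scale from sqrt (n + 1) to sqrt n costs a factor tending to 1. In the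
  binomial expansion around the true mean only i = k survives, as the centring error
  vanishes.\<close>

lemma normalized_X_moments_tendsto:
  assumes mom: "\<And>k. (\<lambda>n. central_moment m t k n / scale n ^ k) \<longlonglongrightarrow> normal_moment v k"
    and mean: "(\<lambda>n. (mean_X m t n - c * real n) / sqrt (real n)) \<longlonglongrightarrow> 0"
  shows "(\<lambda>n. \<integral>x. x ^ k \<partial>normalized_X m t c n) \<longlonglongrightarrow> normal_moment v k"
proof -
  have cm: "(\<lambda>n. central_moment m t i n / sqrt (real n) ^ i) \<longlonglongrightarrow> normal_moment v i" for i
  proof -
    have "(\<lambda>n. scale n / sqrt (real n)) \<longlonglongrightarrow> 1" by real_asymp
    hence "(\<lambda>n. (central_moment m t i n / scale n ^ i) * (scale n / sqrt (real n)) ^ i) \<longlonglongrightarrow> normal_moment v i * 1 ^ i"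
      by (intro tendsto_mult tendsto_power mom)
    thus ?thesis by (simp add: power_divide)
  qed
  have "(\<lambda>n. \<Sum>i\<le>k. real (k choose i) * ((central_moment m t i n / sqrt (real n) ^ i) *
          ((mean_X m t n - c * real n) / sqrt (real n)) ^ (k - i)))
      \<longlonglongrightarrow> (\<Sum>i\<le>k. real (k choose i) * (normal_moment v i * 0 ^ (k - i)))"
    by (intro tendsto_intros cm mean)
  also have "(\<Sum>i\<le>k. real (k choose i) * (normal_moment v i * 0 ^ (k - i))) = (\<Sum>i\<le>k. if i = k then normal_moment v k else 0)"
    by (intro sum.cong) (auto simp: power_0_left)
  also have "\<dots> = normal_moment v k" by simp
  finally show ?thesis unfolding normalized_X(3) .
qed

theorem theorem5p1:
  fixes m :: nat and t :: "nat \<Rightarrow> real"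
  assumes "2 \<le> m" and "m \<le> 26"
    and "t \<in> o(\<lambda>n. sqrt (real n))"
    and "\<exists>\<delta>. 0 < \<delta> \<and> \<delta> < 1 \<and> summable (\<lambda>n. window_max t \<delta> (Suc n) / real (Suc n))"
  shows "summable (\<lambda>j. t j / (real (j + 1) * real (j + 2)))
    \<and> (\<lambda>n. mean_X m t n - mu_const m t * real n) \<in> o(\<lambda>n. sqrt (real n))
    \<and> summable (\<lambda>j. r_seq m t j / (real (j + 1) * real (j + 2)))
    \<and> (\<lambda>n. var_X m t n - sigma_sq m t * real n) \<in> o(\<lambda>n. real n)
    \<and> weak_conv_m (normalized_X m t (mu_const m t)) (normal_dist 0 (sigma_sq m t))
    \<and> (\<forall>k::nat. (\<lambda>n. \<integral>x. x ^ k \<partial>normalized_X m t (mu_const m t) n)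
          \<longlonglongrightarrow> (\<integral>x. x ^ k \<partial>normal_dist 0 (sigma_sq m t)))"
proof -
  let ?c = "mu_const m t" and ?v = "sigma_sq m t"
  obtain \<delta> where "0 < \<delta>" "\<delta> < 1" "summable (\<lambda>n. window_max t \<delta> (Suc n) / real (Suc n))"
    using assms(4) by blast
  note toll = toll_conditions[OF assms(3) this(3,1,2)]
  note mean = mean_X_asymptotics[OF assms(1,2) toll(2,3,4)]
  note r = r_seq_summable[OF assms(1) toll(3) mean(2)] r_seq_tendsto_0[OF assms(1) toll(1) mean(1)]
  note var = var_X_asymptotics[OF assms(1,2) r]
  have err: "(\<lambda>n. split_error m t n (J n) / scale n) \<longlonglongrightarrow> 0"
    if "\<And>n. J n \<in> comps m (n - (m - 1))" for J
    using assms(1) by (intro split_error_tendsto_0[OF _ toll(1) mean(1) that]) auto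
  have mom: "(\<lambda>n. central_moment m t k n / scale n ^ k) \<longlonglongrightarrow> normal_moment ?v k" for k
  proof -
    have "(\<lambda>n. moment_error m t ?v k n / scale n ^ k + normal_moment ?v k) \<longlonglongrightarrow> 0 + normal_moment ?v k"
      by (intro tendsto_intros central_moment_asymptotics[OF assms(1) var err])
    thus ?thesis by (simp add: moment_error_def diff_divide_distrib)
  qed
  have "var_X m t n / real (n + 1) \<ge> 0" for n
    unfolding var_X_def by (intro divide_nonneg_nonneg integral_nonneg) auto
  hence v: "?v \<ge> 0" using LIMSEQ_le_const[OF var] by blast
  have mean': "(\<lambda>n. (mean_X m t n - ?c * real n) / sqrt (real n)) \<longlonglongrightarrow> 0"
  proof -
    have "(\<lambda>n. ((mean_X m t n - ?c * real (n + 1)) / scale n + ?c / scale n) * (scale n / sqrt (real n)))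
        \<longlonglongrightarrow> (0 + 0) * 1"
    proof (intro tendsto_mult tendsto_add mean(1))
      have "(\<lambda>n. ?c * (1 / scale n)) \<longlonglongrightarrow> 0" by (intro tendsto_mult_right_zero) real_asymp
      thus "(\<lambda>n. ?c / scale n) \<longlonglongrightarrow> 0" by simp
      show "(\<lambda>n. scale n / sqrt (real n)) \<longlonglongrightarrow> 1" by real_asymp
    qed
    moreover have "((mean_X m t n - ?c * real (n + 1)) / scale n + ?c / scale n) * (scale n / sqrt (real n)) =
        (mean_X m t n - ?c * real n) / sqrt (real n)" for n
    proof -
      have "(mean_X m t n - ?c * real (n + 1)) / scale n + ?c / scale n = (mean_X m t n - ?c * real n) / scale n"
        by (simp add: algebra_simps flip: add_divide_distrib)
      moreover have "scale n \<noteq> 0" by simp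
      ultimately show ?thesis by (simp del: of_nat_Suc)
    qed
    ultimately show ?thesis by (simp only: add_0 mult_zero_left)
  qed
  have lim: "(\<lambda>n. \<integral>x. x ^ k \<partial>normalized_X m t ?c n) \<longlonglongrightarrow> normal_moment ?v k" for k
    by (rule normalized_X_moments_tendsto[OF mom mean'])
  show ?thesis
  proof (intro conjI allI)
    show "summable (\<lambda>j. t j / (real (j + 1) * real (j + 2)))"
      using summable_norm_cancel[of "\<lambda>n. t n * weight n"] toll(4) weight_pos
      by (simp add: abs_mult abs_of_pos weight_times)
    show "summable (\<lambda>j. r_seq m t j / (real (j + 1) * real (j + 2)))"
      using summable_norm_cancel[of "\<lambda>n. r_seq m t n * weight n"] r(1) weight_pos
      by (simp add: abs_mult abs_of_pos weight_times)
    show "(\<lambda>n. mean_X m t n - ?c * real n) \<in> o(\<lambda>n. sqrt (real n))"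
      using mean' eventually_gt_at_top[of "0::nat"]
      by (intro smalloI_tendsto) (auto elim: eventually_mono)
    have "(\<lambda>n. var_X m t n / real (n + 1) * (real (n + 1) / real n) - ?v) \<longlonglongrightarrow> ?v * 1 - ?v"
      by (intro tendsto_intros var) real_asymp
    moreover have "eventually (\<lambda>n. var_X m t n / real (n + 1) * (real (n + 1) / real n) - ?v =
        (var_X m t n - ?v * real n) / real n) sequentially"
      using eventually_gt_at_top[of "0::nat"]
      by eventually_elim (simp add: diff_divide_distrib del: of_nat_Suc of_nat_add)
    ultimately have "(\<lambda>n. (var_X m t n - ?v * real n) / real n) \<longlonglongrightarrow> 0"
      by (auto elim: Lim_transform_eventually)
    thus "(\<lambda>n. var_X m t n - ?v * real n) \<in> o(\<lambda>n. real n)"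
      using eventually_gt_at_top[of "0::nat"]
      by (intro smalloI_tendsto) (auto elim: eventually_mono)
    show "weak_conv_m (normalized_X m t ?c) (normal_dist 0 ?v)"
      by (rule weak_conv_normal_moments[OF normalized_X(1) normal_dist_0(1)[OF v] normalized_X(2)
            normal_dist_0(2)[OF v] normal_dist_0(3)[OF v] lim])
    show "(\<lambda>n. \<integral>x. x ^ k \<partial>normalized_X m t ?c n) \<longlonglongrightarrow> (\<integral>x. x ^ k \<partial>normal_dist 0 ?v)" for k
      unfolding normal_dist_0(3)[OF v] by (rule lim)
  qed
qed

end
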